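(* Let $(X,\mathsf d)$ be a complete and separable metric space and $n\ge1$. Let $T$ be an $n$-current on $X$. Then $T$ is a tight element of $\mathcal D^n(X)'$. In particular, $T$ induces a unique local vector measure $\mathsf N_T$ defined on $\mathcal D^n(X)$ such that $$\mathsf N_T(A)(v)=T(v)\quad\text{for every open }A\subseteq X\text{ and every }v\in\mathcal D^n(X)\text{ with }\operatorname{supp}v\subseteq A.\qquad( * )$$ Moreover $\|T\|_{\mathrm{AK}}=|\mathsf N_T|$ as measures. Conversely, every tight element of $\mathcal D^n(X)'$ satisfying axiom (ii) in the definition of $n$-current is an $n$-current; in other words, every local vector measure $\mathsf N$ defined on $\mathcal D^n(X)$ such that $\mathsf N(X)$ satisfies axiom (ii) is given by an $n$-current $T$, in the sense that $( * )$ holds with $\mathsf N$ in place of $\mathsf N_T$.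
   Context: **Currents** (Ambrosio–Kirchheim). $\mathrm{LIP}(X)$, $\mathrm{LIP}_b(X)$ denote the Lipschitz and the bounded Lipschitz real functions on $X$, $\mathrm{Lip}(\pi)$ the Lipschitz constant. An $n$-current is a multilinear map $T:\mathrm{LIP}_b(X)\times\mathrm{LIP}(X)^n\to\mathbb R$ such that: (i) there is a finite positive Borel measure $\mu$ with $|T(f,\pi_1,\dots,\pi_n)|\le\prod_j\mathrm{Lip}(\pi_j)\int_X|f|\,\mathrm d\mu$ for all $f\in\mathrm{LIP}_b(X)$, $\pi_j\in\mathrm{LIP}(X)$; the minimal such $\mu$ (which exists) is the mass $\|T\|_{\mathrm{AK}}$; (ii) if $f\in\mathrm{LIP}_b(X)$ and, for $j=1,\dots,n$, $\{\pi_j^i\}_i\subseteq\mathrm{LIP}(X)$ is a sequence of equi-Lipschitz functions with $\pi^i_j\to\pi_j$ pointwise, then $\lim_iT(f,\pi_1^i,\dots,\pi_n^i)=T(f,\pi_1,\dots,\pi_n)$; (iii) if $f\in\mathrm{LIP}_b(X)$ and for some $j$ the function $\pi_j$ is constant on a neighbourhood of $\{f\ne0\}$, then $T(f,\pi_1,\dots,\pi_n)=0$. By (i), $T$ extends uniquely to $C_b(X)\times\mathrm{LIP}(X)^n$ still satisfying the inequality in (i); it is alternating in the last $n$ entries, hence is regarded as a linear map on the algebraic tensor product (over $\mathbb R$) $C_b(X)\otimes\bigwedge^n\mathrm{LIP}(X)$, where $f\,\mathrm d\pi_1\wedge\dots\wedge\mathrm d\pi_n$ denotes the image of $(f,\pi_1,\dots,\pi_n)$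 and $T(f\,\mathrm d\pi_1\wedge\dots\wedge\mathrm d\pi_n):=T(f,\pi_1,\dots,\pi_n)$. **The space $\mathcal D^n(X)$.** On $C_b(X)\otimes\bigwedge^n\mathrm{LIP}(X)$ consider the seminorm $\|v\|:=\sup\{T(v):T\ n\text{-current},\ \|T\|_{\mathrm{AK}}(X)\le1\}$. $\mathcal D^n(X)$ is the quotient by the elements of zero seminorm; with the product by $C_b(X)$ functions acting on the first factor it is a normed $C_b(X)$-module in the sense below. An element $F\in\mathcal D^n(X)'$ is identified with the map $(f,\pi_1,\dots,\pi_n)\mapsto F(f\,\mathrm d\pi_1\wedge\dots\wedge\mathrm d\pi_n)$; saying that $F$ satisfies (ii), or is a current, refers to this map (restricted to $f\in\mathrm{LIP}_b(X)$). **Local vector measures.** A normed $C_b(X)$-module is a normed space $(\mathcal V,\|\cdot\|)$ that is algebraically a module over $C_b(X)$ with $\|\sum_if_iv_i\|\le\max_i\|f_i\|_\infty\max_i\|v_i\|$ for finitely many $v_i\in\mathcal V$ and $f_i\in C_b(X)$ with pairwise disjoint supports. For $A$ open, $\|v\|_{|A}:=\sup\{\|fv\|:f\in C_b(X),\operatorname{supp}f\subseteq A,\|f\|_\infty\le1\}$. For $C$ closed, $\operatorname{supp}v\subseteq C$ means $\|v\|_{|X\setminus C}=0$; for $B$ Borel, $\operatorname{supp}v\subseteq B$ means $\operatorname{supp}v\subseteq C$ for some closed $C\subseteq B$. A local vector measure on $\mathcal V$ is a map $\mathsf N$ from the Borel sets of $X$ to the dual $(\mathcal V',\|\cdot\|')$,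 $\sigma$-additive with respect to norm convergence, with $\mathsf N(A)(v)=0$ whenever $A$ is open and $\|v\|_{|A}=0$. Its total variation is $|\mathsf N|(E):=\sup_\pi\sum_{A\in\pi}\|\mathsf N(A)\|'$, over finite Borel partitions $\pi$ of $E$. $F\in\mathcal V'$ is tight if $F(\varphi_nv)\to0$ for every $v\in\mathcal V$ and every $\{\varphi_n\}_n\subseteq C_b(X)$ with $\varphi_n(x)\searrow0$ for every $x\in X$. *)

theory Defs
  imports "HOL-Analysis.Analysis"
begin

section \<open>Lipschitz functions and bounded continuous functions\<close>

typedef (overloaded) 'a lip = "{f :: 'a::metric_space \<Rightarrow> real. \<exists>L. L-lipschitz_on UNIV f}"
  morphisms apply_lip Abs_lip
  using lipschitz_on_constant by blast

declare [[coercion apply_lip]]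

setup_lifting type_definition_lip

instantiation lip :: (metric_space) real_vector
begin

lift_definition zero_lip :: "'a lip" is "\<lambda>_. 0"
  using lipschitz_on_constant by blast

lift_definition plus_lip :: "'a lip \<Rightarrow> 'a lip \<Rightarrow> 'a lip" is "\<lambda>f g x. f x + g x"
  using lipschitz_on_add by blast

lift_definition uminus_lip :: "'a lip \<Rightarrow> 'a lip" is "\<lambda>f x. - f x"
  using lipschitz_on_minus by blast

lift_definition minus_lip :: "'a lip \<Rightarrow> 'a lip \<Rightarrow> 'a lip" is "\<lambda>f g x. f x - g x"
  using lipschitz_on_diff by blast

lift_definition scaleR_lip :: "real \<Rightarrow> 'a lip \<Rightarrow> 'a lip" is "\<lambda>c f x. c * f x"
  using lipschitz_on_cmult_real by blast

instance
  by standard (transfer; auto simp: algebra_simps)+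

end

lifting_update lip.lifting
lifting_forget lip.lifting

definition Lip :: "'a::metric_space lip \<Rightarrow> real" where
  "Lip \<pi> = Inf {L. L-lipschitz_on UNIV (apply_lip \<pi>)}"

text \<open>The set \<open>LIP\<^sub>b(X)\<close>, as a subset of \<open>C\<^sub>b(X)\<close>.\<close>

definition LIPb :: "('a::metric_space \<Rightarrow>\<^sub>C real) set" where
  "LIPb = {f. \<exists>L. L-lipschitz_on UNIV (apply_bcontfun f)}"

definition cb_times :: "('a::topological_space \<Rightarrow>\<^sub>C real) \<Rightarrow> ('a \<Rightarrow>\<^sub>C real) \<Rightarrow> ('a \<Rightarrow>\<^sub>C real)"
    (infixl \<open>\<odot>\<close> 70) where
  "f \<odot> g = Bcontfun (\<lambda>x. f x * g x)"

definition cb_supp :: "('a::topological_space \<Rightarrow>\<^sub>C real) \<Rightarrow> 'a set" where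
  "cb_supp f = closure {x. f x \<noteq> 0}"

lemma Lip_lipschitz: "(Lip \<pi>)-lipschitz_on UNIV (apply_lip \<pi>)"
proof (rule lipschitz_onI)
  let ?S = "{L. L-lipschitz_on UNIV (apply_lip \<pi>)}"
  have ne: "?S \<noteq> {}" using apply_lip[of \<pi>] by auto
  show "0 \<le> Lip \<pi>"
    unfolding Lip_def by (rule cInf_greatest[OF ne]) (auto intro: lipschitz_on_nonneg)
  fix x y :: 'a
  show "dist (\<pi> x) (\<pi> y) \<le> Lip \<pi> * dist x y"
  proof (cases "x = y")
    case False
    then have "dist (\<pi> x) (\<pi> y) / dist x y \<le> Lip \<pi>"
      unfolding Lip_def
      by (intro cInf_greatest[OF ne]) (auto simp: divide_le_eq dest: lipschitz_onD)
    then show ?thesis using False by (simp add: divide_le_eq)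
  qed simp
qed

lemma Lip_nonneg [simp]: "0 \<le> Lip \<pi>"
  using Lip_lipschitz lipschitz_on_nonneg by blast

lemma Lip_le: "L-lipschitz_on UNIV (apply_lip \<pi>) \<Longrightarrow> Lip \<pi> \<le> L"
  unfolding Lip_def by (rule cInf_lower) (auto intro!: bdd_belowI[of _ 0] lipschitz_on_nonneg)

lemma cb_times_apply [simp]: "apply_bcontfun (f \<odot> g) x = f x * g x"
proof -
  have "(\<lambda>x. f x * g x) \<in> bcontfun"
    by (rule bcontfun_normI[where b = "norm f * norm g"])
      (auto intro!: continuous_intros mult_mono norm_bounded[of f, simplified]
        norm_bounded[of g, simplified] simp: abs_mult)
  then show ?thesis by (simp add: cb_times_def Bcontfun_inverse)
qed

lemma abs_bcontfun_le: "\<bar>apply_bcontfun f x\<bar> \<le> norm (f :: _ \<Rightarrow>\<^sub>C real)"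
  using norm_bounded[of f x] by simp

lemma LIPb_add: "f \<in> LIPb \<Longrightarrow> g \<in> LIPb \<Longrightarrow> f + g \<in> LIPb"
  unfolding LIPb_def by (auto intro: lipschitz_on_add)

lemma LIPb_scaleR: "f \<in> LIPb \<Longrightarrow> c *\<^sub>R f \<in> LIPb"
  unfolding LIPb_def by (auto intro: lipschitz_on_cmult_real)

lemma LIPb_zero: "0 \<in> LIPb"
  unfolding LIPb_def by (auto intro: lipschitz_on_constant)

lemma LIPb_times: "f \<in> LIPb \<Longrightarrow> g \<in> LIPb \<Longrightarrow> f \<odot> g \<in> LIPb"
proof -
  assume "f \<in> LIPb" "g \<in> LIPb"
  then obtain L M where L: "L-lipschitz_on UNIV (apply_bcontfun f)"
    and M: "M-lipschitz_on UNIV (apply_bcontfun g)" by (auto simp: LIPb_def)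
  have "(norm f * M + norm g * L)-lipschitz_on UNIV (apply_bcontfun (f \<odot> g))"
  proof (rule lipschitz_onI)
    fix x y
    have "\<bar>f x * g x - f y * g y\<bar> = \<bar>f x * (g x - g y) + g y * (f x - f y)\<bar>"
      by (simp add: algebra_simps)
    also have "\<dots> \<le> \<bar>f x\<bar> * \<bar>g x - g y\<bar> + \<bar>g y\<bar> * \<bar>f x - f y\<bar>"
      using abs_triangle_ineq abs_mult by metis
    also have "\<dots> \<le> norm f * (M * dist x y) + norm g * (L * dist x y)"
      using lipschitz_onD[OF L, of x y] lipschitz_onD[OF M, of x y] abs_bcontfun_le
      by (intro add_mono mult_mono) (auto simp: dist_real_def)
    finally show "dist ((f \<odot> g) x) ((f \<odot> g) y) \<le> (norm f * M + norm g * L) * dist x y"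
      by (simp add: dist_real_def algebra_simps)
  next
    show "0 \<le> norm f * M + norm g * L"
      using lipschitz_on_nonneg[OF L] lipschitz_on_nonneg[OF M] by simp
  qed
  then show ?thesis unfolding LIPb_def by auto
qed

lemma Lip_approx:
  fixes f :: "'a::metric_space \<Rightarrow>\<^sub>C real"
  obtains F where "\<And>k. F k \<in> LIPb" "\<And>k x. \<bar>F k x\<bar> \<le> norm f" "\<And>x. (\<lambda>k. F k x) \<longlonglongrightarrow> f x"
proof -
  define B where "B = norm f"
  have fB: "- B \<le> f x" "f x \<le> B" for x
    using abs_bcontfun_le[of f x] by (auto simp: B_def)
  define G where "G k x = (INF y. f y + real k * dist x y)" for k x
  have bdd: "bdd_below (range (\<lambda>y. f y + real k * dist x y))" for k x
    by (rule bdd_belowI[of _ "- B"]) (use fB in \<open>auto intro: add_increasing2\<close>)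
  have Gle: "G k x \<le> f y + real k * dist x y" for k x y
    unfolding G_def by (rule cINF_lower[OF bdd]) simp
  have Gge: "c \<le> G k x" if "\<And>y. c \<le> f y + real k * dist x y" for c k x
    unfolding G_def by (rule cINF_greatest) (use that in auto)
  have GB: "\<bar>G k x\<bar> \<le> B" for k x
  proof -
    have "- B \<le> G k x" by (rule Gge) (use fB in \<open>auto intro: add_increasing2\<close>)
    moreover have "G k x \<le> B" using Gle[of k x x] fB(2)[of x] by simp
    ultimately show ?thesis by auto
  qed
  have Gl: "G k x - G k y \<le> real k * dist x y" for k x y
  proof -
    have "G k x - real k * dist x y \<le> G k y"
    proof (rule Gge)
      fix z
      have "G k x \<le> f z + real k * dist x z" by (rule Gle)
      also have "\<dots> \<le> f z + real k * (dist x y + dist y z)"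
        by (intro add_left_mono mult_left_mono dist_triangle) simp
      finally show "G k x - real k * dist x y \<le> f z + real k * dist y z"
        by (simp add: algebra_simps)
    qed
    then show ?thesis by simp
  qed
  have lip: "(real k)-lipschitz_on UNIV (G k)" for k
    using Gl[of k] by (intro lipschitz_onI) (auto simp: dist_real_def abs_le_iff, metis dist_commute)
  have bc: "G k \<in> bcontfun" for k
    by (rule bcontfun_normI[where b = B]) (use GB lipschitz_on_continuous_on[OF lip] in auto)
  have lim: "(\<lambda>k. G k x) \<longlonglongrightarrow> f x" for x
  proof (rule LIMSEQ_I)
    fix r :: real assume r: "r > 0"
    have "continuous_on UNIV (apply_bcontfun f)" by simp
    then obtain d where d: "d > 0" "\<And>y. dist y x < d \<Longrightarrow> dist (f y) (f x) < r / 2"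
      using r unfolding continuous_on_iff by (metis UNIV_I half_gt_zero)
    obtain N :: nat where N: "2 * B / d < real N" using reals_Archimedean2 by blast
    have "norm (G k x - f x) < r" if "k \<ge> N" for k
    proof -
      have "f x - r / 2 \<le> G k x"
      proof (rule Gge)
        fix y
        show "f x - r / 2 \<le> f y + real k * dist x y"
        proof (cases "dist y x < d")
          case True
          then have "f x - r/2 \<le> f y" using d(2)[of y] unfolding dist_real_def by linarith
          then show ?thesis by (simp add: add_increasing2)
        next
          case False
          have "2 * B \<le> real N * d" using N d(1) by (simp add: divide_less_eq)
          also have "\<dots> \<le> real k * dist x y"
            using False that d(1) by (intro mult_mono) (auto simp: dist_commute)
          finally show ?thesis using fB(1)[of y] fB(2)[of x] r by linarith
        qed
      qed
      moreover have "G k x \<le> f x" using Gle[of k x x] by simp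
      ultimately show ?thesis using r by auto
    qed
    then show "\<exists>no. \<forall>n\<ge>no. norm (G n x - f x) < r" by blast
  qed
  show ?thesis
  proof (rule that[of "\<lambda>k. Bcontfun (G k)"])
    show "Bcontfun (G k) \<in> LIPb" for k
      unfolding LIPb_def using lip[of k] by (auto simp: Bcontfun_inverse[OF bc])
    show "\<bar>Bcontfun (G k) x\<bar> \<le> norm f" for k x using GB by (simp add: Bcontfun_inverse[OF bc] B_def)
    show "(\<lambda>k. Bcontfun (G k) x) \<longlonglongrightarrow> f x" for x using lim by (simp add: Bcontfun_inverse[OF bc])
  qed
qed

section \<open>Currents\<close>

text \<open>
  A map \<open>LIP\<^sub>b(X) \<times> LIP(X)\<^sup>n \<rightarrow> \<real>\<close>, where \<open>n = CARD('n)\<close> and the \<open>n\<close> slots are indexed by the finite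
  type \<open>'n\<close>.  The function type has \<open>C\<^sub>b(X)\<close> in the first slot; everything below refers only to the
  values on \<^const>\<open>LIPb\<close>, those elsewhere are irrelevant.
\<close>

type_synonym ('a, 'n) precurrent = "('a \<Rightarrow>\<^sub>C real) \<Rightarrow> ('n \<Rightarrow> 'a lip) \<Rightarrow> real"

definition multilinear :: "('a::metric_space, 'n) precurrent \<Rightarrow> bool" where
  "multilinear T \<longleftrightarrow>
     (\<forall>f\<in>LIPb. \<forall>g\<in>LIPb. \<forall>a b \<pi>. T (a *\<^sub>R f + b *\<^sub>R g) \<pi> = a * T f \<pi> + b * T g \<pi>) \<and>
     (\<forall>f\<in>LIPb. \<forall>\<pi> j a b \<alpha> \<beta>. T f (\<pi>(j := a *\<^sub>R \<alpha> + b *\<^sub>R \<beta>)) = a * T f (\<pi>(j := \<alpha>)) + b * T f (\<pi>(j := \<beta>)))"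

definition mass_bound :: "('a::metric_space, 'n::finite) precurrent \<Rightarrow> 'a measure \<Rightarrow> bool" where
  "mass_bound T \<mu> \<longleftrightarrow> finite_measure \<mu> \<and> sets \<mu> = sets borel \<and>
     (\<forall>f\<in>LIPb. \<forall>\<pi>. \<bar>T f \<pi>\<bar> \<le> (\<Prod>j\<in>UNIV. Lip (\<pi> j)) * (\<integral>x. \<bar>f x\<bar> \<partial>\<mu>))"

definition seq_continuous :: "('a::metric_space, 'n) precurrent \<Rightarrow> bool" where
  "seq_continuous T \<longleftrightarrow>
     (\<forall>f\<in>LIPb. \<forall>P \<pi>. (\<forall>j. \<exists>L. \<forall>i. L-lipschitz_on UNIV (apply_lip (P i j))) \<and>
        (\<forall>j x. (\<lambda>i. apply_lip (P i j) x) \<longlonglongrightarrow> apply_lip (\<pi> j) x) \<longrightarrow> (\<lambda>i::nat. T f (P i)) \<longlonglongrightarrow> T f \<pi>)"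

definition is_local :: "('a::metric_space, 'n) precurrent \<Rightarrow> bool" where
  "is_local T \<longleftrightarrow>
     (\<forall>f\<in>LIPb. \<forall>\<pi>. (\<exists>j U c. open U \<and> {x. apply_bcontfun f x \<noteq> 0} \<subseteq> U \<and> (\<forall>x\<in>U. apply_lip (\<pi> j) x = c)) \<longrightarrow> T f \<pi> = 0)"

definition current :: "('a::metric_space, 'n::finite) precurrent \<Rightarrow> bool" where
  "current T \<longleftrightarrow> multilinear T \<and> (\<exists>\<mu>. mass_bound T \<mu>) \<and> seq_continuous T \<and> is_local T"

text \<open>
  For measures on the same \<open>\<sigma>\<close>-algebra the library's order on measures is the setwise one.  The
  least mass bound exists, see \<open>mass_bound_mass\<close> and \<open>mass_least\<close> below.
\<close>

definition mass :: "('a::metric_space, 'n::finite) precurrent \<Rightarrow> 'a measure" where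
  "mass T = (LEAST \<mu>. mass_bound T \<mu>)"

lemma space_borel_sets: "sets \<mu> = sets (borel :: 'a::topological_space measure) \<Longrightarrow> space \<mu> = UNIV"
  using sets_eq_imp_space_eq by fastforce

lemma cb_integrable:
  fixes f :: "'a::metric_space \<Rightarrow>\<^sub>C real"
  assumes "finite_measure \<mu>" "sets \<mu> = sets borel"
  shows "integrable \<mu> (apply_bcontfun f)"
proof -
  interpret finite_measure \<mu> by fact
  have "apply_bcontfun f \<in> borel_measurable \<mu>"
    using measurable_cong_sets[OF assms(2) refl, of borel]
      borel_measurable_continuous_onI[OF continuous_on_apply_bcontfun] by blast
  then show ?thesis
    by (intro integrable_const_bound[where B = "norm f"]) (auto simp: abs_bcontfun_le)
qed

lemma cb_measurable:
  fixes f :: "'a::metric_space \<Rightarrow>\<^sub>C real"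
  assumes "sets \<mu> = sets borel"
  shows "apply_bcontfun f \<in> borel_measurable \<mu>"
  using measurable_cong_sets[OF assms refl, of borel]
      borel_measurable_continuous_onI[OF continuous_on_apply_bcontfun] by blast

lemma cb_integral_le:
  fixes f :: "'a::metric_space \<Rightarrow>\<^sub>C real"
  assumes "finite_measure \<mu>" "sets \<mu> = sets borel"
  shows "(\<integral>x. \<bar>f x\<bar> \<partial>\<mu>) \<le> norm f * measure \<mu> UNIV"
proof -
  interpret finite_measure \<mu> by fact
  have "(\<integral>x. \<bar>f x\<bar> \<partial>\<mu>) \<le> (\<integral>x. norm f \<partial>\<mu>)"
    by (intro integral_mono integrable_abs cb_integrable assms integrable_const abs_bcontfun_le)
  then show ?thesis by (simp add: space_borel_sets[OF assms(2)] mult.commute)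
qed

lemma integrable_indicator_times:
  fixes f :: "'a \<Rightarrow> real"
  assumes "A \<in> sets M" "integrable M f"
  shows "integrable M (\<lambda>x. indicator A x * f x)"
  using integrable_real_mult_indicator[OF assms] by (simp add: mult.commute)

text \<open>Existence of the mass.  The first step: the infimum of two mass bounds, computed with a Hahn decomposition.\<close>

lemma mass_bound_min:
  fixes T :: "('a::polish_space, 'n::finite) precurrent"
  assumes ml: "multilinear T" and M: "mass_bound T M" and N: "mass_bound T N"
  obtains R where "mass_bound T R" "\<And>A. A \<in> sets borel \<Longrightarrow> emeasure R A \<le> emeasure M A"
    "\<And>A. A \<in> sets borel \<Longrightarrow> emeasure R A \<le> emeasure N A"
proof -
  interpret M: finite_measure M using M by (simp add: mass_bound_def)
  interpret N: finite_measure N using N by (simp add: mass_bound_def)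
  have sM [measurable_cong]: "sets M = sets borel" using M by (simp add: mass_bound_def)
  have sN [measurable_cong]: "sets N = sets borel" using N by (simp add: mass_bound_def)
  have spM: "space M = UNIV" and spN: "space N = UNIV"
    using space_borel_sets[OF sM] space_borel_sets[OF sN] by auto
  obtain P where P: "P \<in> sets borel"
    and PN: "\<And>X. X \<in> sets borel \<Longrightarrow> X \<subseteq> P \<Longrightarrow> emeasure N X \<le> emeasure M X"
    and PM: "\<And>X. X \<in> sets borel \<Longrightarrow> X \<inter> P = {} \<Longrightarrow> emeasure M X \<le> emeasure N X"
    using finite_unsigned_Hahn_decomposition[of M N] M.finite_measure_axioms N.finite_measure_axioms sM sN
    by auto
  define r where "r A = emeasure N (A \<inter> P) + emeasure M (A - P)" for A
  define R where "R = measure_of UNIV (sets borel) r"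
  have sR [measurable_cong]: "sets R = sets borel"
    unfolding R_def by (metis sets.sets_measure_of_eq space_borel)
  have eR: "emeasure R A = r A" if "A \<in> sets borel" for A
    unfolding R_def
  proof (rule emeasure_measure_of_sigma)
    show "sigma_algebra UNIV (sets (borel :: 'a measure))"
      by (metis sets.sigma_algebra_axioms space_borel)
    show "positive (sets borel) r" by (simp add: positive_def r_def)
    show "countably_additive (sets borel) r"
    proof (rule countably_additiveI)
      fix A :: "nat \<Rightarrow> 'a set"
      assume A: "range A \<subseteq> sets borel" "disjoint_family A"
      have "(\<Sum>i. emeasure N (A i \<inter> P)) = emeasure N (\<Union>i. A i \<inter> P)"
        using A P by (intro suminf_emeasure) (auto simp: sN disjoint_family_on_def)
      moreover have "(\<Sum>i. emeasure M (A i - P)) = emeasure M (\<Union>i. A i - P)"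
        using A P by (intro suminf_emeasure) (auto simp: sM disjoint_family_on_def)
      moreover have "(\<Union>i. A i \<inter> P) = (\<Union>i. A i) \<inter> P" "(\<Union>i. A i - P) = (\<Union>i. A i) - P" by auto
      ultimately show "(\<Sum>i. r (A i)) = r (\<Union> (range A))"
        unfolding r_def by (simp add: suminf_add[symmetric])
    qed
  qed (use that in auto)
  have rM: "emeasure R A \<le> emeasure M A" if A: "A \<in> sets borel" for A
  proof -
    have "emeasure R A \<le> emeasure M (A \<inter> P) + emeasure M (A - P)"
      unfolding eR[OF A] r_def using A P by (intro add_mono PN) auto
    also have "\<dots> = emeasure M A" using A P by (subst plus_emeasure) (auto simp: sM Int_Diff_Un)
    finally show ?thesis .
  qed
  have rN: "emeasure R A \<le> emeasure N A" if A: "A \<in> sets borel" for A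
  proof -
    have "emeasure R A \<le> emeasure N (A \<inter> P) + emeasure N (A - P)"
      unfolding eR[OF A] r_def using A P by (intro add_mono PM) auto
    also have "\<dots> = emeasure N A" using A P by (subst plus_emeasure) (auto simp: sN Int_Diff_Un)
    finally show ?thesis .
  qed
  have spR: "space R = UNIV" using sR by (rule space_borel_sets)
  interpret R: finite_measure R
    by (rule finite_measureI) (metis M.emeasure_finite rM spR infinity_ennreal_def sets.top space_borel top.extremum_unique)
  have dN: "density N (indicator P) = density R (indicator P)"
  proof (rule measure_eqI)
    fix A assume "A \<in> sets (density N (indicator P))"
    then have A: "A \<in> sets borel" by (simp add: sN)
    have "emeasure (density N (indicator P)) A = emeasure N (A \<inter> P)"
      using A P by (subst emeasure_density) (auto simp: sN Int_commute simp flip: indicator_inter_arith)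
    moreover have "emeasure (density R (indicator P)) A = emeasure R (A \<inter> P)"
      using A P by (subst emeasure_density) (auto simp: sR Int_commute simp flip: indicator_inter_arith)
    moreover have D: "A \<inter> P - P = {}" by auto
    have "emeasure R (A \<inter> P) = emeasure N (A \<inter> P)"
      using A P by (subst eR) (auto simp: r_def D)
    then show "emeasure (density N (indicator P)) A = emeasure (density R (indicator P)) A"
      using calculation by simp
  qed (simp add: sN sR)
  have dM: "density M (indicator (-P)) = density R (indicator (-P))"
  proof (rule measure_eqI)
    fix A assume "A \<in> sets (density M (indicator (-P)))"
    then have A: "A \<in> sets borel" by (simp add: sM)
    have "emeasure (density M (indicator (-P))) A = emeasure M (A \<inter> -P)"
      using A P by (subst emeasure_density) (auto simp: sM Int_commute simp flip: indicator_inter_arith)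
    moreover have "emeasure (density R (indicator (-P))) A = emeasure R (A \<inter> -P)"
      using A P by (subst emeasure_density) (auto simp: sR Int_commute simp flip: indicator_inter_arith)
    moreover have D: "A \<inter> - P \<inter> P = {}" "A \<inter> - P - P = A \<inter> - P" by auto
    have "emeasure R (A \<inter> -P) = emeasure M (A \<inter> -P)"
      using A P by (subst eR) (auto simp: r_def D simp del: Diff_Compl Int_assoc)
    then show "emeasure (density M (indicator (-P))) A = emeasure (density R (indicator (-P))) A"
      using calculation by simp
  qed (simp add: sM sR)
  have bound: "\<bar>T f \<pi>\<bar> \<le> (\<Prod>j\<in>UNIV. Lip (\<pi> j)) * (\<integral>x. \<bar>f x\<bar> \<partial>R)" if f: "f \<in> LIPb" for f \<pi>
  proof -
    let ?L = "\<Prod>j\<in>UNIV. Lip (\<pi> j)"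
    have L0: "0 \<le> ?L" by (intro prod_nonneg) auto
    let ?f = "\<lambda>x. \<bar>f x\<bar>"
    note [measurable] = cb_measurable[OF sM, of f] cb_measurable[OF sN, of f] cb_measurable[OF sR, of f] P
    have [measurable]: "apply_bcontfun f \<in> borel_measurable borel" by (rule cb_measurable) simp
    have intM: "integrable M ?f" and intN: "integrable N ?f" and intR: "integrable R ?f"
      using cb_integrable M.finite_measure_axioms N.finite_measure_axioms R.finite_measure_axioms sM sN sR
      by blast+
    have eqN: "(\<integral>x. indicator P x * ?f x \<partial>N) = (\<integral>x. indicator P x * ?f x \<partial>R)"
    proof -
      have "(\<integral>x. indicator P x * ?f x \<partial>N) = integral\<^sup>L (density N (\<lambda>x. ennreal (indicator P x))) ?f"
        by (subst integral_density) auto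
      also have "\<dots> = integral\<^sup>L (density R (\<lambda>x. ennreal (indicator P x))) ?f"
        using dN by (simp add: ennreal_indicator)
      also have "\<dots> = (\<integral>x. indicator P x * ?f x \<partial>R)"
        by (subst integral_density) auto
      finally show ?thesis .
    qed
    have eqM: "(\<integral>x. indicator (-P) x * ?f x \<partial>M) = (\<integral>x. indicator (-P) x * ?f x \<partial>R)"
    proof -
      have "(\<integral>x. indicator (-P) x * ?f x \<partial>M) = integral\<^sup>L (density M (\<lambda>x. ennreal (indicator (-P) x))) ?f"
        by (subst integral_density) auto
      also have "\<dots> = integral\<^sup>L (density R (\<lambda>x. ennreal (indicator (-P) x))) ?f"
        using dM by (simp add: ennreal_indicator)
      also have "\<dots> = (\<integral>x. indicator (-P) x * ?f x \<partial>R)"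
        by (subst integral_density) auto
      finally show ?thesis .
    qed
    have closed_case: "\<bar>T f \<pi>\<bar> \<le> ?L * ((\<integral>x. indicator K x * ?f x \<partial>N) + (\<integral>x. indicator (-K) x * ?f x \<partial>M))"
      if K: "closed K" for K
    proof (cases "K = {}")
      case True
      have "\<bar>T f \<pi>\<bar> \<le> ?L * (\<integral>x. ?f x \<partial>M)" using M f by (auto simp: mass_bound_def)
      then show ?thesis using True by simp
    next
      case False
      have [measurable]: "K \<in> sets borel" using K by auto
      define c where "c k x = max 0 (1 - real k * infdist x K)" for k x
      have c01: "0 \<le> c k x" "c k x \<le> 1" for k x
        by (auto simp: c_def infdist_nonneg)
      have clip: "(real k)-lipschitz_on UNIV (c k)" for k
      proof (rule lipschitz_onI)
        fix x y
        have "\<bar>c k x - c k y\<bar> \<le> \<bar>real k * infdist x K - real k * infdist y K\<bar>"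
          by (auto simp: c_def)
        also have "\<dots> = real k * \<bar>infdist x K - infdist y K\<bar>"
          by (simp add: abs_mult flip: right_diff_distrib)
        also have "\<dots> \<le> real k * dist x y"
          by (intro mult_left_mono infdist_triangle_abs) auto
        finally show "dist (c k x) (c k y) \<le> real k * dist x y" by (simp add: dist_real_def)
      qed simp
      have cbc: "c k \<in> bcontfun" for k
        by (rule bcontfun_normI[where b = 1])
          (use c01 lipschitz_on_continuous_on[OF clip] in auto)
      define C where "C k = Bcontfun (c k)" for k
      have Cc: "apply_bcontfun (C k) = c k" for k by (simp add: C_def Bcontfun_inverse[OF cbc])
      have CL: "C k \<in> LIPb" for k unfolding LIPb_def using clip[of k] by (auto simp: Cc)
      have clim: "(\<lambda>k. c k x) \<longlonglongrightarrow> indicator K x" for x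
      proof (cases "x \<in> K")
        case True
        then show ?thesis by (simp add: c_def)
      next
        case x: False
        then have i: "infdist x K > 0"
          using K False by (metis in_closed_iff_infdist_zero infdist_nonneg less_eq_real_def)
        obtain m :: nat where m: "1 / infdist x K < real m" using reals_Archimedean2 by blast
        have "c k x = 0" if "k \<ge> m" for k
        proof -
          have "1 < real m * infdist x K" using m i by (simp add: divide_less_eq)
          also have "\<dots> \<le> real k * infdist x K" using that i by (intro mult_right_mono) auto
          finally show ?thesis by (simp add: c_def)
        qed
        then have "\<forall>\<^sub>F k in sequentially. c k x = 0" by (auto simp: eventually_sequentially)
        then show ?thesis using x by (simp add: tendsto_eventually)
      qed
      have mc [measurable]: "c k \<in> borel_measurable borel" for k
        using cb_measurable[of borel "C k"] by (simp add: Cc)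
      have dec: "f = C k \<odot> f + (1) *\<^sub>R (f - C k \<odot> f)" for k
        by (rule bcontfun_eqI) simp
      have step: "\<bar>T f \<pi>\<bar> \<le> ?L * ((\<integral>x. c k x * ?f x \<partial>N) + (\<integral>x. (1 - c k x) * ?f x \<partial>M))" for k
      proof -
        have l1: "C k \<odot> f \<in> LIPb" by (intro LIPb_times CL f)
        have l2: "f - C k \<odot> f \<in> LIPb"
          using LIPb_add[OF f LIPb_scaleR[OF l1, of "-1"]] by simp
        have "T (1 *\<^sub>R (C k \<odot> f) + 1 *\<^sub>R (f - C k \<odot> f)) \<pi> = 1 * T (C k \<odot> f) \<pi> + 1 * T (f - C k \<odot> f) \<pi>"
          using ml l1 l2 unfolding multilinear_def by blast
        moreover have "1 *\<^sub>R (C k \<odot> f) + 1 *\<^sub>R (f - C k \<odot> f) = f" by simp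
        ultimately have "\<bar>T f \<pi>\<bar> \<le> \<bar>T (C k \<odot> f) \<pi>\<bar> + \<bar>T (f - C k \<odot> f) \<pi>\<bar>" by simp
        also have "\<dots> \<le> ?L * (\<integral>x. \<bar>(C k \<odot> f) x\<bar> \<partial>N) + ?L * (\<integral>x. \<bar>(f - C k \<odot> f) x\<bar> \<partial>M)"
          using M N l1 l2 by (intro add_mono) (auto simp: mass_bound_def)
        also have "(\<lambda>x. \<bar>(C k \<odot> f) x\<bar>) = (\<lambda>x. c k x * ?f x)"
          using c01 by (auto simp: Cc abs_mult)
        also have "(\<lambda>x. \<bar>(f - C k \<odot> f) x\<bar>) = (\<lambda>x. (1 - c k x) * ?f x)"
        proof
          fix x
          have "f x - c k x * f x = (1 - c k x) * f x" by (simp add: algebra_simps)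
          then show "\<bar>(f - C k \<odot> f) x\<bar> = (1 - c k x) * ?f x"
            using c01[of k x] by (simp add: Cc abs_mult)
        qed
        finally show ?thesis by (simp add: algebra_simps)
      qed
      have "(\<lambda>k. \<integral>x. c k x * ?f x \<partial>N) \<longlonglongrightarrow> (\<integral>x. indicator K x * ?f x \<partial>N)"
        using c01 by (intro integral_dominated_convergence[where w = ?f] intN)
          (auto intro!: tendsto_intros clim simp: abs_mult mult_left_le_one_le)
      moreover have "(\<lambda>k. \<integral>x. (1 - c k x) * ?f x \<partial>M) \<longlonglongrightarrow> (\<integral>x. indicator (-K) x * ?f x \<partial>M)"
        using c01 by (intro integral_dominated_convergence[where w = ?f] intM)
          (auto intro!: tendsto_intros clim simp: abs_mult mult_left_le_one_le indicator_compl)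
      ultimately have "(\<lambda>k. ?L * ((\<integral>x. c k x * ?f x \<partial>N) + (\<integral>x. (1 - c k x) * ?f x \<partial>M))) \<longlonglongrightarrow>
          ?L * ((\<integral>x. indicator K x * ?f x \<partial>N) + (\<integral>x. indicator (-K) x * ?f x \<partial>M))"
        by (intro tendsto_intros)
      then show ?thesis by (rule LIMSEQ_le_const) (use step in auto)
    qed
    have "\<bar>T f \<pi>\<bar> \<le> ?L * (\<integral>x. ?f x \<partial>R) + e" if e: "e > 0" for e
    proof -
      define d where "d = e / (?L * norm f + 1)"
      have d: "d > 0" using e L0 by (simp add: d_def add_nonneg_pos)
      have SUP: "emeasure M P = (SUP K\<in>{K. K \<subseteq> P \<and> compact K}. emeasure M K)"
        using sM M.emeasure_finite P by (intro inner_regular) auto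
      have "\<exists>K. K \<subseteq> P \<and> compact K \<and> measure M P \<le> measure M K + d"
      proof (rule ccontr)
        assume *: "\<not> ?thesis"
        have "emeasure M K \<le> ennreal (measure M P - d)" if "K \<subseteq> P" "compact K" for K
          using * that by (auto simp: M.emeasure_eq_measure intro!: ennreal_leI)
        then have "emeasure M P \<le> ennreal (measure M P - d)"
          unfolding SUP by (intro SUP_least) auto
        moreover have "measure M P - d > 0" using *[simplified, rule_format, of "{}"] by auto
        ultimately show False using d by (simp add: M.emeasure_eq_measure)
      qed
      then obtain K where K: "K \<subseteq> P" "compact K" "measure M P \<le> measure M K + d" by blast
      have Kc: "closed K" using K compact_imp_closed by auto
      have [measurable]: "K \<in> sets borel" using Kc by auto
      have mPK: "measure M (P - K) \<le> d"
      proof -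
        show ?thesis using K P by (subst M.finite_measure_Diff) (auto simp: sM)
      qed
      have iPK: "integrable M (\<lambda>x. norm f * indicator (P - K) x)"
        using P by (intro integrable_mult_right) (auto simp: sM M.emeasure_eq_measure)
      have "(\<integral>x. indicator K x * ?f x \<partial>N) \<le> (\<integral>x. indicator P x * ?f x \<partial>N)"
        using K(1) by (intro integral_mono integrable_indicator_times[OF _ intN] mult_right_mono)
           (auto simp: sN indicator_def)
      moreover have "(\<integral>x. indicator (-K) x * ?f x \<partial>M) \<le> (\<integral>x. indicator (-P) x * ?f x + norm f * indicator (P - K) x \<partial>M)"
        using K(1) by (intro integral_mono Bochner_Integration.integrable_add integrable_indicator_times[OF _ intM] iPK)
           (auto simp: sM indicator_def abs_bcontfun_le)
      moreover have "(\<integral>x. indicator (-P) x * ?f x + norm f * indicator (P - K) x \<partial>M)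
          = (\<integral>x. indicator (-P) x * ?f x \<partial>M) + norm f * measure M (P - K)"
        using iPK by (subst Bochner_Integration.integral_add)
          (auto simp: sM M.emeasure_eq_measure intro!: integrable_indicator_times[OF _ intM])
      moreover have "norm f * measure M (P - K) \<le> norm f * d" using mPK by (simp add: mult_left_mono)
      ultimately have "(\<integral>x. indicator K x * ?f x \<partial>N) + (\<integral>x. indicator (-K) x * ?f x \<partial>M)
          \<le> (\<integral>x. indicator P x * ?f x \<partial>R) + (\<integral>x. indicator (-P) x * ?f x \<partial>R) + norm f * d"
        using eqN eqM by linarith
      also have "(\<integral>x. indicator P x * ?f x \<partial>R) + (\<integral>x. indicator (-P) x * ?f x \<partial>R) = (\<integral>x. ?f x \<partial>R)"
      proof -
        have "integrable R (\<lambda>x. indicator P x * ?f x)" "integrable R (\<lambda>x. indicator (-P) x * ?f x)"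
          using P by (auto simp: sR intro!: integrable_indicator_times[OF _ intR])
        from Bochner_Integration.integral_add[OF this]
        have "(\<integral>x. indicator P x * ?f x \<partial>R) + (\<integral>x. indicator (-P) x * ?f x \<partial>R) =
            (\<integral>x. indicator P x * ?f x + indicator (-P) x * ?f x \<partial>R)" by (rule sym)
        also have "\<dots> = (\<integral>x. ?f x \<partial>R)"
          by (intro Bochner_Integration.integral_cong) (auto simp: indicator_def)
        finally show ?thesis .
      qed
      finally have "?L * ((\<integral>x. indicator K x * ?f x \<partial>N) + (\<integral>x. indicator (-K) x * ?f x \<partial>M))
          \<le> ?L * ((\<integral>x. ?f x \<partial>R) + norm f * d)" using L0 by (rule mult_left_mono)
      also have "\<dots> = ?L * (\<integral>x. ?f x \<partial>R) + (?L * norm f) * d" by (simp add: algebra_simps)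
      also have "(?L * norm f) * d \<le> e"
      proof -
        have "0 \<le> ?L * norm f" using L0 by simp
        then have "0 < ?L * norm f + 1" by simp
        then show ?thesis
          using e unfolding d_def by (simp only: times_divide_eq_right pos_divide_le_eq) (simp add: algebra_simps)
      qed
      finally show ?thesis using closed_case[OF Kc] by linarith
    qed
    then show ?thesis by (rule field_le_epsilon)
  qed
  show ?thesis
    by (rule that[of R]) (use rM rN bound sR R.finite_measure_axioms in \<open>auto simp: mass_bound_def\<close>)
qed

text \<open>The second step: a decreasing sequence of mass bounds of almost minimal total mass.\<close>

lemma mass_bound_le:
  "mass_bound T M \<Longrightarrow> mass_bound T N \<Longrightarrow> M \<le> N \<longleftrightarrow> (\<forall>A\<in>sets borel. emeasure M A \<le> emeasure N A)"
  by (simp add: mass_bound_def le_measure)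

lemma mass_bound_least:
  fixes T :: "('a::polish_space, 'n::finite) precurrent"
  assumes ml: "multilinear T" and ex: "\<exists>\<mu>. mass_bound T \<mu>"
  obtains m where "mass_bound T m" "\<And>\<nu>. mass_bound T \<nu> \<Longrightarrow> m \<le> \<nu>"
proof -
  let ?B = "{\<mu>. mass_bound T \<mu>}"
  define c where "c = (INF \<mu>\<in>?B. measure \<mu> UNIV)"
  have bdd: "bdd_below ((\<lambda>\<mu>. measure \<mu> UNIV) ` ?B)" by (rule bdd_belowI[of _ 0]) auto
  have c_le: "c \<le> measure \<mu> UNIV" if "mass_bound T \<mu>" for \<mu>
    unfolding c_def by (rule cINF_lower[OF bdd]) (use that in auto)
  have near: "\<exists>\<mu>. mass_bound T \<mu> \<and> measure \<mu> UNIV < c + e" if "e > 0" for e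
  proof (rule ccontr)
    assume "\<not> ?thesis"
    then have "c + e \<le> (INF \<mu>\<in>?B. measure \<mu> UNIV)"
      using ex by (intro cINF_greatest) (auto simp: not_less)
    then show False using that by (simp add: c_def)
  qed
  have sets: "sets \<mu> = sets borel" "finite_measure \<mu>" if "mass_bound T \<mu>" for \<mu>
    using that by (auto simp: mass_bound_def)
  define Q where "Q k \<mu> \<longleftrightarrow> mass_bound T \<mu> \<and> measure \<mu> UNIV < c + 1 / real (Suc k)" for k \<mu>
  have "\<exists>\<rho>. \<forall>k. Q k (\<rho> k) \<and> \<rho> (Suc k) \<le> \<rho> k"
  proof (rule dependent_nat_choice)
    show "\<exists>x. Q 0 x" using near[of 1] by (auto simp: Q_def)
    fix \<mu> k assume \<mu>: "Q k \<mu>"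
    obtain \<nu> where \<nu>: "Q (Suc k) \<nu>" using near[of "1 / real (Suc (Suc k))"] by (auto simp: Q_def)
    obtain R where R: "mass_bound T R" "\<And>A. A \<in> sets borel \<Longrightarrow> emeasure R A \<le> emeasure \<mu> A"
      "\<And>A. A \<in> sets borel \<Longrightarrow> emeasure R A \<le> emeasure \<nu> A"
      using mass_bound_min[OF ml, of \<mu> \<nu>] \<mu> \<nu> by (auto simp: Q_def)
    have "R \<le> \<mu>" using R \<mu> by (auto simp: mass_bound_le Q_def)
    moreover have "measure R UNIV \<le> measure \<nu> UNIV"
      using R(3)[of UNIV] sets[OF R(1)] sets[of \<nu>] \<nu>
      by (simp add: finite_measure.emeasure_eq_measure Q_def)
    ultimately show "\<exists>y. Q (Suc k) y \<and> y \<le> \<mu>" using R(1) \<nu> by (auto simp: Q_def)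
  qed
  then obtain \<rho> where \<rho>: "\<And>k. Q k (\<rho> k)" "\<And>k. \<rho> (Suc k) \<le> \<rho> k" by blast
  have \<rho>B: "mass_bound T (\<rho> k)" for k using \<rho>(1) by (simp add: Q_def)
  have s\<rho>: "sets (\<rho> k) = sets borel" for k using sets \<rho>B by blast
  have sp\<rho>: "space (\<rho> k) = UNIV" for k using s\<rho> by (rule space_borel_sets)
  have fin: "finite_measure (\<rho> k)" for k using sets \<rho>B by blast
  have dec: "decseq (\<lambda>k. emeasure (\<rho> k) A)" if "A \<in> sets borel" for A
  proof (rule decseq_SucI)
    show "emeasure (\<rho> (Suc k)) A \<le> emeasure (\<rho> k) A" for k
      using \<rho>(2)[of k] mass_bound_le[OF \<rho>B \<rho>B] that by blast
  qed
  define r where "r A = (INF k. emeasure (\<rho> k) A)" for A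
  have lim: "(\<lambda>k. emeasure (\<rho> k) A) \<longlonglongrightarrow> r A" if "A \<in> sets borel" for A
    unfolding r_def by (rule LIMSEQ_INF[OF dec[OF that]])
  have r_le: "r A \<le> emeasure (\<rho> k) A" for A k unfolding r_def by (rule INF_lower) simp
  have r_fin: "r A \<noteq> top" for A
    using r_le[of A 0] finite_measure.emeasure_finite[OF fin[of 0], of A] by (auto simp: top_unique)
  define m where "m = measure_of UNIV (sets borel) r"
  have sm: "sets m = sets borel"
    unfolding m_def by (metis sets.sets_measure_of_eq space_borel)
  have em: "emeasure m A = r A" if "A \<in> sets borel" for A
    unfolding m_def
  proof (rule emeasure_measure_of_sigma)
    show "sigma_algebra UNIV (sets (borel :: 'a measure))"
      by (metis sets.sigma_algebra_axioms space_borel)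
    show pos: "positive (sets borel) r" by (simp add: positive_def r_def)
    show "countably_additive (sets borel) r"
    proof (rule ring_of_sets.empty_continuous_imp_countably_additive[OF _ pos])
      show "ring_of_sets UNIV (sets (borel :: 'a measure))"
        by (metis sets.ring_of_sets_axioms space_borel)
      show "additive (sets borel) r"
        unfolding additive_def
      proof (intro ballI impI)
        fix x y :: "'a set" assume xy: "x \<in> sets borel" "y \<in> sets borel" "x \<inter> y = {}"
        have "(\<lambda>k. emeasure (\<rho> k) x + emeasure (\<rho> k) y) \<longlonglongrightarrow> r x + r y"
          by (intro tendsto_add lim xy)
        also have "(\<lambda>k. emeasure (\<rho> k) x + emeasure (\<rho> k) y) = (\<lambda>k. emeasure (\<rho> k) (x \<union> y))"
          using xy by (intro ext plus_emeasure) (auto simp: s\<rho>)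
        finally show "r (x \<union> y) = r x + r y"
          using lim[of "x \<union> y"] xy LIMSEQ_unique by blast
      qed
      show "\<forall>A\<in>sets borel. r A \<noteq> \<infinity>" using r_fin by simp
      fix A :: "nat \<Rightarrow> 'a set"
      assume A: "range A \<subseteq> sets borel" "decseq A" "(\<Inter>i. A i) = {}"
      have "(\<lambda>i. emeasure (\<rho> 0) (A i)) \<longlonglongrightarrow> emeasure (\<rho> 0) (\<Inter>i. A i)"
        using A finite_measure.emeasure_finite[OF fin[of 0]]
        by (intro Lim_emeasure_decseq) (auto simp: s\<rho>)
      then have "(\<lambda>i. emeasure (\<rho> 0) (A i)) \<longlonglongrightarrow> 0" using A by simp
      then show "(\<lambda>i. r (A i)) \<longlonglongrightarrow> 0"
        by (rule tendsto_sandwich[OF _ _ tendsto_const, rotated 2]) (auto simp: r_le)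
    qed
  qed (use that in auto)
  have spm: "space m = UNIV" using sm by (rule space_borel_sets)
  have finm: "finite_measure m"
    by (rule finite_measureI) (simp add: spm em r_fin)
  have mc: "measure m UNIV \<le> c"
  proof (rule field_le_epsilon)
    fix e :: real assume "e > 0"
    then obtain k where k: "inverse (real (Suc k)) < e" using reals_Archimedean by blast
    have "measure m UNIV \<le> measure (\<rho> k) UNIV"
      using r_le[of UNIV k] by (simp add: em[symmetric] finite_measure.emeasure_eq_measure[OF finm] finite_measure.emeasure_eq_measure[OF fin])
    also have "\<dots> \<le> c + 1 / real (Suc k)" using \<rho>(1)[of k] by (simp add: Q_def)
    finally show "measure m UNIV \<le> c + e" using k by (simp add: inverse_eq_divide)
  qed
  have mB: "mass_bound T m"
    unfolding mass_bound_def
  proof (intro conjI finm sm ballI allI)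
    fix f :: "'a \<Rightarrow>\<^sub>C real" and \<pi> :: "'n \<Rightarrow> 'a lip"
    assume f: "f \<in> LIPb"
    let ?L = "\<Prod>j\<in>UNIV. Lip (\<pi> j)"
    have L0: "0 \<le> ?L" by (intro prod_nonneg) auto
    have "\<bar>T f \<pi>\<bar> \<le> ?L * ((\<integral>x. \<bar>f x\<bar> \<partial>m) + norm f * (measure (\<rho> k) UNIV - measure m UNIV))" for k
    proof -
      interpret K: finite_measure "\<rho> k" by (rule fin)
      interpret m: finite_measure m by (rule finm)
      have le: "m \<le> \<rho> k" using r_le by (subst le_measure) (auto simp: sm s\<rho> em)
      have i: "integrable m (\<lambda>x. \<bar>f x\<bar>)" "integrable (\<rho> k) (\<lambda>x. \<bar>f x\<bar>)"
        using cb_integrable finm sm fin s\<rho> by blast+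
      have "(\<integral>x. norm f - \<bar>f x\<bar> \<partial>m) \<le> (\<integral>x. norm f - \<bar>f x\<bar> \<partial>\<rho> k)"
      proof (subst (1 2) integral_eq_nn_integral)
        have "(\<integral>\<^sup>+x. ennreal (norm f - \<bar>f x\<bar>) \<partial>m) \<le> (\<integral>\<^sup>+x. ennreal (norm f - \<bar>f x\<bar>) \<partial>\<rho> k)"
          using le by (intro nn_integral_mono_measure) (auto simp: sm s\<rho>)
        moreover have "(\<integral>\<^sup>+x. ennreal (norm f - \<bar>f x\<bar>) \<partial>\<rho> k) < top"
          using i(2) integrableD(2)[of "\<rho> k" "\<lambda>x. norm f - \<bar>f x\<bar>"]
          by (auto simp: abs_bcontfun_le less_top)
        ultimately show "enn2real (\<integral>\<^sup>+x. ennreal (norm f - \<bar>f x\<bar>) \<partial>m) \<le> enn2real (\<integral>\<^sup>+x. ennreal (norm f - \<bar>f x\<bar>) \<partial>\<rho> k)"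
          by (intro enn2real_mono)
      qed (use i in \<open>auto simp: abs_bcontfun_le\<close>)
      then have "norm f * measure m UNIV - (\<integral>x. \<bar>f x\<bar> \<partial>m) \<le> norm f * measure (\<rho> k) UNIV - (\<integral>x. \<bar>f x\<bar> \<partial>\<rho> k)"
        using i by (simp add: spm sp\<rho> mult.commute)
      then have "(\<integral>x. \<bar>f x\<bar> \<partial>\<rho> k) \<le> (\<integral>x. \<bar>f x\<bar> \<partial>m) + norm f * (measure (\<rho> k) UNIV - measure m UNIV)"
        by (simp add: algebra_simps)
      moreover have "\<bar>T f \<pi>\<bar> \<le> ?L * (\<integral>x. \<bar>f x\<bar> \<partial>\<rho> k)" using \<rho>B f by (auto simp: mass_bound_def)
      ultimately show ?thesis using L0 by (meson mult_left_mono order_trans)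
    qed
    moreover have "(\<lambda>k. ?L * ((\<integral>x. \<bar>f x\<bar> \<partial>m) + norm f * (measure (\<rho> k) UNIV - measure m UNIV))) \<longlonglongrightarrow>
        ?L * ((\<integral>x. \<bar>f x\<bar> \<partial>m) + norm f * (measure m UNIV - measure m UNIV))"
    proof (intro tendsto_intros)
      have "(\<lambda>k. emeasure (\<rho> k) UNIV) \<longlonglongrightarrow> emeasure m UNIV" using lim[of UNIV] em[of UNIV] by simp
      then show "(\<lambda>k. measure (\<rho> k) UNIV) \<longlonglongrightarrow> measure m UNIV"
        using finite_measure.emeasure_eq_measure[OF finm] finite_measure.emeasure_eq_measure[OF fin] by simp
    qed
    ultimately have "\<bar>T f \<pi>\<bar> \<le> ?L * ((\<integral>x. \<bar>f x\<bar> \<partial>m) + norm f * (measure m UNIV - measure m UNIV))"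
      by (intro LIMSEQ_le_const) auto
    then show "\<bar>T f \<pi>\<bar> \<le> ?L * (\<integral>x. \<bar>f x\<bar> \<partial>m)" by simp
  qed
  have "m \<le> \<nu>" if \<nu>: "mass_bound T \<nu>" for \<nu>
  proof -
    obtain R where R: "mass_bound T R" "\<And>A. A \<in> sets borel \<Longrightarrow> emeasure R A \<le> emeasure m A"
      "\<And>A. A \<in> sets borel \<Longrightarrow> emeasure R A \<le> emeasure \<nu> A"
      using mass_bound_min[OF ml mB \<nu>] by blast
    have sR: "sets R = sets borel" and fR: "finite_measure R" using R(1) sets by auto
    interpret R: finite_measure R by (rule fR)
    interpret m: finite_measure m by (rule finm)
    have "emeasure m A \<le> emeasure R A" if A: "A \<in> sets borel" for A
    proof -
      have "measure m UNIV \<le> measure R UNIV" using mc c_le[OF R(1)] by simp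
      moreover have "measure m UNIV = measure m A + measure m (UNIV - A)"
        using A m.finite_measure_compl[of A] by (simp add: sm spm)
      moreover have "measure R UNIV = measure R A + measure R (UNIV - A)"
        using A R.finite_measure_compl[of A] by (simp add: sR space_borel_sets[OF sR])
      moreover have "measure R (UNIV - A) \<le> measure m (UNIV - A)"
        using R(2)[of "UNIV - A"] A by (simp add: R.emeasure_eq_measure m.emeasure_eq_measure)
      ultimately show ?thesis by (simp add: R.emeasure_eq_measure m.emeasure_eq_measure)
    qed
    then show ?thesis using R(3) mB \<nu> by (auto simp: mass_bound_le intro: order_trans)
  qed
  with mB show ?thesis using that by blast
qed

lemma
  fixes T :: "('a::polish_space, 'n::finite) precurrent"
  assumes "multilinear T" "\<exists>\<mu>. mass_bound T \<mu>"
  shows mass_bound_mass: "mass_bound T (mass T)"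
    and mass_least: "mass_bound T \<nu> \<Longrightarrow> mass T \<le> \<nu>"
proof -
  obtain m where m: "mass_bound T m" "\<And>\<nu>. mass_bound T \<nu> \<Longrightarrow> m \<le> \<nu>"
    using mass_bound_least[OF assms] by blast
  then have "mass T = m" unfolding mass_def by (intro Least_equality) auto
  with m show "mass_bound T (mass T)" "mass_bound T \<nu> \<Longrightarrow> mass T \<le> \<nu>" by auto
qed

section \<open>The tensor product\<close>

text \<open>
  The algebraic tensor product \<open>C\<^sub>b(X) \<otimes> \<Lambda>\<^sup>n LIP(X)\<close> is built in one step, as the quotient of the free
  real vector space on \<open>C\<^sub>b(X) \<times> LIP(X)\<^sup>n\<close> by the multilinearity relations and by the generators with a
  repeated entry \<open>\<pi>\<^sub>i = \<pi>\<^sub>j\<close>: it is the universal target of the maps which are multilinear in all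
  \<open>n + 1\<close> arguments and alternating in the last \<open>n\<close>.
\<close>

typedef 'b free_space = "{c :: 'b \<Rightarrow> real. finite {b. c b \<noteq> 0}}"
  morphisms fs_coeff Abs_free_space
  by (rule exI[of _ "\<lambda>_. 0"]) simp

setup_lifting type_definition_free_space

instantiation free_space :: (type) real_vector
begin

lift_definition zero_free_space :: "'a free_space" is "\<lambda>_. 0" by simp

lift_definition plus_free_space :: "'a free_space \<Rightarrow> 'a free_space \<Rightarrow> 'a free_space"
  is "\<lambda>p q b. p b + q b"
  subgoal for p q by (rule finite_subset[of _ "{b. p b \<noteq> 0} \<union> {b. q b \<noteq> 0}"]) auto
  done

lift_definition minus_free_space :: "'a free_space \<Rightarrow> 'a free_space \<Rightarrow> 'a free_space"
  is "\<lambda>p q b. p b - q b"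
  subgoal for p q by (rule finite_subset[of _ "{b. p b \<noteq> 0} \<union> {b. q b \<noteq> 0}"]) auto
  done

lift_definition uminus_free_space :: "'a free_space \<Rightarrow> 'a free_space" is "\<lambda>p b. - p b" by simp

lift_definition scaleR_free_space :: "real \<Rightarrow> 'a free_space \<Rightarrow> 'a free_space" is "\<lambda>c p b. c * p b"
  by (rule finite_subset, rule subsetI, auto)

instance
  by standard (transfer; auto simp: algebra_simps)+

end

lift_definition gen :: "'b \<Rightarrow> 'b free_space" is "\<lambda>b x. if x = b then 1 else 0" by simp

definition free_lift :: "('b \<Rightarrow> 'v::real_vector) \<Rightarrow> 'b free_space \<Rightarrow> 'v" where
  "free_lift h p = (\<Sum>b | fs_coeff p b \<noteq> 0. fs_coeff p b *\<^sub>R h b)"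

lemma free_lift_superset:
  assumes "finite S" "{b. fs_coeff p b \<noteq> 0} \<subseteq> S"
  shows "free_lift h p = (\<Sum>b\<in>S. fs_coeff p b *\<^sub>R h b)"
  unfolding free_lift_def using assms by (intro sum.mono_neutral_left) auto

lemma finite_fs_coeff: "finite {b. fs_coeff p b \<noteq> 0}"
  using fs_coeff[of p] by simp

lemma linear_free_lift: "linear (free_lift h)"
proof (rule linearI)
  fix p q :: "'a free_space" and c :: real
  let ?S = "{b. fs_coeff p b \<noteq> 0} \<union> {b. fs_coeff q b \<noteq> 0}"
  have S: "finite ?S" by (simp add: finite_fs_coeff)
  show "free_lift h (p + q) = free_lift h p + free_lift h q"
    by (subst (1 2 3) free_lift_superset[OF S])
      (auto simp: plus_free_space.rep_eq scaleR_add_left sum.distrib)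
  show "free_lift h (c *\<^sub>R p) = c *\<^sub>R free_lift h p"
    by (subst (1 2) free_lift_superset[OF S])
      (auto simp: scaleR_free_space.rep_eq scaleR_sum_right)
qed

lemma free_lift_gen [simp]: "free_lift h (gen b) = h b"
  by (subst free_lift_superset[of "{b}"]) (auto simp: gen.rep_eq split: if_splits)

lemma free_lift_gen_id: "free_lift gen p = p"
proof -
  have lookup_sum: "fs_coeff (sum g S) x = (\<Sum>b\<in>S. fs_coeff (g b) x)" for g :: "'c \<Rightarrow> 'b free_space" and S x
    by (induction S rule: infinite_finite_induct) (auto simp: plus_free_space.rep_eq zero_free_space.rep_eq)
  have "fs_coeff (free_lift gen p) x = fs_coeff p x" for x
    unfolding free_lift_def lookup_sum
    by (simp add: scaleR_free_space.rep_eq gen.rep_eq if_distrib sum.delta finite_fs_coeff cong: if_cong)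
  then show ?thesis by (metis ext fs_coeff_inject)
qed

lemma span_gen: "p \<in> span (range gen)"
  by (subst free_lift_gen_id[symmetric], unfold free_lift_def, intro span_sum span_scale span_base) simp

inductive_set form_relations ::
    "(('a::metric_space \<Rightarrow>\<^sub>C real) \<times> ('n \<Rightarrow> 'a lip)) free_space set" where
  linear1: "gen (a *\<^sub>R f + b *\<^sub>R g, \<pi>) - a *\<^sub>R gen (f, \<pi>) - b *\<^sub>R gen (g, \<pi>) \<in> form_relations"
| linear2: "gen (f, \<pi>(j := a *\<^sub>R \<alpha> + b *\<^sub>R \<beta>)) - a *\<^sub>R gen (f, \<pi>(j := \<alpha>)) - b *\<^sub>R gen (f, \<pi>(j := \<beta>))
     \<in> form_relations"
| alternating: "i \<noteq> j \<Longrightarrow> \<pi> i = \<pi> j \<Longrightarrow> gen (f, \<pi>) \<in> form_relations"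

definition form_rel ::
    "(('a::metric_space \<Rightarrow>\<^sub>C real) \<times> ('n \<Rightarrow> 'a lip)) free_space \<Rightarrow> (('a \<Rightarrow>\<^sub>C real) \<times> ('n \<Rightarrow> 'a lip)) free_space \<Rightarrow> bool" where
  "form_rel p q \<longleftrightarrow> p - q \<in> span form_relations"

lemma equivp_form_rel: "equivp form_rel"
proof (rule equivpI, goal_cases)
  case 1
  show ?case by (rule reflpI) (simp add: form_rel_def span_zero)
next
  case 2
  show ?case by (rule sympI) (metis form_rel_def minus_diff_eq span_neg)
next
  case 3
  show ?case
    unfolding form_rel_def by (rule transpI) (use span_add in fastforce)
qed

quotient_type (overloaded) ('a, 'n) cform =
  "(('a::polish_space \<Rightarrow>\<^sub>C real) \<times> ('n::finite \<Rightarrow> 'a lip)) free_space" / form_rel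
  by (rule equivp_form_rel)

instantiation cform :: (polish_space, finite) real_vector
begin

lift_definition zero_cform :: "('a, 'b) cform" is 0 .

lift_definition plus_cform :: "('a, 'b) cform \<Rightarrow> ('a, 'b) cform \<Rightarrow> ('a, 'b) cform" is "(+)"
  unfolding form_rel_def by (metis add_diff_add span_add)

lift_definition minus_cform :: "('a, 'b) cform \<Rightarrow> ('a, 'b) cform \<Rightarrow> ('a, 'b) cform" is "(-)"
  unfolding form_rel_def
  subgoal premises prems for p q r s
  proof -
    have eq: "(p - q) - (r - s) = p - r - (q - s)" by (simp add: algebra_simps)
    show ?thesis using span_diff[OF prems] by (simp only: eq)
  qed
  done

lift_definition uminus_cform :: "('a, 'b) cform \<Rightarrow> ('a, 'b) cform" is "uminus"
  unfolding form_rel_def by (metis minus_diff_minus span_neg)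

lift_definition scaleR_cform :: "real \<Rightarrow> ('a, 'b) cform \<Rightarrow> ('a, 'b) cform" is "scaleR"
  unfolding form_rel_def by (metis scaleR_diff_right span_scale)

instance
  by standard (transfer; simp add: algebra_simps form_rel_def span_zero)+

end

text \<open>\<open>form f \<pi>\<close> is the tensor \<open>f d\<pi>\<^sub>1 \<and> \<dots> \<and> d\<pi>\<^sub>n\<close>.\<close>

lift_definition form :: "('a::polish_space \<Rightarrow>\<^sub>C real) \<Rightarrow> ('n::finite \<Rightarrow> 'a lip) \<Rightarrow> ('a, 'n) cform"
  is "\<lambda>f \<pi>. gen (f, \<pi>)" .

lift_definition cform_mult :: "('a::polish_space \<Rightarrow>\<^sub>C real) \<Rightarrow> ('a, 'n::finite) cform \<Rightarrow> ('a, 'n) cform"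
  is "\<lambda>f. free_lift (\<lambda>(g, \<pi>). gen (f \<odot> g, \<pi>))"
proof -
  fix f :: "'a \<Rightarrow>\<^sub>C real" and p q :: "(('a \<Rightarrow>\<^sub>C real) \<times> ('n \<Rightarrow> 'a lip)) free_space"
  let ?m = "free_lift (\<lambda>(g, \<pi> :: 'n \<Rightarrow> 'a lip). gen (f \<odot> g, \<pi>))"
  assume "form_rel p q"
  then have pq: "p - q \<in> span form_relations" by (simp add: form_rel_def)
  have lin: "?m (u - v) = ?m u - ?m v" "?m (c *\<^sub>R u) = c *\<^sub>R ?m u" for u v c
    by (simp_all add: linear_diff[OF linear_free_lift] linear_scale[OF linear_free_lift])
  have dist: "f \<odot> (a *\<^sub>R g + b *\<^sub>R h) = a *\<^sub>R (f \<odot> g) + b *\<^sub>R (f \<odot> h)" for a b g h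
    by (rule bcontfun_eqI) (simp add: algebra_simps)
  have "?m r \<in> form_relations" if "r \<in> form_relations" for r
    using that
  proof cases
    case (linear1 a g b h \<pi>)
    then have "?m r = gen (a *\<^sub>R (f \<odot> g) + b *\<^sub>R (f \<odot> h), \<pi>) - a *\<^sub>R gen (f \<odot> g, \<pi>) - b *\<^sub>R gen (f \<odot> h, \<pi>)"
      by (simp only: lin free_lift_gen split_conv dist)
    then show ?thesis by (simp only: form_relations.linear1)
  next
    case (linear2 g \<pi> j a \<alpha> b \<beta>)
    then have "?m r = gen (f \<odot> g, \<pi>(j := a *\<^sub>R \<alpha> + b *\<^sub>R \<beta>)) - a *\<^sub>R gen (f \<odot> g, \<pi>(j := \<alpha>)) - b *\<^sub>R gen (f \<odot> g, \<pi>(j := \<beta>))"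
      by (simp only: lin free_lift_gen split_conv)
    then show ?thesis by (simp only: form_relations.linear2)
  next
    case (alternating i j \<pi> g)
    then have "?m r = gen (f \<odot> g, \<pi>)" by (simp only: free_lift_gen split_conv)
    with alternating show ?thesis using form_relations.alternating by metis
  qed
  then have "?m ` form_relations \<subseteq> form_relations" by blast
  then have "?m ` span form_relations \<subseteq> span form_relations"
    unfolding linear_span_image[OF linear_free_lift, symmetric] by (rule span_mono)
  then have "?m (p - q) \<in> span form_relations" using pq by blast
  then show "form_rel (?m p) (?m q)" by (simp only: form_rel_def lin)
qed

lemma form_linear1: "form (a *\<^sub>R f + b *\<^sub>R g) \<pi> = a *\<^sub>R form f \<pi> + b *\<^sub>R form g \<pi>"
proof transfer
  fix a b :: real and f g :: "'a \<Rightarrow>\<^sub>C real" and \<pi> :: "'b \<Rightarrow> 'a lip"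
  have "gen (a *\<^sub>R f + b *\<^sub>R g, \<pi>) - a *\<^sub>R gen (f, \<pi>) - b *\<^sub>R gen (g, \<pi>) \<in> span form_relations"
    by (intro span_base form_relations.intros)
  then show "form_rel (gen (a *\<^sub>R f + b *\<^sub>R g, \<pi>)) (a *\<^sub>R gen (f, \<pi>) + b *\<^sub>R gen (g, \<pi>))"
    by (simp add: form_rel_def algebra_simps)
qed

lemma form_linear2:
  "form f (\<pi>(j := a *\<^sub>R \<alpha> + b *\<^sub>R \<beta>)) = a *\<^sub>R form f (\<pi>(j := \<alpha>)) + b *\<^sub>R form f (\<pi>(j := \<beta>))"
proof transfer
  fix a b :: real and f :: "'a \<Rightarrow>\<^sub>C real" and \<pi> :: "'b \<Rightarrow> 'a lip" and j \<alpha> \<beta>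
  have "gen (f, \<pi>(j := a *\<^sub>R \<alpha> + b *\<^sub>R \<beta>)) - a *\<^sub>R gen (f, \<pi>(j := \<alpha>)) - b *\<^sub>R gen (f, \<pi>(j := \<beta>)) \<in> span form_relations"
    by (intro span_base form_relations.intros)
  then show "form_rel (gen (f, \<pi>(j := a *\<^sub>R \<alpha> + b *\<^sub>R \<beta>))) (a *\<^sub>R gen (f, \<pi>(j := \<alpha>)) + b *\<^sub>R gen (f, \<pi>(j := \<beta>)))"
    by (simp add: form_rel_def algebra_simps)
qed

lemma form_alternating: "i \<noteq> j \<Longrightarrow> \<pi> i = \<pi> j \<Longrightarrow> form f \<pi> = 0"
proof transfer
  fix i j :: 'a and \<pi> :: "'a \<Rightarrow> 'b lip" and f
  assume "i \<noteq> j" "\<pi> i = \<pi> j"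
  then have "gen (f, \<pi>) \<in> span form_relations"
    using \<open>i \<noteq> j\<close> \<open>\<pi> i = \<pi> j\<close> by (intro span_base form_relations.alternating)
  then show "form_rel (gen (f, \<pi>)) 0" by (simp add: form_rel_def)
qed

lemma linear_abs_cform: "linear abs_cform"
  by (rule linearI) (simp_all add: plus_cform.abs_eq scaleR_cform.abs_eq)

lemma span_form: "(v :: ('a::polish_space, 'n::finite) cform) \<in> span {form f \<pi> | f \<pi>. True}"
proof -
  obtain p where v: "v = abs_cform p" by (metis Quotient_cform Quotient_abs_rep)
  have "abs_cform p \<in> abs_cform ` span (range gen)" by (intro imageI span_gen)
  also have "\<dots> = span (abs_cform ` range gen)" by (rule linear_span_image[OF linear_abs_cform, symmetric])
  also have "abs_cform ` range gen = {form f \<pi> | f \<pi>. True}"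
    by (auto simp: form.abs_eq)
  finally show ?thesis by (simp add: v)
qed

lemma linear_cform_mult: "linear (cform_mult f)"
proof (rule linearI)
  fix v w :: "('a, 'b) cform" and c :: real
  show "cform_mult f (v + w) = cform_mult f v + cform_mult f w"
    by transfer (simp add: linear_add[OF linear_free_lift] form_rel_def span_zero)
  show "cform_mult f (c *\<^sub>R v) = c *\<^sub>R cform_mult f v"
    by transfer (simp add: linear_scale[OF linear_free_lift] form_rel_def span_zero)
qed

lemma cform_mult_form [simp]: "cform_mult f (form g \<pi>) = form (f \<odot> g) \<pi>"
  by transfer (simp add: form_rel_def span_zero)

lemma linear_cform_eqI:
  fixes L M :: "('a::polish_space, 'n::finite) cform \<Rightarrow> 'v::real_vector"
  assumes "linear L" "linear M" "\<And>f \<pi>. L (form f \<pi>) = M (form f \<pi>)"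
  shows "L = M"
  using linear_eq_on_span[OF assms(1,2), of "{form f \<pi> | f \<pi>. True}"] assms(3) span_form by blast

section \<open>The seminorm\<close>

text \<open>
  \<open>extends T L\<close>: \<open>L\<close> is the linear map on the tensor product to which the current \<open>T\<close> extends, that is
  \<open>L v = T(v)\<close>.  There is at most one such \<open>L\<close>, see \<open>extends_unique\<close>.
\<close>

definition extends :: "('a::polish_space, 'n::finite) precurrent \<Rightarrow> (('a, 'n) cform \<Rightarrow> real) \<Rightarrow> bool" where
  "extends T L \<longleftrightarrow> linear L \<and> (\<forall>f\<in>LIPb. \<forall>\<pi>. L (form f \<pi>) = T f \<pi>) \<and>
     (\<forall>f \<pi>. \<bar>L (form f \<pi>)\<bar> \<le> (\<Prod>j\<in>UNIV. Lip (\<pi> j)) * (\<integral>x. \<bar>f x\<bar> \<partial>mass T))"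

definition current_seminorm :: "('a::polish_space, 'n::finite) cform \<Rightarrow> real" where
  "current_seminorm v = Sup {L v | L. \<exists>T. current T \<and> emeasure (mass T) UNIV \<le> 1 \<and> extends T L}"

lemma current_mass_bound: "current T \<Longrightarrow> mass_bound T (mass (T :: ('a::polish_space, 'n::finite) precurrent))"
  unfolding current_def by (blast intro: mass_bound_mass)

lemma
  fixes T :: "('a::polish_space, 'n::finite) precurrent"
  assumes "current T"
  shows finite_mass: "finite_measure (mass T)"
    and sets_mass: "sets (mass T) = sets borel"
    and space_mass: "space (mass T) = UNIV"
    and mass_le: "mass_bound T \<nu> \<Longrightarrow> A \<in> sets borel \<Longrightarrow> emeasure (mass T) A \<le> emeasure \<nu> A"
proof -
  show "finite_measure (mass T)" and *: "sets (mass T) = sets borel"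
    using current_mass_bound[OF assms] by (auto simp: mass_bound_def)
  then show "space (mass T) = UNIV" using space_borel_sets by blast
  show "mass_bound T \<nu> \<Longrightarrow> A \<in> sets borel \<Longrightarrow> emeasure (mass T) A \<le> emeasure \<nu> A"
    using mass_least[of T \<nu>] mass_bound_le[OF current_mass_bound[OF assms], of \<nu>] assms
    unfolding current_def by blast
qed

lemma cb_integral_tendsto_0:
  fixes F :: "nat \<Rightarrow> 'a::metric_space \<Rightarrow>\<^sub>C real"
  assumes "finite_measure \<mu>" "sets \<mu> = sets borel"
    and "\<And>k x. \<bar>F k x\<bar> \<le> B" "\<And>x. (\<lambda>k. F k x) \<longlonglongrightarrow> 0"
  shows "(\<lambda>k. \<integral>x. \<bar>F k x\<bar> \<partial>\<mu>) \<longlonglongrightarrow> 0"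
proof -
  interpret finite_measure \<mu> by fact
  have "(\<lambda>k. \<integral>x. \<bar>F k x\<bar> \<partial>\<mu>) \<longlonglongrightarrow> (\<integral>x. 0 \<partial>\<mu>)"
    using assms(3,4) cb_measurable[OF assms(2)]
    by (intro integral_dominated_convergence[where w = "\<lambda>_. B"] integrable_const)
      (auto intro!: tendsto_rabs_zero borel_measurable_abs)
  then show ?thesis by simp
qed

lemma extends_form_tendsto:
  fixes F :: "nat \<Rightarrow> 'a::polish_space \<Rightarrow>\<^sub>C real"
  assumes "current T" "extends T L"
    and "\<And>k x. \<bar>F k x\<bar> \<le> B" "\<And>x. (\<lambda>k. F k x) \<longlonglongrightarrow> 0"
  shows "(\<lambda>k. L (form (F k) \<pi>)) \<longlonglongrightarrow> 0"
proof (rule Lim_null_comparison)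
  show "\<forall>\<^sub>F k in sequentially. norm (L (form (F k) \<pi>)) \<le> (\<Prod>j\<in>UNIV. Lip (\<pi> j)) * (\<integral>x. \<bar>F k x\<bar> \<partial>mass T)"
    using assms(2) by (auto simp: extends_def)
  have "(\<lambda>k. \<integral>x. \<bar>F k x\<bar> \<partial>mass T) \<longlonglongrightarrow> 0"
    by (rule cb_integral_tendsto_0[OF finite_mass[OF assms(1)] sets_mass[OF assms(1)] assms(3,4)])
  then show "(\<lambda>k. (\<Prod>j\<in>UNIV. Lip (\<pi> j)) * (\<integral>x. \<bar>F k x\<bar> \<partial>mass T)) \<longlonglongrightarrow> 0"
    by (rule tendsto_mult_right_zero)
qed

lemma form_diff1: "form (f - g) \<pi> = form f \<pi> - form g \<pi>"
  using form_linear1[of 1 f "-1" g \<pi>] by simp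

lemma extends_unique:
  assumes "current T" "extends T L" "extends T M"
  shows "L = M"
proof (rule linear_cform_eqI)
  show lin: "linear L" "linear M" using assms by (auto simp: extends_def)
  fix f :: "'a \<Rightarrow>\<^sub>C real" and \<pi> :: "'b \<Rightarrow> 'a lip"
  obtain F where F: "\<And>k. F k \<in> LIPb" "\<And>k x. \<bar>F k x\<bar> \<le> norm f" "\<And>x. (\<lambda>k. F k x) \<longlonglongrightarrow> f x"
    using Lip_approx[of f] by blast
  have bd: "\<bar>(f - F k) x\<bar> \<le> norm f + norm f" for k x
    using F(2)[of k x] abs_bcontfun_le[of f x] by simp
  have lm: "(\<lambda>k. (f - F k) x) \<longlonglongrightarrow> 0" for x
    using tendsto_diff[OF tendsto_const F(3), of "f x" x] by simp
  have eq: "L (form f \<pi>) - M (form f \<pi>) = L (form (f - F k) \<pi>) - M (form (f - F k) \<pi>)" for k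
  proof -
    have "L (form (F k) \<pi>) = M (form (F k) \<pi>)"
      using assms F(1) unfolding extends_def by metis
    then show ?thesis by (simp add: form_diff1 linear_diff[OF lin(1)] linear_diff[OF lin(2)])
  qed
  have "(\<lambda>k. L (form (f - F k) \<pi>) - M (form (f - F k) \<pi>)) \<longlonglongrightarrow> 0 - 0"
    by (intro tendsto_diff extends_form_tendsto[OF assms(1,2) bd lm] extends_form_tendsto[OF assms(1,3) bd lm])
  then have "(\<lambda>k::nat. L (form f \<pi>) - M (form f \<pi>)) \<longlonglongrightarrow> 0" by (simp flip: eq)
  then show "L (form f \<pi>) = M (form f \<pi>)" by (simp add: LIMSEQ_const_iff)
qed

lemma mass_bound_scale:
  assumes "mass_bound T \<mu>"
  shows "mass_bound (\<lambda>f \<pi>. c * T f \<pi>) (scale_measure (ennreal \<bar>c\<bar>) \<mu>)"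
proof -
  let ?\<nu> = "scale_measure (ennreal \<bar>c\<bar>) \<mu>"
  have s: "sets \<mu> = sets borel" and fin: "finite_measure \<mu>" using assms by (auto simp: mass_bound_def)
  have fin': "finite_measure ?\<nu>"
    using finite_measure.emeasure_finite[OF fin]
    by (intro finite_measureI) (auto simp: space_scale_measure ennreal_mult_eq_top_iff)
  have int: "(\<integral>x. \<bar>f x\<bar> \<partial>?\<nu>) = \<bar>c\<bar> * (\<integral>x. \<bar>f x\<bar> \<partial>\<mu>)" for f :: "'a \<Rightarrow>\<^sub>C real"
  proof -
    have [measurable]: "apply_bcontfun f \<in> borel_measurable \<mu>" by (rule cb_measurable[OF s])
    have "apply_bcontfun f \<in> borel_measurable ?\<nu>" by (rule cb_measurable) (simp add: s)
    then show ?thesis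
      by (subst (1 2) integral_eq_nn_integral)
        (auto simp: nn_integral_scale_measure enn2real_mult)
  qed
  show ?thesis
    unfolding mass_bound_def
  proof (intro conjI fin' ballI allI)
    show "sets ?\<nu> = sets borel" using s by simp
    fix f :: "'a \<Rightarrow>\<^sub>C real" and \<pi> :: "'b \<Rightarrow> 'a lip" assume "f \<in> LIPb"
    then have "\<bar>c\<bar> * \<bar>T f \<pi>\<bar> \<le> \<bar>c\<bar> * ((\<Prod>j\<in>UNIV. Lip (\<pi> j)) * (\<integral>x. \<bar>f x\<bar> \<partial>\<mu>))"
      using assms by (intro mult_left_mono) (auto simp: mass_bound_def)
    then show "\<bar>c * T f \<pi>\<bar> \<le> (\<Prod>j\<in>UNIV. Lip (\<pi> j)) * (\<integral>x. \<bar>f x\<bar> \<partial>?\<nu>)"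
      by (simp add: int abs_mult algebra_simps)
  qed
qed

lemma extends_bound_limit:
  fixes L :: "('a::polish_space, 'n::finite) cform \<Rightarrow> real"
  assumes lin: "linear L" and \<mu>: "finite_measure \<mu>" "sets \<mu> = sets borel"
    and bd: "\<And>f \<pi>. \<bar>L (form f \<pi>)\<bar> \<le> (\<Prod>j\<in>UNIV. Lip (\<pi> j)) * (\<integral>x. \<bar>f x\<bar> \<partial>\<mu>)"
    and \<nu>: "finite_measure \<nu>" "sets \<nu> = sets borel"
    and bd': "\<And>f \<pi>. f \<in> LIPb \<Longrightarrow> \<bar>L (form f \<pi>)\<bar> \<le> (\<Prod>j\<in>UNIV. Lip (\<pi> j)) * (\<integral>x. \<bar>f x\<bar> \<partial>\<nu>)"
  shows "\<bar>L (form f \<pi>)\<bar> \<le> (\<Prod>j\<in>UNIV. Lip (\<pi> j)) * (\<integral>x. \<bar>f x\<bar> \<partial>\<nu>)"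
proof -
  let ?P = "\<Prod>j\<in>UNIV. Lip (\<pi> j)"
  have P0: "0 \<le> ?P" by (intro prod_nonneg) auto
  obtain F where F: "\<And>k. F k \<in> LIPb" "\<And>k x. \<bar>F k x\<bar> \<le> norm f" "\<And>x. (\<lambda>k. F k x) \<longlonglongrightarrow> f x"
    using Lip_approx[of f] by blast
  have bdd: "\<bar>(f - F k) x\<bar> \<le> norm f + norm f" for k x
    using F(2)[of k x] abs_bcontfun_le[of f x] by simp
  have lm: "(\<lambda>k. (f - F k) x) \<longlonglongrightarrow> 0" for x
    using tendsto_diff[OF tendsto_const F(3), of "f x" x] by simp
  have "\<bar>L (form f \<pi>)\<bar> \<le> ?P * (\<integral>x. \<bar>(f - F k) x\<bar> \<partial>\<mu>) + ?P * ((\<integral>x. \<bar>f x\<bar> \<partial>\<nu>) + (\<integral>x. \<bar>(f - F k) x\<bar> \<partial>\<nu>))" for k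
  proof -
    have "L (form f \<pi>) = L (form (f - F k) \<pi>) + L (form (F k) \<pi>)"
      by (simp add: form_diff1 linear_diff[OF lin])
    moreover have "(\<integral>x. \<bar>F k x\<bar> \<partial>\<nu>) \<le> (\<integral>x. \<bar>f x\<bar> + \<bar>(f - F k) x\<bar> \<partial>\<nu>)"
      using cb_integrable[OF \<nu>]
      by (intro integral_mono Bochner_Integration.integrable_add integrable_abs) auto
    moreover have "\<dots> = (\<integral>x. \<bar>f x\<bar> \<partial>\<nu>) + (\<integral>x. \<bar>(f - F k) x\<bar> \<partial>\<nu>)"
      using cb_integrable[OF \<nu>]
      by (intro Bochner_Integration.integral_add integrable_abs)
    ultimately show ?thesis
      using bd[of "f - F k" \<pi>] order_trans[OF bd'[OF F(1)[of k], of \<pi>] mult_left_mono[OF _ P0]]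
      by fastforce
  qed
  moreover have "(\<lambda>k. ?P * (\<integral>x. \<bar>(f - F k) x\<bar> \<partial>\<mu>) + ?P * ((\<integral>x. \<bar>f x\<bar> \<partial>\<nu>) + (\<integral>x. \<bar>(f - F k) x\<bar> \<partial>\<nu>)))
      \<longlonglongrightarrow> ?P * 0 + ?P * ((\<integral>x. \<bar>f x\<bar> \<partial>\<nu>) + 0)"
    by (intro tendsto_intros cb_integral_tendsto_0[OF \<mu> bdd lm] cb_integral_tendsto_0[OF \<nu> bdd lm])
  ultimately have "\<bar>L (form f \<pi>)\<bar> \<le> ?P * 0 + ?P * ((\<integral>x. \<bar>f x\<bar> \<partial>\<nu>) + 0)"
    by (intro LIMSEQ_le_const) auto
  then show ?thesis by simp
qed

text \<open>The restriction of a current by a bounded continuous function is a current.\<close>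

lemma current_restrict:
  fixes T :: "('a::polish_space, 'n::finite) precurrent" and f :: "'a \<Rightarrow>\<^sub>C real"
  assumes T: "current T" and L: "extends T L"
  defines "S \<equiv> \<lambda>g \<pi>. L (form (f \<odot> g) \<pi>)"
  shows "current S" "extends S (\<lambda>v. L (cform_mult f v))"
    "measure (mass S) UNIV \<le> (\<integral>x. \<bar>f x\<bar> \<partial>mass T)"
proof -
  let ?M = "mass T"
  let ?D = "density ?M (\<lambda>x. ennreal \<bar>f x\<bar>)"
  have lin: "linear L" using L by (simp add: extends_def)
  note fin = finite_mass[OF T] and st = sets_mass[OF T] and sp = space_mass[OF T]
  have sD: "sets ?D = sets borel" by (simp add: st)
  have [measurable]: "apply_bcontfun g \<in> borel_measurable ?M" for g :: "'a \<Rightarrow>\<^sub>C real" by (rule cb_measurable[OF st])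
  have int: "integrable ?M (\<lambda>x. \<bar>g x\<bar>)" for g :: "'a \<Rightarrow>\<^sub>C real"
    using cb_integrable[OF fin st] by blast
  have eD: "emeasure ?D UNIV = ennreal (\<integral>x. \<bar>f x\<bar> \<partial>?M)"
    using int[of f] by (subst emeasure_density) (auto simp: st nn_integral_eq_integral)
  have finD: "finite_measure ?D"
    using eD by (intro finite_measureI) (simp add: sp)
  obtain F where F: "\<And>k. F k \<in> LIPb" "\<And>k x. \<bar>F k x\<bar> \<le> norm f" "\<And>x. (\<lambda>k. F k x) \<longlonglongrightarrow> f x"
    using Lip_approx[of f] by blast
  have bdd: "\<bar>(f - F k) x\<bar> \<le> norm f + norm f" for k x
    using F(2)[of k x] abs_bcontfun_le[of f x] by simp
  have lm: "(\<lambda>k. (f - F k) x) \<longlonglongrightarrow> 0" for x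
    using tendsto_diff[OF tendsto_const F(3), of "f x" x] by simp
  have bdd': "\<bar>((f - F k) \<odot> g) x\<bar> \<le> (norm f + norm f) * norm g" for k x g
    using mult_mono[OF bdd[of k x] abs_bcontfun_le[of g x]] by (simp add: abs_mult)
  have lm': "(\<lambda>k. ((f - F k) \<odot> g) x) \<longlonglongrightarrow> 0" for x g
    using tendsto_mult_left_zero[OF lm[of x], of "g x"] by simp
  have dist: "f \<odot> (a *\<^sub>R g + b *\<^sub>R h) = a *\<^sub>R (f \<odot> g) + b *\<^sub>R (f \<odot> h)" for a b g h
    by (rule bcontfun_eqI) (simp add: algebra_simps)
  have split: "f \<odot> g = (f - F k) \<odot> g + F k \<odot> g" for g k
    by (rule bcontfun_eqI) (simp add: algebra_simps)
  have Lsplit: "L (form (f \<odot> g) \<pi>) = L (form ((f - F k) \<odot> g) \<pi>) + T (F k \<odot> g) \<pi>" if "g \<in> LIPb" for g \<pi> k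
  proof -
    have "form (f \<odot> g) \<pi> = form ((f - F k) \<odot> g) \<pi> + form (F k \<odot> g) \<pi>"
      unfolding split[of g k] using form_linear1[of 1 "(f - F k) \<odot> g" 1 "F k \<odot> g" \<pi>] by simp
    then show ?thesis
      using L LIPb_times[OF F(1) that] by (simp add: linear_add[OF lin] extends_def)
  qed
  have Lbd: "\<bar>L (form g \<pi>)\<bar> \<le> (\<Prod>j\<in>UNIV. Lip (\<pi> j)) * (\<integral>x. \<bar>g x\<bar> \<partial>?M)" for g \<pi>
    using L by (simp add: extends_def)
  have bound: "\<bar>S g \<pi>\<bar> \<le> (\<Prod>j\<in>UNIV. Lip (\<pi> j)) * (\<integral>x. \<bar>g x\<bar> \<partial>?D)" for g \<pi>
  proof -
    have "(\<integral>x. \<bar>g x\<bar> \<partial>?D) = (\<integral>x. \<bar>f x\<bar> * \<bar>g x\<bar> \<partial>?M)"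
      by (subst integral_density) auto
    then show ?thesis using Lbd[of "f \<odot> g" \<pi>] by (simp add: S_def abs_mult)
  qed
  have mbD: "mass_bound S ?D"
    unfolding mass_bound_def using bound finD sD by auto
  have "multilinear S"
    unfolding multilinear_def S_def
    by (auto simp: dist form_linear1 form_linear2 linear_add[OF lin] linear_scale[OF lin])
  moreover have "is_local S"
    unfolding is_local_def
  proof (intro ballI allI impI)
    fix g :: "'a \<Rightarrow>\<^sub>C real" and \<pi> :: "'n \<Rightarrow> 'a lip"
    assume g: "g \<in> LIPb" and "\<exists>j U c. open U \<and> {x. apply_bcontfun g x \<noteq> 0} \<subseteq> U \<and> (\<forall>x\<in>U. apply_lip (\<pi> j) x = c)"
    then obtain j U c where j: "open U" "{x. apply_bcontfun g x \<noteq> 0} \<subseteq> U" "\<forall>x\<in>U. apply_lip (\<pi> j) x = c"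
      by blast
    have "{x. apply_bcontfun (F k \<odot> g) x \<noteq> 0} \<subseteq> U" for k using j(2) by auto
    then have "T (F k \<odot> g) \<pi> = 0" for k
      using T LIPb_times[OF F(1) g] j(1,3) unfolding current_def is_local_def by blast
    then have "S g \<pi> = L (form ((f - F k) \<odot> g) \<pi>)" for k unfolding S_def Lsplit[OF g, of \<pi> k] by simp
    moreover have "(\<lambda>k. L (form ((f - F k) \<odot> g) \<pi>)) \<longlonglongrightarrow> 0"
      by (rule extends_form_tendsto[OF T L bdd' lm'])
    ultimately have "(\<lambda>k::nat. S g \<pi>) \<longlonglongrightarrow> 0" by simp
    then show "S g \<pi> = 0" by (simp add: LIMSEQ_const_iff)
  qed
  moreover have "seq_continuous S"
    unfolding seq_continuous_def
  proof (intro ballI allI impI)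
    fix g :: "'a \<Rightarrow>\<^sub>C real" and P :: "nat \<Rightarrow> 'n \<Rightarrow> 'a lip" and \<pi> :: "'n \<Rightarrow> 'a lip"
    assume g: "g \<in> LIPb"
      and P: "(\<forall>j. \<exists>L. \<forall>i. L-lipschitz_on UNIV (apply_lip (P i j))) \<and>
        (\<forall>j x. (\<lambda>i. apply_lip (P i j) x) \<longlonglongrightarrow> apply_lip (\<pi> j) x)"
    then obtain K where K: "\<And>i j. (K j)-lipschitz_on UNIV (apply_lip (P i j))" by metis
    let ?A = "\<Prod>j\<in>UNIV. K j" and ?B = "\<Prod>j\<in>UNIV. Lip (\<pi> j)"
    have A: "(\<Prod>j\<in>UNIV. Lip (P i j)) \<le> ?A" for i
      by (intro prod_mono) (auto intro: Lip_le K)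
    have B0: "0 \<le> ?B" by (intro prod_nonneg) auto
    have A0: "0 \<le> ?A" by (intro prod_nonneg) (auto intro: lipschitz_on_nonneg K)
    show "(\<lambda>i. S g (P i)) \<longlonglongrightarrow> S g \<pi>"
    proof (rule LIMSEQ_I)
      fix r :: real assume r: "r > 0"
      have "(\<lambda>k. (?A + ?B) * (\<integral>x. \<bar>((f - F k) \<odot> g) x\<bar> \<partial>?M)) \<longlonglongrightarrow> 0"
        by (intro tendsto_mult_right_zero cb_integral_tendsto_0[OF fin st bdd' lm'])
      then have "\<forall>\<^sub>F k in sequentially. (?A + ?B) * (\<integral>x. \<bar>((f - F k) \<odot> g) x\<bar> \<partial>?M) < r / 2"
        by (rule order_tendstoD) (use r in simp)
      then obtain k where k: "(?A + ?B) * (\<integral>x. \<bar>((f - F k) \<odot> g) x\<bar> \<partial>?M) < r / 2"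
        by (auto simp: eventually_sequentially)
      let ?I = "\<integral>x. \<bar>((f - F k) \<odot> g) x\<bar> \<partial>?M"
      have I0: "0 \<le> ?I" by (rule Bochner_Integration.integral_nonneg) simp
      have "(\<lambda>i. T (F k \<odot> g) (P i)) \<longlonglongrightarrow> T (F k \<odot> g) \<pi>"
        using T LIPb_times[OF F(1) g] P unfolding current_def seq_continuous_def by blast
      then obtain N where N: "\<And>i. i \<ge> N \<Longrightarrow> \<bar>T (F k \<odot> g) (P i) - T (F k \<odot> g) \<pi>\<bar> < r / 2"
        using LIMSEQ_D[of _ _ "r/2"] r by (metis half_gt_zero real_norm_def)
      have "norm (S g (P i) - S g \<pi>) < r" if "i \<ge> N" for i
      proof -
        have "\<bar>L (form ((f - F k) \<odot> g) (P i))\<bar> \<le> ?A * ?I"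
          using Lbd[of "(f - F k) \<odot> g" "P i"] mult_right_mono[OF A I0] by (rule order_trans)
        moreover have "\<bar>L (form ((f - F k) \<odot> g) \<pi>)\<bar> \<le> ?B * ?I" by (rule Lbd)
        ultimately show ?thesis
          using N[OF that] k unfolding S_def Lsplit[OF g, of _ k] real_norm_def distrib_right by linarith
      qed
      then show "\<exists>N. \<forall>i\<ge>N. norm (S g (P i) - S g \<pi>) < r" by blast
    qed
  qed
  ultimately show cS: "current S" unfolding current_def using mbD by blast
  show "extends S (\<lambda>v. L (cform_mult f v))"
    unfolding extends_def
  proof (intro conjI ballI allI)
    show lin': "linear (\<lambda>v. L (cform_mult f v))"
      using linear_compose[OF linear_cform_mult lin, of f] by (simp add: o_def)
    show "L (cform_mult f (form g \<pi>)) = S g \<pi>" for g \<pi> by (simp add: S_def)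
    show "\<bar>L (cform_mult f (form g \<pi>))\<bar> \<le> (\<Prod>j\<in>UNIV. Lip (\<pi> j)) * (\<integral>x. \<bar>g x\<bar> \<partial>mass S)" for g \<pi>
    proof (rule extends_bound_limit[OF lin' finD sD _ finite_mass[OF cS] sets_mass[OF cS]])
      show "\<bar>L (cform_mult f (form g \<pi>))\<bar> \<le> (\<Prod>j\<in>UNIV. Lip (\<pi> j)) * (\<integral>x. \<bar>g x\<bar> \<partial>?D)" for g \<pi>
        using bound[of g \<pi>] by (simp add: S_def)
      show "\<bar>L (cform_mult f (form g \<pi>))\<bar> \<le> (\<Prod>j\<in>UNIV. Lip (\<pi> j)) * (\<integral>x. \<bar>g x\<bar> \<partial>mass S)"
        if "g \<in> LIPb" for g \<pi>
        using current_mass_bound[OF cS] that by (simp add: mass_bound_def S_def)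
    qed
  qed
  have "emeasure (mass S) UNIV \<le> ennreal (\<integral>x. \<bar>f x\<bar> \<partial>?M)"
    using mass_le[OF cS mbD, of UNIV] by (simp add: eD)
  then show "measure (mass S) UNIV \<le> (\<integral>x. \<bar>f x\<bar> \<partial>?M)"
    by (simp add: finite_measure.emeasure_eq_measure[OF finite_mass[OF cS]])
qed

lemma current_scale:
  fixes T :: "('a::polish_space, 'n::finite) precurrent"
  assumes T: "current T" and L: "extends T L"
  shows "current (\<lambda>f \<pi>. c * T f \<pi>)" "extends (\<lambda>f \<pi>. c * T f \<pi>) (\<lambda>v. c * L v)"
    "measure (mass (\<lambda>f \<pi>. c * T f \<pi>)) UNIV \<le> \<bar>c\<bar> * measure (mass T) UNIV"
proof -
  let ?S = "\<lambda>f \<pi>. c * T f \<pi>"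
  have c: "const_bcontfun c \<odot> f = c *\<^sub>R f" for f :: "'a \<Rightarrow>\<^sub>C real"
    by (rule bcontfun_eqI) simp
  have lin: "linear L" using L by (simp add: extends_def)
  note * = current_restrict[OF T L, of "const_bcontfun c"]
  define S' where "S' = (\<lambda>g \<pi>. L (form (const_bcontfun c \<odot> g) \<pi>))"
  have f0: "form (c *\<^sub>R f) \<pi> = c *\<^sub>R form f \<pi>" for f :: "'a \<Rightarrow>\<^sub>C real" and \<pi> :: "'n \<Rightarrow> 'a lip"
    using form_linear1[of c f 0 f \<pi>] by simp
  have S': "S' g \<pi> = c * T g \<pi>" if "g \<in> LIPb" for g \<pi>
    using L that unfolding S'_def c f0 by (simp add: linear_scale[OF lin] extends_def)
  have mb: "mass_bound S' = mass_bound ?S"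
    by (rule ext) (simp add: mass_bound_def S')
  have ml: "multilinear S' = multilinear ?S"
    unfolding multilinear_def by (simp add: S' LIPb_add LIPb_scaleR cong: ball_cong)
  have sc: "seq_continuous S' = seq_continuous ?S" "is_local S' = is_local ?S"
    unfolding seq_continuous_def is_local_def by (simp_all add: S' cong: ball_cong)
  have mass: "mass S' = mass ?S" unfolding mass_def mb ..
  have cS': "current S'" using *(1) by (simp add: S'_def)
  then show cS: "current ?S" unfolding current_def ml sc mb .
  have cm: "cform_mult (const_bcontfun c) v = c *\<^sub>R v" for v :: "('a, 'n) cform"
  proof -
    have "cform_mult (const_bcontfun c) = (\<lambda>v :: ('a, 'n) cform. c *\<^sub>R v)"
      by (rule linear_cform_eqI) (auto simp: linear_cform_mult linear_scale_self c f0)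
    then show ?thesis by (rule fun_cong)
  qed
  have "extends S' (\<lambda>v. c * L v)"
    using *(2) by (simp add: S'_def cm linear_scale[OF lin])
  then show "extends ?S (\<lambda>v. c * L v)"
    unfolding extends_def mass by (simp add: S')
  show "measure (mass ?S) UNIV \<le> \<bar>c\<bar> * measure (mass T) UNIV"
    using *(3) by (simp add: mass[symmetric] S'_def space_mass[OF T] mult.commute)
qed

abbreviation unit_functionals :: "(('a::polish_space, 'n::finite) cform \<Rightarrow> real) set" where
  "unit_functionals \<equiv> {L. \<exists>T. current T \<and> emeasure (mass T) UNIV \<le> 1 \<and> extends T L}"

lemma emeasure_mass_le_1:
  fixes T :: "('a::polish_space, 'n::finite) precurrent"
  assumes "current T"
  shows "emeasure (mass T) UNIV \<le> 1 \<longleftrightarrow> measure (mass T) UNIV \<le> 1"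
  by (simp add: finite_measure.emeasure_eq_measure[OF finite_mass[OF assms]])

lemma unit_functionals_linear: "L \<in> unit_functionals \<Longrightarrow> linear L"
  by (auto simp: extends_def)

lemma zero_unit_functional: "(\<lambda>_. 0) \<in> (unit_functionals :: (('a::polish_space, 'n::finite) cform \<Rightarrow> real) set)"
proof -
  let ?Z = "\<lambda>f \<pi>. 0 :: real"
  let ?N = "null_measure (borel :: 'a measure)"
  have mb: "mass_bound (?Z :: ('a, 'n) precurrent) ?N"
    by (auto simp: mass_bound_def intro!: finite_measureI)
  then have Z: "current (?Z :: ('a, 'n) precurrent)"
    by (auto simp: current_def multilinear_def seq_continuous_def is_local_def)
  have "emeasure (mass (?Z :: ('a, 'n) precurrent)) UNIV \<le> 1"
    using mass_le[OF Z mb, of UNIV] by simp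
  moreover have "extends (?Z :: ('a, 'n) precurrent) (\<lambda>_. 0)"
    by (auto simp: extends_def linear_zero intro!: mult_nonneg_nonneg prod_nonneg Bochner_Integration.integral_nonneg)
  ultimately show ?thesis using Z by blast
qed

lemma uminus_unit_functional: "L \<in> unit_functionals \<Longrightarrow> (\<lambda>v. - L v) \<in> unit_functionals"
proof -
  assume "L \<in> unit_functionals"
  then obtain T where T: "current T" "emeasure (mass T) UNIV \<le> 1" "extends T L" by auto
  note * = current_scale[OF T(1,3), of "-1"]
  have "emeasure (mass (\<lambda>f \<pi>. -1 * T f \<pi>)) UNIV \<le> 1"
    using *(3) T(2) unfolding emeasure_mass_le_1[OF *(1)] emeasure_mass_le_1[OF T(1)] by simp
  with *(1,2) show ?thesis by auto
qed

lemma unit_functional_form: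
  assumes "L \<in> unit_functionals"
  shows "\<bar>L (form f \<pi>)\<bar> \<le> (\<Prod>j\<in>UNIV. Lip (\<pi> j)) * norm f"
proof -
  obtain T where T: "current T" "emeasure (mass T) UNIV \<le> 1" "extends T L" using assms by auto
  have "(\<integral>x. \<bar>f x\<bar> \<partial>mass T) \<le> norm f * measure (mass T) UNIV"
    by (rule cb_integral_le[OF finite_mass[OF T(1)] sets_mass[OF T(1)]])
  also have "\<dots> \<le> norm f * 1"
    using T(2) unfolding emeasure_mass_le_1[OF T(1)] by (intro mult_left_mono) auto
  finally have "(\<Prod>j\<in>UNIV. Lip (\<pi> j)) * (\<integral>x. \<bar>f x\<bar> \<partial>mass T) \<le> (\<Prod>j\<in>UNIV. Lip (\<pi> j)) * norm f"
    by (intro mult_left_mono prod_nonneg) auto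
  then show ?thesis using T(3) unfolding extends_def by (meson order_trans)
qed

lemma unit_functionals_bounded:
  fixes v :: "('a::polish_space, 'n::finite) cform"
  shows "\<exists>K. \<forall>L\<in>unit_functionals. \<bar>L v\<bar> \<le> K"
proof -
  let ?P = "{v :: ('a, 'n) cform. \<exists>K. \<forall>L\<in>unit_functionals. \<bar>L v\<bar> \<le> K}"
  have "subspace ?P"
    unfolding subspace_def
  proof (intro conjI ballI allI)
    show "0 \<in> ?P" by (auto simp: linear_0 unit_functionals_linear intro!: exI[of _ 0] dest: linear_0[OF unit_functionals_linear])
    show "x + y \<in> ?P" if xy: "x \<in> ?P" "y \<in> ?P" for x y
    proof -
      obtain K where K: "\<And>L. L \<in> unit_functionals \<Longrightarrow> \<bar>L x\<bar> \<le> K" using xy(1) by blast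
      obtain M where M: "\<And>L. L \<in> unit_functionals \<Longrightarrow> \<bar>L y\<bar> \<le> M" using xy(2) by blast
      have "\<bar>L (x + y)\<bar> \<le> K + M" if "L \<in> unit_functionals" for L
        using K[OF that] M[OF that] linear_add[OF unit_functionals_linear[OF that], of x y] by linarith
      then show ?thesis by blast
    qed
    show "c *\<^sub>R x \<in> ?P" if x: "x \<in> ?P" for x c
    proof -
      obtain K where K: "\<And>L. L \<in> unit_functionals \<Longrightarrow> \<bar>L x\<bar> \<le> K" using x by blast
      have "\<bar>L (c *\<^sub>R x)\<bar> \<le> \<bar>c\<bar> * K" if "L \<in> unit_functionals" for L
        using mult_left_mono[OF K[OF that], of "\<bar>c\<bar>"] linear_scale[OF unit_functionals_linear[OF that], of c x]
        by (simp add: abs_mult)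
      then show ?thesis by blast
    qed
  qed
  moreover have "{form f \<pi> | f \<pi>. True} \<subseteq> ?P" using unit_functional_form by blast
  ultimately have "span {form f \<pi> | f \<pi>. True} \<subseteq> ?P" by (rule span_minimal[rotated])
  then show ?thesis using span_form by blast
qed

lemma current_seminorm_alt: "current_seminorm v = (SUP L\<in>unit_functionals. L v)"
  unfolding current_seminorm_def by (rule arg_cong[where f = Sup]) auto

lemma unit_functionals_bdd: "bdd_above ((\<lambda>L. L v) ` unit_functionals)"
proof -
  obtain K where K: "\<forall>L\<in>unit_functionals. \<bar>L v\<bar> \<le> K" using unit_functionals_bounded by blast
  show ?thesis by (rule bdd_aboveI[of _ K]) (use K in \<open>auto simp: abs_le_iff\<close>)
qed

lemma unit_functional_le: "L \<in> unit_functionals \<Longrightarrow> L v \<le> current_seminorm v"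
  unfolding current_seminorm_alt by (rule cSUP_upper[OF _ unit_functionals_bdd])

lemma current_seminorm_least: "(\<And>L. L \<in> unit_functionals \<Longrightarrow> L v \<le> K) \<Longrightarrow> current_seminorm v \<le> K"
  unfolding current_seminorm_alt by (rule cSUP_least) (use zero_unit_functional in blast)+

lemma unit_functional_abs_le: "L \<in> unit_functionals \<Longrightarrow> \<bar>L v\<bar> \<le> current_seminorm v"
  using unit_functional_le[of L v] unit_functional_le[OF uminus_unit_functional, of L v] by simp

lemma current_seminorm_nonneg: "0 \<le> current_seminorm v"
  using unit_functional_le[OF zero_unit_functional] by blast

lemma current_seminorm_triangle: "current_seminorm (v + w) \<le> current_seminorm v + current_seminorm w"
proof (rule current_seminorm_least)
  fix L :: "('a, 'b) cform \<Rightarrow> real" assume L: "L \<in> unit_functionals"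
  show "L (v + w) \<le> current_seminorm v + current_seminorm w"
    using unit_functional_le[OF L, of v] unit_functional_le[OF L, of w]
      linear_add[OF unit_functionals_linear[OF L], of v w] by linarith
qed

lemma current_seminorm_scale_le: "current_seminorm (c *\<^sub>R v) \<le> \<bar>c\<bar> * current_seminorm v"
proof (rule current_seminorm_least)
  fix L :: "('a, 'b) cform \<Rightarrow> real" assume L: "L \<in> unit_functionals"
  have "L (c *\<^sub>R v) \<le> \<bar>c\<bar> * \<bar>L v\<bar>"
    by (metis abs_ge_self abs_mult linear_scale[OF unit_functionals_linear[OF L]] real_scaleR_def)
  also have "\<dots> \<le> \<bar>c\<bar> * current_seminorm v"
    by (intro mult_left_mono unit_functional_abs_le L) simp
  finally show "L (c *\<^sub>R v) \<le> \<bar>c\<bar> * current_seminorm v" .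
qed

lemma current_seminorm_0: "current_seminorm (0 :: ('a::polish_space, 'n::finite) cform) = 0"
  using current_seminorm_scale_le[of 0 "0 :: ('a, 'n) cform"] current_seminorm_nonneg[of "0 :: ('a, 'n) cform"]
  by simp

lemma current_seminorm_scale: "current_seminorm (c *\<^sub>R v) = \<bar>c\<bar> * current_seminorm v"
proof (cases "c = 0")
  case False
  have "current_seminorm v \<le> \<bar>1 / c\<bar> * current_seminorm (c *\<^sub>R v)"
    using current_seminorm_scale_le[of "1/c" "c *\<^sub>R v"] False by simp
  then have "\<bar>c\<bar> * current_seminorm v \<le> current_seminorm (c *\<^sub>R v)"
    using False by (simp add: field_simps abs_divide)
  then show ?thesis using current_seminorm_scale_le[of c v] by linarith
qed (simp add: current_seminorm_0)

lemma current_seminorm_minus: "current_seminorm (- v) = current_seminorm v"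
  using current_seminorm_scale[of "-1" v] by simp

lemma current_seminorm_cong: "current_seminorm (v - w) = 0 \<Longrightarrow> current_seminorm v = current_seminorm w"
  using current_seminorm_triangle[of "v - w" w] current_seminorm_triangle[of "w - v" v]
    current_seminorm_minus[of "v - w"] by simp

lemma extends_le_mass:
  fixes T :: "('a::polish_space, 'n::finite) precurrent"
  assumes T: "current T" and L: "extends T L"
  shows "\<bar>L v\<bar> \<le> measure (mass T) UNIV * current_seminorm v"
proof (rule field_le_epsilon)
  fix e :: real assume e: "e > 0"
  define d where "d = e / (current_seminorm v + 1)"
  have d: "d > 0" using e current_seminorm_nonneg[of v] by (simp add: d_def add_nonneg_pos)
  define c where "c = measure (mass T) UNIV + d"
  have c: "c > 0" "measure (mass T) UNIV \<le> c" using d by (auto simp: c_def add_nonneg_pos)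
  note * = current_scale[OF T L, of "1 / c"]
  have "measure (mass (\<lambda>f \<pi>. 1 / c * T f \<pi>)) UNIV \<le> 1"
    using *(3) c by (simp add: divide_le_eq abs_of_pos) (metis divide_le_eq_1_pos order_trans)
  then have "(\<lambda>v. 1 / c * L v) \<in> unit_functionals"
    using *(1,2) emeasure_mass_le_1[OF *(1)] by blast
  then have "\<bar>1 / c * L v\<bar> \<le> current_seminorm v" by (rule unit_functional_abs_le)
  then have "\<bar>L v\<bar> \<le> c * current_seminorm v" using c(1) by (simp add: abs_mult abs_divide divide_le_eq mult.commute)
  also have "\<dots> = measure (mass T) UNIV * current_seminorm v + d * current_seminorm v"
    by (simp add: c_def distrib_right)
  also have "d * current_seminorm v \<le> e"
  proof -
    have "0 < current_seminorm v + 1" using current_seminorm_nonneg[of v] by simp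
    then show ?thesis
      using e unfolding d_def by (simp only: times_divide_eq_left pos_divide_le_eq) (simp add: algebra_simps)
  qed
  finally show "\<bar>L v\<bar> \<le> measure (mass T) UNIV * current_seminorm v + e" by simp
qed

lemma current_seminorm_disjoint:
  fixes v :: "'i \<Rightarrow> ('a::polish_space, 'n::finite) cform" and f :: "'i \<Rightarrow> 'a \<Rightarrow>\<^sub>C real"
  assumes fin: "finite I" and supp: "\<And>i j x. i \<in> I \<Longrightarrow> j \<in> I \<Longrightarrow> i \<noteq> j \<Longrightarrow> f i x = 0 \<or> f j x = 0"
    and F: "\<And>i. i \<in> I \<Longrightarrow> norm (f i) \<le> F" "0 \<le> F"
    and V: "\<And>i. i \<in> I \<Longrightarrow> current_seminorm (v i) \<le> V" "0 \<le> V"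
  shows "current_seminorm (\<Sum>i\<in>I. cform_mult (f i) (v i)) \<le> F * V"
proof (rule current_seminorm_least)
  fix L :: "('a, 'n) cform \<Rightarrow> real" assume "L \<in> unit_functionals"
  then obtain T where T: "current T" "emeasure (mass T) UNIV \<le> 1" and L: "extends T L" by auto
  note fm = finite_mass[OF T(1)] and sm = sets_mass[OF T(1)]
  interpret finite_measure "mass T" by (rule fm)
  have lin: "linear L" using L by (simp add: extends_def)
  have int: "integrable (mass T) (\<lambda>x. \<bar>f i x\<bar>)" for i using cb_integrable[OF fm sm] by blast
  have "L (\<Sum>i\<in>I. cform_mult (f i) (v i)) = (\<Sum>i\<in>I. L (cform_mult (f i) (v i)))"
    by (rule linear_sum[OF lin])
  also have "\<dots> \<le> (\<Sum>i\<in>I. (\<integral>x. \<bar>f i x\<bar> \<partial>mass T) * V)"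
  proof (rule sum_mono)
    fix i assume i: "i \<in> I"
    note * = current_restrict[OF T(1) L, of "f i"]
    have "L (cform_mult (f i) (v i)) \<le> measure (mass (\<lambda>g \<pi>. L (form (f i \<odot> g) \<pi>))) UNIV * current_seminorm (v i)"
      using extends_le_mass[OF *(1,2), of "v i"] by simp
    also have "\<dots> \<le> (\<integral>x. \<bar>f i x\<bar> \<partial>mass T) * V"
      using *(3) V i by (intro mult_mono) (auto intro: current_seminorm_nonneg)
    finally show "L (cform_mult (f i) (v i)) \<le> (\<integral>x. \<bar>f i x\<bar> \<partial>mass T) * V" .
  qed
  also have "\<dots> = (\<integral>x. (\<Sum>i\<in>I. \<bar>f i x\<bar>) \<partial>mass T) * V"
    using int by (simp add: Bochner_Integration.integral_sum sum_distrib_right)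
  also have "\<dots> \<le> (\<integral>x. F \<partial>mass T) * V"
  proof (intro mult_right_mono integral_mono V integrable_const Bochner_Integration.integrable_sum int)
    fix x
    show "(\<Sum>i\<in>I. \<bar>f i x\<bar>) \<le> F"
    proof (cases "\<exists>i\<in>I. f i x \<noteq> 0")
      case True
      then obtain i where i: "i \<in> I" "f i x \<noteq> 0" by blast
      have "(\<Sum>j\<in>I. \<bar>f j x\<bar>) = \<bar>f i x\<bar>"
        using supp[of i _ x] i(2) by (subst sum.remove[OF fin i(1)]) (auto intro!: sum.neutral dest: supp[OF i(1), of _ x])
      then show ?thesis using abs_bcontfun_le[of "f i" x] F(1)[OF i(1)] by simp
    next
      case False
      then show ?thesis using F(2) by simp
    qed
  qed
  also have "\<dots> \<le> F * V"
    using T(2) F(2) V(2) unfolding emeasure_mass_le_1[OF T(1)]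
    by (simp add: space_mass[OF T(1)] mult_right_mono mult_left_le_one_le)
  finally show "L (\<Sum>i\<in>I. cform_mult (f i) (v i)) \<le> F * V" .
qed

lemma current_seminorm_mult: "current_seminorm (cform_mult f v) \<le> norm f * current_seminorm v"
  using current_seminorm_disjoint[of "{()}" "\<lambda>_. f" "norm f" "\<lambda>_. v" "current_seminorm v"]
  by (simp add: current_seminorm_nonneg)

section \<open>The space of forms\<close>

text \<open>The space \<open>\<D>\<^sup>n(X)\<close> is the type \<open>('a, 'n) dform\<close>, with the quotient norm and module structure.\<close>

definition seminorm_rel :: "('a::polish_space, 'n::finite) cform \<Rightarrow> ('a, 'n) cform \<Rightarrow> bool" where
  "seminorm_rel v w \<longleftrightarrow> current_seminorm (v - w) = 0"

lemma seminorm_rel_iff: "seminorm_rel v w \<longleftrightarrow> current_seminorm (v - w) \<le> 0"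
  using current_seminorm_nonneg[of "v - w"] by (auto simp: seminorm_rel_def)

lemma equivp_seminorm_rel: "equivp seminorm_rel"
proof (rule equivpI, goal_cases)
  case 1
  show ?case by (rule reflpI) (simp add: seminorm_rel_def current_seminorm_0)
next
  case 2
  show ?case by (rule sympI) (metis seminorm_rel_def current_seminorm_minus minus_diff_eq)
next
  case 3
  show ?case
  proof (rule transpI)
    fix x y z :: "('a, 'b) cform"
    assume "seminorm_rel x y" "seminorm_rel y z"
    then show "seminorm_rel x z"
      using current_seminorm_triangle[of "x - y" "y - z"] unfolding seminorm_rel_iff by simp
  qed
qed

quotient_type (overloaded) ('a, 'n) dform = "('a::polish_space, 'n::finite) cform" / seminorm_rel
  by (rule equivp_seminorm_rel)

instantiation dform :: (polish_space, finite) real_vector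
begin

lift_definition zero_dform :: "('a, 'b) dform" is 0 .

lift_definition plus_dform :: "('a, 'b) dform \<Rightarrow> ('a, 'b) dform \<Rightarrow> ('a, 'b) dform" is "(+)"
  subgoal for x y z w
    using current_seminorm_triangle[of "x - y" "z - w"] unfolding seminorm_rel_iff
    by (simp add: add_diff_add)
  done

lift_definition uminus_dform :: "('a, 'b) dform \<Rightarrow> ('a, 'b) dform" is uminus
  subgoal for x y
    using current_seminorm_minus[of "x - y"] unfolding seminorm_rel_def by simp
  done

lift_definition minus_dform :: "('a, 'b) dform \<Rightarrow> ('a, 'b) dform \<Rightarrow> ('a, 'b) dform" is "(-)"
  subgoal for x y z w
  proof -
    assume a: "seminorm_rel x y" "seminorm_rel z w"
    have eq: "(x - y) + - (z - w) = x - z - (y - w)" by (simp add: algebra_simps)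
    show ?thesis
      using a current_seminorm_triangle[of "x - y" "- (z - w)"] current_seminorm_minus[of "z - w"]
      unfolding seminorm_rel_iff eq by linarith
  qed
  done

lift_definition scaleR_dform :: "real \<Rightarrow> ('a, 'b) dform \<Rightarrow> ('a, 'b) dform" is scaleR
  subgoal for c x y
    using current_seminorm_scale[of c "x - y"] unfolding seminorm_rel_def
    by (simp add: scaleR_diff_right)
  done

instance
proof
  fix u v w :: "('a, 'b) dform" and a b :: real
  show "u + v + w = u + (v + w)" "u + v = v + u" "0 + u = u" "- u + u = 0" "u - v = u + - v"
    by (transfer; simp add: seminorm_rel_def current_seminorm_0 add_ac)+
  show "a *\<^sub>R (u + v) = a *\<^sub>R u + a *\<^sub>R v" "(a + b) *\<^sub>R u = a *\<^sub>R u + b *\<^sub>R u"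
    "a *\<^sub>R b *\<^sub>R u = (a * b) *\<^sub>R u" "1 *\<^sub>R u = u"
    by (transfer; simp add: seminorm_rel_def current_seminorm_0 scaleR_add_left scaleR_add_right)+
qed

end

instantiation dform :: (polish_space, finite) real_normed_vector
begin

lift_definition norm_dform :: "('a, 'b) dform \<Rightarrow> real" is current_seminorm
  unfolding seminorm_rel_def by (rule current_seminorm_cong)

definition dist_dform :: "('a, 'b) dform \<Rightarrow> ('a, 'b) dform \<Rightarrow> real" where
  "dist_dform v w = norm (v - w)"

definition sgn_dform :: "('a, 'b) dform \<Rightarrow> ('a, 'b) dform" where
  "sgn_dform v = v /\<^sub>R norm v"

definition uniformity_dform :: "(('a, 'b) dform \<times> ('a, 'b) dform) filter" where
  "uniformity_dform = (INF e\<in>{0 <..}. principal {(x, y). dist x y < e})"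

definition open_dform :: "('a, 'b) dform set \<Rightarrow> bool" where
  "open_dform S = (\<forall>x\<in>S. \<forall>\<^sub>F (x', y) in uniformity. x' = x \<longrightarrow> y \<in> S)"

instance
proof
  fix u v :: "('a, 'b) dform" and a :: real
  show "norm u = 0 \<longleftrightarrow> u = 0" by transfer (simp add: seminorm_rel_def)
  show "norm (u + v) \<le> norm u + norm v" by transfer (rule current_seminorm_triangle)
  show "norm (a *\<^sub>R u) = \<bar>a\<bar> * norm u" by transfer (rule current_seminorm_scale)
qed (rule dist_dform_def sgn_dform_def uniformity_dform_def open_dform_def)+

end

lift_definition dform_mult :: "('a::polish_space \<Rightarrow>\<^sub>C real) \<Rightarrow> ('a, 'n::finite) dform \<Rightarrow> ('a, 'n) dform"
  is cform_mult
  subgoal for f v w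
  proof -
    assume a: "seminorm_rel v w"
    have "current_seminorm (cform_mult f (v - w)) \<le> norm f * current_seminorm (v - w)"
      by (rule current_seminorm_mult)
    then show ?thesis
      using a unfolding seminorm_rel_iff
      by (simp add: linear_diff[OF linear_cform_mult] mult_nonneg_nonpos order_trans)
  qed
  done

text \<open>The class of \<open>f d\<pi>\<^sub>1 \<and> \<dots> \<and> d\<pi>\<^sub>n\<close> in \<open>\<D>\<^sup>n(X)\<close>.\<close>

definition elementary_form :: "('a::polish_space \<Rightarrow>\<^sub>C real) \<Rightarrow> ('n::finite \<Rightarrow> 'a lip) \<Rightarrow> ('a, 'n) dform" where
  "elementary_form f \<pi> = abs_dform (form f \<pi>)"

text \<open>\<open>F\<close> is the current \<open>T\<close> seen as an element of the dual \<open>\<D>\<^sup>n(X)'\<close>.\<close>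

definition induces :: "('a::polish_space, 'n::finite) precurrent \<Rightarrow> (('a, 'n) dform \<Rightarrow>\<^sub>L real) \<Rightarrow> bool" where
  "induces T F \<longleftrightarrow> extends T (\<lambda>v. F (abs_dform v))"

text \<open>The map \<open>(f, \<pi>\<^sub>1, \<dots>, \<pi>\<^sub>n) \<mapsto> F(f d\<pi>\<^sub>1 \<and> \<dots> \<and> d\<pi>\<^sub>n)\<close> identified with \<open>F\<close>.\<close>

definition current_map :: "(('a::polish_space, 'n::finite) dform \<Rightarrow>\<^sub>L real) \<Rightarrow> ('a, 'n) precurrent" where
  "current_map F f \<pi> = F (elementary_form f \<pi>)"

section \<open>Local vector measures\<close>

locale normed_cb_module =
  fixes smult :: "('a::topological_space \<Rightarrow>\<^sub>C real) \<Rightarrow> 'v::real_normed_vector \<Rightarrow> 'v"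
  assumes smult_add_right: "smult f (v + w) = smult f v + smult f w"
    and smult_add_left: "smult (f + g) v = smult f v + smult g v"
    and smult_smult: "smult f (smult g v) = smult (f \<odot> g) v"
    and smult_const: "smult (const_bcontfun c) v = c *\<^sub>R v"
    and norm_sum_smult_le:
      "finite (I :: nat set) \<Longrightarrow> I \<noteq> {} \<Longrightarrow>
        (\<And>i j. i \<in> I \<Longrightarrow> j \<in> I \<Longrightarrow> i \<noteq> j \<Longrightarrow> cb_supp (fs i) \<inter> cb_supp (fs j) = {}) \<Longrightarrow>
        norm (\<Sum>i\<in>I. smult (fs i) (vs i)) \<le> (MAX i\<in>I. norm (fs i)) * (MAX i\<in>I. norm (vs i))"
begin

definition local_norm :: "'a set \<Rightarrow> 'v \<Rightarrow> real" where
  "local_norm A v = Sup {norm (smult f v) | f. cb_supp f \<subseteq> A \<and> norm f \<le> 1}"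

text \<open>
  \<open>supp v \<subseteq> B\<close>.  For closed \<open>B\<close> this is the same as \<open>local_norm (- B) v = 0\<close>, as \<^const>\<open>local_norm\<close> is
  monotone in the set.
\<close>

definition supp_in :: "'v \<Rightarrow> 'a set \<Rightarrow> bool" where
  "supp_in v B \<longleftrightarrow> (\<exists>C\<subseteq>B. closed C \<and> local_norm (- C) v = 0)"

text \<open>Only the values on Borel sets matter.\<close>

definition local_vector_measure :: "('a set \<Rightarrow> 'v \<Rightarrow>\<^sub>L real) \<Rightarrow> bool" where
  "local_vector_measure N \<longleftrightarrow>
     (\<forall>A :: nat \<Rightarrow> 'a set. range A \<subseteq> sets borel \<and> disjoint_family A \<longrightarrow> (\<lambda>i. N (A i)) sums N (\<Union>i. A i)) \<and>
     (\<forall>A v. open A \<and> local_norm A v = 0 \<longrightarrow> N A v = 0)"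

definition tight :: "('v \<Rightarrow>\<^sub>L real) \<Rightarrow> bool" where
  "tight F \<longleftrightarrow>
     (\<forall>v. \<forall>\<phi> :: nat \<Rightarrow> 'a \<Rightarrow>\<^sub>C real. (\<forall>x. decseq (\<lambda>n. apply_bcontfun (\<phi> n) x) \<and> (\<lambda>n. apply_bcontfun (\<phi> n) x) \<longlonglongrightarrow> 0)
        \<longrightarrow> (\<lambda>n. F (smult (\<phi> n) v)) \<longlonglongrightarrow> 0)"

end

definition total_variation :: "('a::topological_space set \<Rightarrow> 'v::real_normed_vector \<Rightarrow>\<^sub>L real) \<Rightarrow> 'a set \<Rightarrow> ennreal" where
  "total_variation N E =
     (SUP P\<in>{P. finite P \<and> P \<subseteq> sets borel \<and> partition_on E P}. \<Sum>A\<in>P. ennreal (norm (N A)))"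

lemma linear_abs_dform: "linear abs_dform"
  by (rule linearI) (simp_all add: plus_dform.abs_eq scaleR_dform.abs_eq)

interpretation D: normed_cb_module "dform_mult :: ('a::polish_space \<Rightarrow>\<^sub>C real) \<Rightarrow> ('a, 'n::finite) dform \<Rightarrow> _"
proof
  have form_scale: "form (c *\<^sub>R f) \<pi> = c *\<^sub>R form f \<pi>" for c and f :: "'a \<Rightarrow>\<^sub>C real" and \<pi> :: "'n \<Rightarrow> 'a lip"
    using form_linear1[of c f 0 f \<pi>] by simp
  have form_add: "form (f + g) \<pi> = form f \<pi> + form g \<pi>" for f g :: "'a \<Rightarrow>\<^sub>C real" and \<pi> :: "'n \<Rightarrow> 'a lip"
    using form_linear1[of 1 f 1 g \<pi>] by simp
  fix f g :: "'a \<Rightarrow>\<^sub>C real" and v w :: "('a, 'n) dform" and c :: real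
  show "dform_mult f (v + w) = dform_mult f v + dform_mult f w"
    by transfer (simp add: linear_add[OF linear_cform_mult] seminorm_rel_def current_seminorm_0)
  have "cform_mult (f + g) = (\<lambda>v :: ('a, 'n) cform. cform_mult f v + cform_mult g v)"
  proof (rule linear_cform_eqI)
    have "(f + g) \<odot> h = f \<odot> h + g \<odot> h" for h by (rule bcontfun_eqI) (simp add: algebra_simps)
    then show "cform_mult (f + g) (form h \<pi>) = cform_mult f (form h \<pi>) + cform_mult g (form h \<pi>)"
      for h and \<pi> :: "'n \<Rightarrow> 'a lip" by (simp add: form_add)
  qed (intro linear_cform_mult linear_compose_add)+
  then show "dform_mult (f + g) v = dform_mult f v + dform_mult g v"
    by transfer (simp add: seminorm_rel_def current_seminorm_0)
  have "cform_mult (f \<odot> g) = (\<lambda>v :: ('a, 'n) cform. cform_mult f (cform_mult g v))"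
  proof (rule linear_cform_eqI)
    have "(f \<odot> g) \<odot> h = f \<odot> (g \<odot> h)" for h by (rule bcontfun_eqI) (simp add: mult.assoc)
    then show "cform_mult (f \<odot> g) (form h \<pi>) = cform_mult f (cform_mult g (form h \<pi>))"
      for h and \<pi> :: "'n \<Rightarrow> 'a lip" by simp
    show "linear (\<lambda>v :: ('a, 'n) cform. cform_mult f (cform_mult g v))"
      using linear_compose[OF linear_cform_mult linear_cform_mult] by (simp add: o_def)
  qed (rule linear_cform_mult)
  then show "dform_mult f (dform_mult g v) = dform_mult (f \<odot> g) v"
    by transfer (simp add: seminorm_rel_def current_seminorm_0)
  have "cform_mult (const_bcontfun c) = (\<lambda>v :: ('a, 'n) cform. c *\<^sub>R v)"
  proof (rule linear_cform_eqI)
    have "const_bcontfun c \<odot> h = c *\<^sub>R h" for h :: "'a \<Rightarrow>\<^sub>C real" by (rule bcontfun_eqI) simp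
    then show "cform_mult (const_bcontfun c) (form h \<pi>) = c *\<^sub>R form h \<pi>"
      for h :: "'a \<Rightarrow>\<^sub>C real" and \<pi> :: "'n \<Rightarrow> 'a lip" by (simp add: form_scale)
  qed (auto simp: linear_cform_mult linear_scale_self)
  then show "dform_mult (const_bcontfun c) v = c *\<^sub>R v"
    by transfer (simp add: seminorm_rel_def current_seminorm_0)
  fix I :: "nat set" and fs :: "nat \<Rightarrow> 'a \<Rightarrow>\<^sub>C real" and vs :: "nat \<Rightarrow> ('a, 'n) dform"
  assume I: "finite I" "I \<noteq> {}"
    and disj: "\<And>i j. i \<in> I \<Longrightarrow> j \<in> I \<Longrightarrow> i \<noteq> j \<Longrightarrow> cb_supp (fs i) \<inter> cb_supp (fs j) = {}"
  let ?F = "MAX i\<in>I. norm (fs i)" and ?V = "MAX i\<in>I. norm (vs i)"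
  have "\<forall>i. \<exists>w. vs i = abs_dform w" by (metis Quotient_dform Quotient_abs_rep)
  then obtain w where w: "\<And>i. vs i = abs_dform (w i)" by metis
  have nw: "norm (vs i) = current_seminorm (w i)" for i by (simp add: w norm_dform.abs_eq)
  have "current_seminorm (\<Sum>i\<in>I. cform_mult (fs i) (w i)) \<le> ?F * ?V"
  proof (rule current_seminorm_disjoint[OF I(1)])
    fix i j x assume "i \<in> I" "j \<in> I" "i \<noteq> j"
    then have "cb_supp (fs i) \<inter> cb_supp (fs j) = {}" by (rule disj)
    moreover have "{x. fs i x \<noteq> 0} \<subseteq> cb_supp (fs i)" for i
      unfolding cb_supp_def by (rule closure_subset)
    ultimately show "fs i x = 0 \<or> fs j x = 0" by blast
  next
    obtain i where i: "i \<in> I" using I by blast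
    show "norm (fs i) \<le> ?F" if "i \<in> I" for i using I that by simp
    then show "0 \<le> ?F" using i norm_ge_zero order_trans by blast
    have V: "norm (vs i) \<le> ?V" if "i \<in> I" for i using I that by simp
    then show "0 \<le> ?V" using i norm_ge_zero order_trans by blast
    show "current_seminorm (w i) \<le> ?V" if "i \<in> I" for i using V[OF that] by (simp add: nw)
  qed
  also have "current_seminorm (\<Sum>i\<in>I. cform_mult (fs i) (w i)) = norm (\<Sum>i\<in>I. dform_mult (fs i) (vs i))"
    by (simp add: w dform_mult.abs_eq norm_dform.abs_eq flip: linear_sum[OF linear_abs_dform])
  finally show "norm (\<Sum>i\<in>I. dform_mult (fs i) (vs i)) \<le> ?F * ?V" .
qed

end

theory Submission
  imports Defs
begin

text \<open>
  Currents are alternating: \<open>\<pi>\<close> is the limit of \<open>\<epsilon> \<phi>(\<pi>/\<epsilon>)\<close> and of \<open>\<epsilon> \<psi>(\<pi>/\<epsilon>)\<close>, where \<open>\<phi>\<close> and \<open>\<psi>\<close> are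
  staircases with disjoint sets of increase, so that locality makes \<open>T(f, \<phi>(\<pi>/\<epsilon>), \<psi>(\<pi>/\<epsilon>), \<dots>)\<close> vanish.
  Hence \<open>T\<close> extends to a functional \<open>F\<close> on \<open>\<D>\<^sup>n(X)\<close>, and \<open>\<bar>F(g v)\<bar> \<le> \<parallel>v\<parallel> \<integral>\<bar>g\<bar> d\<parallel>T\<parallel>\<close>; this gives
  tightness and, as \<open>C\<^sub>b(X)\<close> is dense in \<open>L\<^sup>1(\<parallel>T\<parallel>)\<close>, the measure \<open>N(A) = F(1\<^sub>A \<cdot>)\<close> with \<open>\<parallel>N(A)\<parallel> \<le> \<parallel>T\<parallel>(A)\<close>.

  For an arbitrary tight \<open>F\<close>, the dual norms of \<open>F\<close> on the forms supported in an open set \<open>U\<close> define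
  an outer measure by \<open>U \<mapsto> \<parallel>F\<parallel>\<^sub>U\<close>. It is countably subadditive by tightness, open sets are measurable
  for it by the module inequality for disjoint supports, and the resulting Borel measure bounds \<open>F\<close>
  by a layer cake decomposition. So \<open>F\<close> has finite mass, at most \<open>\<parallel>F\<parallel>\<close>. For a current this gives
  \<open>\<parallel>T\<parallel>(X) \<le> \<parallel>F\<parallel> \<le> \<parallel>N(B)\<parallel> + \<parallel>N(- B)\<parallel> \<le> \<parallel>T\<parallel>(X)\<close>, hence even \<open>\<parallel>N(B)\<parallel> = \<parallel>T\<parallel>(B)\<close> for every Borel set.

  A local vector measure satisfies \<open>N(E)(\<phi>\<^sub>n v) \<rightarrow> 0\<close> whenever \<open>\<phi>\<^sub>n\<close> decreases to \<open>0\<close> on \<open>E\<close>. This yields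
  both the tightness of \<open>N(X)\<close> and uniqueness.
\<close>

section \<open>Currents are alternating\<close>

lemma apply_lip_Abs: "L-lipschitz_on UNIV f \<Longrightarrow> apply_lip (Abs_lip f) = f"
  by (rule Abs_lip_inverse) blast

lemma apply_Bcontfun_bounded:
  fixes g :: "'a::topological_space \<Rightarrow> real"
  assumes "continuous_on UNIV g" "\<And>x. \<bar>g x\<bar> \<le> B"
  shows "apply_bcontfun (Bcontfun g) = g"
  by (rule Bcontfun_inverse, rule bcontfun_normI) (use assms in auto)

lemma multilinear_diff1:
  "multilinear T \<Longrightarrow> f \<in> LIPb \<Longrightarrow> g \<in> LIPb \<Longrightarrow> T (f - g) \<pi> = T f \<pi> - T g \<pi>"
proof -
  assume "multilinear T" "f \<in> LIPb" "g \<in> LIPb"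
  then have "T (1 *\<^sub>R f + (-1) *\<^sub>R g) \<pi> = 1 * T f \<pi> + (-1) * T g \<pi>"
    unfolding multilinear_def by blast
  then show ?thesis by simp
qed

lemma multilinear_diff2:
  "multilinear T \<Longrightarrow> f \<in> LIPb \<Longrightarrow> T f (\<pi>(j := \<alpha> - \<beta>)) = T f (\<pi>(j := \<alpha>)) - T f (\<pi>(j := \<beta>))"
proof -
  assume "multilinear T" "f \<in> LIPb"
  then have "T f (\<pi>(j := 1 *\<^sub>R \<alpha> + (-1) *\<^sub>R \<beta>)) = 1 * T f (\<pi>(j := \<alpha>)) + (-1) * T f (\<pi>(j := \<beta>))"
    unfolding multilinear_def by blast
  then show ?thesis by simp
qed

lemma multilinear_scale2:
  "multilinear T \<Longrightarrow> f \<in> LIPb \<Longrightarrow> T f (\<pi>(j := c *\<^sub>R \<alpha>)) = c * T f (\<pi>(j := \<alpha>))"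
proof -
  assume "multilinear T" "f \<in> LIPb"
  then have "T f (\<pi>(j := c *\<^sub>R \<alpha> + 0 *\<^sub>R \<alpha>)) = c * T f (\<pi>(j := \<alpha>)) + 0 * T f (\<pi>(j := \<alpha>))"
    unfolding multilinear_def by blast
  then show ?thesis by simp
qed

text \<open>The localized pieces of \<open>f\<close> below are differences, and
  \<open>multilinear\<close> and \<open>is_local\<close> speak only of first arguments in
  \<open>LIPb\<close>.\<close>

lemma LIPb_diff: "f \<in> LIPb \<Longrightarrow> g \<in> LIPb \<Longrightarrow> f - g \<in> LIPb"
  using LIPb_add[OF _ LIPb_scaleR[of g "-1"], of f] by simp

text \<open>
  \<open>\<pi> j - c\<close> is approximated by its soft thresholds, which vanish on neighbourhoods of \<open>{\<pi> j = c}\<close>.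
\<close>

lemma current_strong_local:
  fixes T :: "('a::metric_space, 'n::finite) precurrent"
  assumes T: "current T" and f: "f \<in> LIPb" and c: "\<And>x. apply_bcontfun f x \<noteq> 0 \<Longrightarrow> apply_lip (\<pi> j) x = c"
  shows "T f \<pi> = 0"
proof -
  have ml: "multilinear T" and sc: "seq_continuous T" and loc: "is_local T"
    using T by (auto simp: current_def)
  define \<alpha> where "\<alpha> = \<pi> j - Abs_lip (\<lambda>_. c)"
  have cc: "apply_lip (Abs_lip (\<lambda>_. c)) = (\<lambda>_ :: 'a. c)"
    by (rule apply_lip_Abs[of 0]) (rule lipschitz_on_constant)
  have \<alpha>: "apply_lip \<alpha> x = \<pi> j x - c" for x
    by (simp add: \<alpha>_def minus_lip.rep_eq cc)
  obtain L where L: "L-lipschitz_on UNIV (apply_lip \<alpha>)" using apply_lip[of \<alpha>] by blast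
  \<comment> \<open>Subtracting from t its truncation to [-1/(k+1), 1/(k+1)] gives a 1-Lipschitz map
    that is zero near 0 and stays within 1/(k+1) of the identity.\<close>
  define s where "s k t = t - max (- (1 / real (Suc k))) (min (1 / real (Suc k)) t)" for k t
  have s_lip: "\<bar>s k t - s k u\<bar> \<le> \<bar>t - u\<bar>" for k t u
    unfolding s_def using zero_less_divide_1_iff[of "real (Suc k)"] by linarith
  have s_close: "\<bar>s k t - t\<bar> \<le> 1 / real (Suc k)" for k t
    unfolding s_def using zero_less_divide_1_iff[of "real (Suc k)"] by linarith
  have s0: "s k t = 0" if "\<bar>t\<bar> < 1 / real (Suc k)" for k t
    using that unfolding s_def by linarith
  have sL: "L-lipschitz_on UNIV (\<lambda>x. s k (\<alpha> x))" for k
    using order_trans[OF s_lip lipschitz_onD[OF L, unfolded dist_real_def]] lipschitz_on_nonneg[OF L]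
    by (intro lipschitz_onI) (auto simp: dist_real_def)
  define A where "A k = Abs_lip (\<lambda>x. s k (\<alpha> x))" for k
  have A: "apply_lip (A k) x = s k (\<alpha> x)" for k x
    using apply_lip_Abs[OF sL] by (simp add: A_def)
  have zero: "T f (\<pi>(j := A k)) = 0" for k
  proof -
    let ?U = "{x. \<bar>\<alpha> x\<bar> < 1 / real (Suc k)}"
    have "open ?U"
      using lipschitz_on_continuous_on[OF L] by (intro open_Collect_less continuous_intros) auto
    moreover have "{x. f x \<noteq> 0} \<subseteq> ?U" using c by (auto simp: \<alpha>)
    moreover have "\<forall>x\<in>?U. apply_lip ((\<pi>(j := A k)) j) x = 0" by (auto simp: A s0)
    ultimately show ?thesis using loc f unfolding is_local_def by blast
  qed
  have "(\<lambda>k. T f (\<pi>(j := A k))) \<longlonglongrightarrow> T f (\<pi>(j := \<alpha>))"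
  proof (rule sc[unfolded seq_continuous_def, rule_format, OF f], intro conjI allI)
    show "\<exists>L. \<forall>i. L-lipschitz_on UNIV (apply_lip ((\<pi>(j := A i)) k))" for k
    proof (cases "k = j")
      case True
      then show ?thesis using sL by (auto simp: A[abs_def])
    next
      case False
      then show ?thesis using apply_lip[of "\<pi> k"] by auto
    qed
    have "(\<lambda>i. s i t) \<longlonglongrightarrow> t" for t
    proof -
      have "(\<lambda>i. s i t - t) \<longlonglongrightarrow> 0"
        by (rule Lim_null_comparison[OF _ lim_1_over_n[THEN LIMSEQ_Suc]]) (use s_close in auto)
      then show ?thesis by (simp add: LIM_zero_iff)
    qed
    then show "(\<lambda>i. apply_lip ((\<pi>(j := A i)) k) x) \<longlonglongrightarrow> apply_lip ((\<pi>(j := \<alpha>)) k) x" for k x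
      by (auto simp: A)
  qed
  then have "T f (\<pi>(j := \<alpha>)) = 0" by (simp add: zero LIMSEQ_const_iff)
  \<comment> \<open>Linearity in slot \<open>j\<close> returns from \<open>\<pi> j - c\<close> to
    \<open>\<pi> j\<close>; the constant entry contributes 0 by locality on the whole space.\<close>
  moreover have "T f (\<pi>(j := \<alpha>)) = T f \<pi> - T f (\<pi>(j := Abs_lip (\<lambda>_. c)))"
    unfolding \<alpha>_def by (simp add: multilinear_diff2[OF ml f])
  moreover have "T f (\<pi>(j := Abs_lip (\<lambda>_. c))) = 0"
  proof -
    have "\<forall>x\<in>UNIV. apply_lip ((\<pi>(j := Abs_lip (\<lambda>_. c))) j) x = c" by (simp add: cc)
    then show ?thesis using loc f unfolding is_local_def by (meson open_UNIV subset_UNIV)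
  qed
  ultimately show ?thesis by simp
qed

section \<open>Staircases with disjoint sets of increase\<close>

text \<open>For 0 \<le> a \<le> 3/4 this rises from m to m+1 with slope 4 on [m+a, m+a+1/4] and is
  flat in between. The values a = 0 and a = 1/2 give rises on disjoint intervals.\<close>

definition stair :: "real \<Rightarrow> real \<Rightarrow> real" where
  "stair a t = of_int \<lfloor>t\<rfloor> + max 0 (min 1 (4 * (t - of_int \<lfloor>t\<rfloor> - a)))"

lemma stair_increment:
  assumes "0 \<le> a" "a \<le> 3/4" "s \<le> t"
  shows "stair a s \<le> stair a t" "stair a t - stair a s \<le> 4 * (t - s)"
proof -
  have 1: "of_int \<lfloor>s\<rfloor> \<le> s" "s < of_int \<lfloor>s\<rfloor> + 1" "of_int \<lfloor>t\<rfloor> \<le> t" "t < of_int \<lfloor>t\<rfloor> + 1" by linarith+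
  define c where "c y = max 0 (min 1 (4 * (y - a)))" for y
  have st: "stair a y = of_int \<lfloor>y\<rfloor> + c (y - of_int \<lfloor>y\<rfloor>)" for y by (simp add: stair_def c_def)
  have c: "c y \<le> c z" "c z - c y \<le> 4 * (z - y)" if "y \<le> z" for y z
    using that by (auto simp: c_def max_def min_def)
  have c_bounds: "0 \<le> c y" "c y \<le> 1" for y by (auto simp: c_def)
  have c_low: "4 * y - 3 \<le> c y" if "y \<le> 1" for y using that assms by (auto simp: c_def max_def min_def)
  have c_upp: "c y \<le> 4 * y" if "0 \<le> y" for y using that assms by (auto simp: c_def max_def min_def)
  let ?s = "s - of_int \<lfloor>s\<rfloor>" and ?t = "t - of_int \<lfloor>t\<rfloor>"
  have low: "4 * ?s - 3 \<le> c ?s" and upp: "c ?t \<le> 4 * ?t" using c_low[of ?s] c_upp[of ?t] 1 by auto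
  have "stair a s \<le> stair a t \<and> stair a t - stair a s \<le> 4 * (t - s)"
  proof (cases "\<lfloor>s\<rfloor> = \<lfloor>t\<rfloor>")
    case True
    then show ?thesis unfolding st using c[of ?s ?t] assms(3) by (simp add: algebra_simps)
  next
    case False
    then have "of_int \<lfloor>s\<rfloor> + 1 \<le> (of_int \<lfloor>t\<rfloor> :: real)" using floor_mono[OF assms(3)] by linarith
    then show ?thesis
      unfolding st using 1 low upp c_bounds[of ?s] c_bounds[of ?t] by (simp add: algebra_simps)
  qed
  then show "stair a s \<le> stair a t" "stair a t - stair a s \<le> 4 * (t - s)" by auto
qed

lemma stair_lipschitz: "0 \<le> a \<Longrightarrow> a \<le> 3/4 \<Longrightarrow> 4-lipschitz_on UNIV (stair a)"
proof (rule lipschitz_onI)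
  fix s t :: real assume "0 \<le> a" "a \<le> 3/4"
  then show "dist (stair a s) (stair a t) \<le> 4 * dist s t"
    using stair_increment[of a s t] stair_increment[of a t s] by (cases "s \<le> t") (auto simp: dist_real_def)
qed simp

lemma stair_close: "0 \<le> a \<Longrightarrow> \<bar>stair a t - t\<bar> \<le> 1"
  unfolding stair_def by linarith

text \<open>The flat stretch [m+1/4, m+1) here and the flat stretch [m+3/4, m+3/2) in
  \<open>stair_half\<close> alternate and cover the line with overlaps of length 1/4, which leaves
  room for a Lipschitz partition of unity.\<close>

lemma stair_0: "of_int m + 1/4 \<le> t \<Longrightarrow> t < of_int m + 1 \<Longrightarrow> stair 0 t = of_int m + 1"
proof -
  assume *: "of_int m + 1/4 \<le> t" "t < of_int m + 1"
  then have "\<lfloor>t\<rfloor> = m" by (intro floor_unique) auto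
  with * show ?thesis by (simp add: stair_def)
qed

lemma stair_half: "of_int m + 3/4 \<le> t \<Longrightarrow> t < of_int m + 3/2 \<Longrightarrow> stair (1/2) t = of_int m + 1"
proof -
  assume *: "of_int m + 3/4 \<le> t" "t < of_int m + 3/2"
  show ?thesis
  proof (cases "t < of_int m + 1")
    case True
    then have "\<lfloor>t\<rfloor> = m" using * by (intro floor_unique) auto
    with * show ?thesis by (simp add: stair_def)
  next
    case False
    then have "\<lfloor>t\<rfloor> = m + 1" using * by (intro floor_unique) auto
    with * show ?thesis by (simp add: stair_def)
  qed
qed

text \<open>The transition of the partition of unity: it takes place within a length 1/4, the
  overlap of consecutive flat stretches.\<close>

definition ramp :: "real \<Rightarrow> real" where
  "ramp t = max 0 (min 1 (4 * t))"

lemma ramp_lipschitz: "4-lipschitz_on UNIV ramp"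
proof (rule lipschitz_onI)
  show "dist (ramp s) (ramp t) \<le> 4 * dist s t" for s t
    unfolding ramp_def dist_real_def by (simp add: max_def min_def abs_if)
qed simp

lemma ramp_0: "t \<le> 0 \<Longrightarrow> ramp t = 0" and ramp_1: "1/4 \<le> t \<Longrightarrow> ramp t = 1"
  by (auto simp: ramp_def)

lemma ramp_bounds: "0 \<le> ramp t" "ramp t \<le> 1"
  by (auto simp: ramp_def)

text \<open>
  The two staircases are never both increasing, so \<open>f\<close> splits into finitely many pieces on which one
  of the two is constant.
\<close>

lemma current_stairs:
  fixes T :: "('a::metric_space, 'n::finite) precurrent"
  assumes T: "current T" and f: "f \<in> LIPb" and u: "L-lipschitz_on UNIV u" "\<And>x. \<bar>u x\<bar> \<le> B"
    and \<pi>: "\<And>x. apply_lip (\<pi> i) x = stair 0 (u x)" "\<And>x. apply_lip (\<pi> j) x = stair (1/2) (u x)"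
  shows "T f \<pi> = 0"
proof -
  have ml: "multilinear T" using T by (simp add: current_def)
  \<comment> \<open>This makes the range of \<open>u\<close> lie between \<open>q 0 + 1/4\<close>
    and \<open>q (2 * N)\<close>.\<close>
  obtain N :: nat where N: "2 * B + 1 \<le> real N" using real_arch_simple by blast
  define q where "q n = real n / 2 - real N / 2 + 1/4" for n
  define h where "h n x = ramp (u x - q 0) - ramp (u x - q n)" for n x
  have h1: "(4 * L + 4 * L)-lipschitz_on UNIV (h n)" for n
  proof -
    have "(4 * L)-lipschitz_on UNIV (\<lambda>x. ramp (u x - c))" for c
    proof -
      have "(L + 0)-lipschitz_on UNIV (\<lambda>x. u x - c)"
        by (intro lipschitz_on_diff u lipschitz_on_constant)
      then have "L-lipschitz_on UNIV (\<lambda>x. u x - c)" by simp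
      then have "(4 * L)-lipschitz_on UNIV (ramp \<circ> (\<lambda>x. u x - c))"
        by (rule lipschitz_on_compose) (rule lipschitz_on_subset[OF ramp_lipschitz], simp)
      then show ?thesis by (simp add: o_def)
    qed
    then show ?thesis unfolding h_def by (intro lipschitz_on_diff)
  qed
  define H where "H n = Bcontfun (h n)" for n
  have H: "apply_bcontfun (H n) = h n" for n
    unfolding H_def by (rule apply_Bcontfun_bounded[of _ 1, OF lipschitz_on_continuous_on[OF h1]])
      (unfold h_def, use ramp_bounds in smt)
  have HL: "H n \<in> LIPb" for n unfolding LIPb_def using h1 by (auto simp: H)
  have "T (f \<odot> H n) \<pi> = 0" for n
  proof (induction n)
    case 0
    show ?case
      by (rule current_strong_local[OF T LIPb_times[OF f HL], where j = i and c = 0]) (simp add: H h_def)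
  next
    case (Suc n)
    have qS: "q (Suc n) = q n + 1/2" unfolding q_def by (simp add: field_simps)
    have piece: "q n < u x \<and> u x < q n + 3/4" if "h (Suc n) x - h n x \<noteq> 0" for x
    proof (rule ccontr)
      assume "\<not> ?thesis"
      then consider "u x \<le> q n" | "q n + 3/4 \<le> u x" by linarith
      then have "ramp (u x - q n) = ramp (u x - q (Suc n))"
        by cases (simp_all add: ramp_0 ramp_1 qS)
      with that show False by (simp add: h_def)
    qed
    have piece_bounds: "q n \<le> u x" "u x < q n + 3/4" if "(f \<odot> H (Suc n) - f \<odot> H n) x \<noteq> 0" for x
    proof -
      have "h (Suc n) x - h n x \<noteq> 0" using that by (auto simp: H)
      from piece[OF this] show "q n \<le> u x" "u x < q n + 3/4" by auto
    qed
    have *: "f \<odot> H (Suc n) - f \<odot> H n \<in> LIPb" by (intro LIPb_diff LIPb_times f HL)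
    have "T (f \<odot> H (Suc n) - f \<odot> H n) \<pi> = 0"
    \<comment> \<open>The parity decides whether the stretch starting at \<open>q n\<close> is flat
      for \<open>stair 0\<close>, so that \<open>\<pi> i\<close> is constant there, or for
      \<open>stair (1/2)\<close>, so that \<open>\<pi> j\<close> is.\<close>
    proof (cases "even (int n - int N)")
      case True
      then obtain m where m: "int n - int N = 2 * m" by blast
      then have "q n = of_int m + 1/4" unfolding q_def by linarith
      then show ?thesis
        using piece_bounds by (intro current_strong_local[OF T *, where j = i and c = "of_int m + 1"])
          (simp only: \<pi>, intro stair_0, fastforce+)
    next
      case False
      then obtain m where m: "int n - int N = 2 * m + 1" by (elim oddE)
      then have "q n = of_int m + 3/4" unfolding q_def by linarith
      then show ?thesis
        using piece_bounds by (intro current_strong_local[OF T *, where j = j and c = "of_int m + 1"])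
          (simp only: \<pi>, intro stair_half, fastforce+)
    qed
    with Suc show ?case using multilinear_diff1[OF ml LIPb_times[OF f HL] LIPb_times[OF f HL], of "Suc n" n] by simp
  qed
  moreover have "f \<odot> H (2 * N) = f"
  proof (rule bcontfun_eqI)
    fix x
    have "h (2 * N) x = 1"
      using u(2)[of x] N unfolding h_def q_def by (subst ramp_1, linarith) (subst ramp_0, simp_all)
    then show "(f \<odot> H (2 * N)) x = f x" by (simp add: H)
  qed
  ultimately show ?thesis by metis
qed

text \<open>Alternation is not among the axioms of a current; locality enters through
  \<open>current_stairs\<close>, and axiom (ii) carries the vanishing to the limit.\<close>

lemma current_alternating:
  fixes T :: "('a::metric_space, 'n::finite) precurrent"
  assumes T: "current T" and f: "f \<in> LIPb" and ij: "i \<noteq> j" "\<pi> i = \<pi> j"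
  shows "T f \<pi> = 0"
proof -
  have ml: "multilinear T" and sc: "seq_continuous T" using T by (auto simp: current_def)
  obtain L where L: "L-lipschitz_on UNIV (apply_lip (\<pi> i))" using apply_lip[of "\<pi> i"] by blast
  have L0: "0 \<le> L" using L by (rule lipschitz_on_nonneg)
  \<comment> \<open>The truncation to [-k, k] provides the bound that \<open>current_stairs\<close>
    asks for; the factor k+1 refines the stairs to mesh 1/(k+1) after rescaling by
    \<open>c k\<close>.\<close>
  define u where "u k x = real (Suc k) * max (- real k) (min (real k) (\<pi> i x))" for k x
  have uL: "(real (Suc k) * L)-lipschitz_on UNIV (u k)" for k
  proof (rule lipschitz_onI)
    fix x y
    have "dist (u k x) (u k y) = real (Suc k) * \<bar>max (- real k) (min (real k) (\<pi> i x)) - max (- real k) (min (real k) (\<pi> i y))\<bar>"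
      unfolding u_def dist_real_def by (simp add: abs_mult flip: right_diff_distrib)
    also have "\<dots> \<le> real (Suc k) * \<bar>\<pi> i x - \<pi> i y\<bar>" by (rule mult_left_mono) linarith+
    also have "\<dots> \<le> real (Suc k) * (L * dist x y)"
      using lipschitz_onD[OF L, of x y] by (intro mult_left_mono) (auto simp: dist_real_def)
    finally show "dist (u k x) (u k y) \<le> real (Suc k) * L * dist x y" by (simp add: mult.assoc)
  qed (use L0 in simp)
  have ub: "\<bar>u k x\<bar> \<le> real (Suc k) * real k" for k x
    unfolding u_def abs_mult by (rule mult_mono) auto
  have stL: "(4 * (real (Suc k) * L))-lipschitz_on UNIV (\<lambda>x. stair a (u k x))" if "0 \<le> a" "a \<le> 3/4" for a k
  proof -
    have "(4 * (real (Suc k) * L))-lipschitz_on UNIV (stair a \<circ> u k)"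
      by (intro lipschitz_on_compose uL) (rule lipschitz_on_subset[OF stair_lipschitz[OF that]], simp)
    then show ?thesis by (simp add: o_def)
  qed
  define S where "S k a = Abs_lip (\<lambda>x. stair a (u k x))" for k a
  have S: "apply_lip (S k a) = (\<lambda>x. stair a (u k x))" if "0 \<le> a" "a \<le> 3/4" for k a
    unfolding S_def by (rule apply_lip_Abs[OF stL[OF that]])
  define c where "c k = 1 / real (Suc k)" for k
  have c: "c k > 0" "c k * real (Suc k) = 1" for k by (auto simp: c_def)
  define P where "P k = \<pi>(i := c k *\<^sub>R S k 0, j := c k *\<^sub>R S k (1/2))" for k
  have cS: "(4 * L)-lipschitz_on UNIV (apply_lip (c k *\<^sub>R S k a))" if "0 \<le> a" "a \<le> 3/4" for k a
  proof -
    have "(c k * (4 * (real (Suc k) * L)))-lipschitz_on UNIV (\<lambda>x. c k * stair a (u k x))"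
      using lipschitz_on_cmult_real[OF stL[OF that, of k], of "c k"] c(1)[of k] by simp
    \<comment> \<open>The two scalings cancel, so the approximants are equi-Lipschitz with constant
      4L, as axiom (ii) requires.\<close>
    also have "c k * (4 * (real (Suc k) * L)) = 4 * L * (c k * real (Suc k))" by (simp add: mult_ac)
    finally show ?thesis using c(2)[of k] by (simp add: scaleR_lip.rep_eq S[OF that] del: of_nat_Suc)
  qed
  have lim: "(\<lambda>k. apply_lip (c k *\<^sub>R S k a) x) \<longlonglongrightarrow> \<pi> i x" if a: "0 \<le> a" "a \<le> 3/4" for a x
  proof -
    have "(\<lambda>k. apply_lip (c k *\<^sub>R S k a) x - \<pi> i x) \<longlonglongrightarrow> 0"
    proof (rule Lim_null_comparison[OF _ lim_1_over_n[THEN LIMSEQ_Suc]])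
      obtain n :: nat where n: "\<bar>\<pi> i x\<bar> \<le> real n" using real_arch_simple by blast
      have "norm (apply_lip (c k *\<^sub>R S k a) x - \<pi> i x) \<le> 1 / real (Suc k)" if k: "n \<le> k" for k
      proof -
        \<comment> \<open>From k = n on the truncation does not act at x.\<close>
        have "real (Suc k) * \<pi> i x = u k x"
          using n k unfolding u_def by (simp add: abs_le_iff)
        then have "c k * u k x = \<pi> i x"
          using c(2)[of k] by (metis mult.assoc mult_1)
        then have "apply_lip (c k *\<^sub>R S k a) x - \<pi> i x = c k * (stair a (u k x) - u k x)"
          by (simp add: scaleR_lip.rep_eq S[OF a] right_diff_distrib)
        moreover have "\<bar>c k * (stair a (u k x) - u k x)\<bar> \<le> c k * 1"
          unfolding abs_mult using c(1)[of k] stair_close[OF a(1), of "u k x"] by (intro mult_mono) auto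
        ultimately show ?thesis by (simp add: c_def)
      qed
      then show "\<forall>\<^sub>F k in sequentially. norm (apply_lip (c k *\<^sub>R S k a) x - \<pi> i x) \<le> 1 / real (Suc k)"
        by (auto simp: eventually_sequentially)
    qed
    then show ?thesis by (simp add: LIM_zero_iff)
  qed
  have "T f (P k) = 0" for k
  proof -
    \<comment> \<open>Swapping the order of the two updates lets the scalars be pulled out one after
      the other.\<close>
    have "T f (P k) = c k * T f (\<pi>(j := S k (1/2), i := c k *\<^sub>R S k 0))"
      unfolding P_def by (simp only: multilinear_scale2[OF ml f] fun_upd_twist[OF ij(1)[symmetric], of _ "S k (1/2)"])
    also have "\<dots> = c k * (c k * T f (\<pi>(i := S k 0, j := S k (1/2))))"
      by (simp only: multilinear_scale2[OF ml f] fun_upd_twist[OF ij(1), of \<pi> "S k 0"])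
    also have "T f (\<pi>(i := S k 0, j := S k (1/2))) = 0"
      using ij(1) by (intro current_stairs[OF T f uL[of k] ub[of k], where i = i and j = j]) (simp_all add: S)
    finally show ?thesis by simp
  qed
  moreover have "(\<lambda>k. T f (P k)) \<longlonglongrightarrow> T f \<pi>"
  proof (rule sc[unfolded seq_continuous_def, rule_format, OF f], intro conjI allI)
    show "\<exists>L. \<forall>k. L-lipschitz_on UNIV (apply_lip (P k l))" for l
    proof (cases "l = i \<or> l = j")
      case True
      then show ?thesis using cS ij(1) unfolding P_def by (intro exI[of _ "4 * L"]) auto
    next
      case False
      then show ?thesis unfolding P_def using apply_lip[of "\<pi> l"] by auto
    qed
    show "(\<lambda>k. apply_lip (P k l) x) \<longlonglongrightarrow> apply_lip (\<pi> l) x" for l x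
    proof -
      consider "l = i" | "l = j" | "l \<noteq> i" "l \<noteq> j" by blast
      then show ?thesis
        by cases (use lim[of 0 x] lim[of "1/2" x] ij in \<open>simp_all add: P_def\<close>)
    qed
  qed
  ultimately show ?thesis by (simp add: LIMSEQ_const_iff)
qed

section \<open>Cutoff functions\<close>

lemma norm_bcontfun_le:
  fixes f :: "'a::topological_space \<Rightarrow>\<^sub>C real"
  shows "(\<And>x. \<bar>f x\<bar> \<le> b) \<Longrightarrow> norm f \<le> b"
  by (rule norm_bound) simp

lemma abs_blinfun_le:
  fixes F :: "'v::real_normed_vector \<Rightarrow>\<^sub>L real"
  shows "norm v \<le> b \<Longrightarrow> \<bar>F v\<bar> \<le> norm F * b"
  using norm_blinfun[of F v] mult_left_mono[of "norm v" b "norm F"] by simp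

lemma cb_supp_subsetI:
  "closed C \<Longrightarrow> (\<And>x. apply_bcontfun f x \<noteq> 0 \<Longrightarrow> x \<in> C) \<Longrightarrow> cb_supp f \<subseteq> C"
  unfolding cb_supp_def by (rule closure_minimal) auto

lemma cb_suppI: "apply_bcontfun f x \<noteq> 0 \<Longrightarrow> x \<in> cb_supp f"
  unfolding cb_supp_def by (rule closure_subset[THEN subsetD]) simp

text \<open>The case distinction is due to \<open>infdist x {} = 0\<close>.\<close>

definition height :: "'a::metric_space set \<Rightarrow> 'a \<Rightarrow> real" where
  "height U x = (if U = UNIV then 1 else infdist x (- U))"

lemma continuous_on_height: "continuous_on A (height U)"
  unfolding height_def by (cases "U = UNIV") (auto intro!: continuous_intros)

lemma height_nonneg: "0 \<le> height U x"
  by (simp add: height_def infdist_nonneg)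

lemma height_pos_iff: "open U \<Longrightarrow> 0 < height U x \<longleftrightarrow> x \<in> U"
proof (cases "U = UNIV")
  case False
  assume "open U"
  then have "x \<notin> U \<longleftrightarrow> infdist x (- U) = 0"
    using False in_closed_iff_infdist_zero[of "- U" x] by (auto simp: closed_def)
  then show ?thesis using False height_nonneg[of U x] by (auto simp: height_def)
qed (simp add: height_def)

text \<open>The shift by -1 keeps the closed support, and not only the set where the function is
  nonzero, inside an open U: it lies in the closed set where k times the height is at least
  1.\<close>

definition cutoff :: "'a::metric_space set \<Rightarrow> nat \<Rightarrow> 'a \<Rightarrow>\<^sub>C real" where
  "cutoff U k = Bcontfun (\<lambda>x. max 0 (min 1 (real k * height U x - 1)))"

lemma cutoff_apply: "cutoff U k x = max 0 (min 1 (real k * height U x - 1))"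
  unfolding cutoff_def
  by (subst apply_Bcontfun_bounded[where B = 1]) (auto intro!: continuous_intros continuous_on_height)

lemma cutoff_bounds: "0 \<le> cutoff U k x" "cutoff U k x \<le> 1"
  by (auto simp: cutoff_apply)

lemma cutoff_supp: "open U \<Longrightarrow> cb_supp (cutoff U k) \<subseteq> U"
proof -
  assume U: "open U"
  have "cb_supp (cutoff U k) \<subseteq> {x. 1 \<le> real k * height U x}"
    by (rule cb_supp_subsetI)
      (auto simp: cutoff_apply max_def min_def split: if_splits
        intro!: closed_Collect_le continuous_intros continuous_on_height)
  also have "\<dots> \<subseteq> U" using height_pos_iff[OF U] height_nonneg[of U]
    by (force simp: less_le)
  finally show ?thesis .
qed

lemma cutoff_outside: "open U \<Longrightarrow> x \<notin> U \<Longrightarrow> cutoff U k x = 0"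
  using cutoff_supp[of U k] cb_suppI by blast

lemma cutoff_mono: "k \<le> l \<Longrightarrow> cutoff U k x \<le> cutoff U l x"
proof -
  assume "k \<le> l"
  then have "real k * height U x \<le> real l * height U x" by (intro mult_right_mono height_nonneg) simp
  then show ?thesis by (simp add: cutoff_apply max_def min_def)
qed

lemma cutoff_tendsto: "open U \<Longrightarrow> (\<lambda>k. cutoff U k x) \<longlonglongrightarrow> indicator U x"
proof (cases "x \<in> U")
  case True
  assume U: "open U"
  have h: "0 < height U x" using True height_pos_iff[OF U] by simp
  obtain N :: nat where N: "2 / height U x < real N" using reals_Archimedean2 by blast
  have "cutoff U k x = 1" if "k \<ge> N" for k
  proof -
    have "2 < real N * height U x" using N h by (simp add: divide_less_eq)
    also have "\<dots> \<le> real k * height U x" using that h by (intro mult_right_mono) auto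
    finally show ?thesis by (simp add: cutoff_apply)
  qed
  then show ?thesis using True by (intro tendsto_eventually) (auto simp: eventually_sequentially)
qed (simp add: cutoff_outside)

text \<open>Where \<open>cutoff U k\<close> is nonzero, k times the height exceeds 1, so
  \<open>cutoff U (2 * k)\<close> equals 1. Thus one cutoff certifies the support of what another
  has localized.\<close>

lemma cutoff_absorb: "cutoff U (2 * k) \<odot> cutoff U k = cutoff U k"
  by (rule bcontfun_eqI) (auto simp: cutoff_apply max_def min_def)

text \<open>Dynkin's pi-lambda theorem for the intersection-stable generator of open sets.\<close>

lemma borel_induct_disjoint [consumes 1, case_names basic compl union]:
  assumes "A \<in> sets (borel :: 'a::topological_space measure)"
    and "\<And>U. open U \<Longrightarrow> P U"
    and "\<And>A. A \<in> sets borel \<Longrightarrow> P A \<Longrightarrow> P (- A)"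
    and "\<And>A. disjoint_family A \<Longrightarrow> range A \<subseteq> sets borel \<Longrightarrow> (\<And>i. P (A i)) \<Longrightarrow> P (\<Union>i::nat. A i)"
  shows "P A"
proof -
  have s: "sets (borel :: 'a measure) = sigma_sets UNIV {S. open S}"
    unfolding borel_def by (rule sets_measure_of) simp
  have "Int_stable {S :: 'a set. open S}" by (auto simp: Int_stable_def)
  from sigma_sets_induct_disjoint[OF this _ assms(1)[unfolded s], of P] show ?thesis
    using assms(2-)[unfolded s] by (auto simp: Compl_eq_Diff_UNIV[symmetric])
qed

section \<open>Modules over the bounded continuous functions on a metric space\<close>

text \<open>The metric supplies the cutoffs of open sets. The measure theory below is carried out
  for an arbitrary such module; forms and currents enter with the interpretation at
  \<open>dform_mult\<close>.\<close>

locale metric_cb_module = normed_cb_module smult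
  for smult :: "('a::metric_space \<Rightarrow>\<^sub>C real) \<Rightarrow> 'v::real_normed_vector \<Rightarrow> 'v"
begin

lemma smult_zero_right [simp]: "smult f 0 = 0"
  using smult_add_right[of f 0 0] by simp

lemma smult_zero_left [simp]: "smult 0 v = 0"
  using smult_add_left[of 0 0 v] by simp

lemma smult_scale_left: "smult (c *\<^sub>R f) v = c *\<^sub>R smult f v"
proof -
  have "const_bcontfun c \<odot> f = c *\<^sub>R f" by (rule bcontfun_eqI) simp
  then show ?thesis using smult_smult[of "const_bcontfun c" f v] by (simp add: smult_const)
qed

lemma smult_scale_right: "smult f (c *\<^sub>R v) = c *\<^sub>R smult f v"
proof -
  have "f \<odot> const_bcontfun c = c *\<^sub>R f" by (rule bcontfun_eqI) simp
  then show ?thesis using smult_smult[of f "const_bcontfun c" v]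
    by (simp add: smult_const smult_scale_left)
qed

lemma smult_diff_left: "smult (f - g) v = smult f v - smult g v"
  using smult_add_left[of f "(-1) *\<^sub>R g" v] smult_scale_left[of "-1" g v] by simp

lemma smult_one: "smult (const_bcontfun 1) v = v"
  by (simp add: smult_const)

lemma norm_smult_le: "norm (smult f v) \<le> norm f * norm v"
  using norm_sum_smult_le[of "{0}" "\<lambda>_. f" "\<lambda>_. v"] by simp

lemma norm_smult_le_norm: "norm f \<le> 1 \<Longrightarrow> norm (smult f v) \<le> norm v"
  using norm_smult_le[of f v] mult_right_mono[of "norm f" 1 "norm v"] by simp

text \<open>The module inequality for two terms. A maximum instead of a sum on the right is what
  makes dual norms superadditive over disjoint supports.\<close>

lemma norm_smult_disjoint_le:
  assumes "cb_supp f \<inter> cb_supp g = {}" "norm f \<le> 1" "norm g \<le> 1" "norm v \<le> 1" "norm w \<le> 1"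
  shows "norm (smult f v + smult g w) \<le> 1"
proof -
  let ?f = "\<lambda>i::nat. if i = 0 then f else g" and ?v = "\<lambda>i::nat. if i = 0 then v else w"
  have "norm (\<Sum>i\<in>{0,1}. smult (?f i) (?v i)) \<le> (MAX i\<in>{0,1}. norm (?f i)) * (MAX i\<in>{0,1}. norm (?v i))"
    by (rule norm_sum_smult_le) (use assms in \<open>auto split: if_splits\<close>)
  also have "\<dots> \<le> 1 * 1" using assms by (intro mult_mono) (auto simp: le_max_iff_disj)
  finally show ?thesis by simp
qed

text \<open>The supremum is over a set bounded by \<open>norm v\<close>, and rescaling
  \<open>f\<close> removes the constraint \<open>norm f \<le> 1\<close>.\<close>

lemma local_norm_zero_iff: "local_norm A v = 0 \<longleftrightarrow> (\<forall>f. cb_supp f \<subseteq> A \<longrightarrow> smult f v = 0)"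
proof -
  let ?S = "{norm (smult f v) |f. cb_supp f \<subseteq> A \<and> norm f \<le> 1}"
  have bdd: "bdd_above ?S" by (rule bdd_aboveI[of _ "norm v"]) (auto intro: norm_smult_le_norm)
  show ?thesis
  proof
    assume 0: "local_norm A v = 0"
    show "\<forall>f. cb_supp f \<subseteq> A \<longrightarrow> smult f v = 0"
    proof (intro allI impI)
      fix f assume f: "cb_supp f \<subseteq> A"
      \<comment> \<open>The summand 1 covers the case f = 0.\<close>
      define c where "c = 1 / (norm f + 1)"
      have n: "0 < norm f + 1" using norm_ge_zero[of f] by linarith
      then have c: "c > 0" "norm (c *\<^sub>R f) \<le> 1" by (auto simp: c_def divide_le_eq)
      have "cb_supp (c *\<^sub>R f) \<subseteq> A" using f c(1) by (simp add: cb_supp_def)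
      then have "norm (smult (c *\<^sub>R f) v) \<le> local_norm A v"
        unfolding local_norm_def using c by (intro cSup_upper[OF _ bdd]) blast
      then show "smult f v = 0" using 0 c(1) by (simp add: smult_scale_left mult_le_0_iff)
    qed
  next
    assume *: "\<forall>f. cb_supp f \<subseteq> A \<longrightarrow> smult f v = 0"
    \<comment> \<open>The function 0 is admissible, so the set is nonempty.\<close>
    have "?S = {0}"
      using * by (auto intro!: exI[of _ 0] simp: cb_supp_def)
    then show "local_norm A v = 0" by (simp add: local_norm_def)
  qed
qed

lemma local_norm_zero_mono: "local_norm B v = 0 \<Longrightarrow> A \<subseteq> B \<Longrightarrow> local_norm A v = 0"
  unfolding local_norm_zero_iff by blast

lemma local_norm_zeroI: "(\<And>x. x \<in> A \<Longrightarrow> apply_bcontfun f x = 0) \<Longrightarrow> local_norm A (smult f v) = 0"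
  unfolding local_norm_zero_iff
proof (intro allI impI)
  fix g assume *: "\<And>x. x \<in> A \<Longrightarrow> apply_bcontfun f x = 0" and g: "cb_supp g \<subseteq> A"
  have "g \<odot> f = 0" by (rule bcontfun_eqI) (use * g cb_suppI in fastforce)
  then show "smult g (smult f v) = 0" by (simp add: smult_smult)
qed

lemma local_norm_diff_zeroI:
  "(\<And>x. x \<in> A \<Longrightarrow> apply_bcontfun f x = apply_bcontfun g x) \<Longrightarrow> local_norm A (smult f v - smult g v) = 0"
  using local_norm_zeroI[of A "f - g" v] by (simp add: smult_diff_left)

lemma supp_in_smult: "cb_supp f \<subseteq> A \<Longrightarrow> supp_in (smult f v) A"
  unfolding supp_in_def
  by (rule exI[of _ "cb_supp f"]) (auto intro!: local_norm_zeroI simp: cb_supp_def intro: cb_suppI dest: cb_suppI[unfolded cb_supp_def])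

section \<open>The measure of a tight functional\<close>

lemma tightD:
  "tight F \<Longrightarrow> (\<And>x. decseq (\<lambda>n. apply_bcontfun (\<phi> n) x)) \<Longrightarrow>
    (\<And>x. (\<lambda>n. apply_bcontfun (\<phi> n) x) \<longlonglongrightarrow> 0) \<Longrightarrow> (\<lambda>n. F (smult (\<phi> n) v)) \<longlonglongrightarrow> 0"
  unfolding tight_def by blast

section \<open>The outer measure given by dual norms on open sets\<close>

text \<open>Support in \<open>U\<close> is witnessed by a function \<open>k\<close> that reproduces
  \<open>w\<close>, so that disjointness and localization become identities between products of
  functions.\<close>

definition unit_forms :: "'a set \<Rightarrow> 'v set" where
  "unit_forms U = {w. norm w \<le> 1 \<and> (\<exists>k. cb_supp k \<subseteq> U \<and> (\<forall>x. 0 \<le> apply_bcontfun k x \<and> apply_bcontfun k x \<le> 1) \<and> smult k w = w)}"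

text \<open>\<open>ennreal\<close> sends negative values to 0. This does not change the supremum,
  because 0 is a unit form.\<close>

definition open_mass :: "('v \<Rightarrow>\<^sub>L real) \<Rightarrow> 'a set \<Rightarrow> ennreal" where
  "open_mass F U = (SUP w\<in>unit_forms U. ennreal (F w))"

definition outer_mass :: "('v \<Rightarrow>\<^sub>L real) \<Rightarrow> 'a set \<Rightarrow> ennreal" where
  "outer_mass F E = (INF U\<in>{U. open U \<and> E \<subseteq> U}. open_mass F U)"

lemma unit_formsI:
  assumes "norm w \<le> 1" "cb_supp k \<subseteq> U" "\<And>x. 0 \<le> k x" "\<And>x. k x \<le> 1" "smult k w = w"
  shows "w \<in> unit_forms U"
  unfolding unit_forms_def using assms by blast

lemma unit_formsE:
  assumes "w \<in> unit_forms U"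
  obtains k where "cb_supp k \<subseteq> U" "\<And>x. 0 \<le> apply_bcontfun k x" "\<And>x. apply_bcontfun k x \<le> 1"
    "smult k w = w" "norm w \<le> 1"
  using assms unfolding unit_forms_def by blast

lemma norm_01: "(\<And>x. 0 \<le> apply_bcontfun k x) \<Longrightarrow> (\<And>x. apply_bcontfun k x \<le> (1::real)) \<Longrightarrow> norm k \<le> 1"
  by (rule norm_bcontfun_le) auto

lemma zero_unit_forms: "0 \<in> unit_forms U"
  by (rule unit_formsI[where k = 0]) (auto simp: cb_supp_def)

lemma open_mass_upper: "w \<in> unit_forms U \<Longrightarrow> ennreal (blinfun_apply F w) \<le> open_mass F U"
  unfolding open_mass_def by (rule SUP_upper)

lemma open_mass_mono: "U \<subseteq> V \<Longrightarrow> open_mass F U \<le> open_mass F V"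
  unfolding open_mass_def by (rule SUP_subset_mono) (auto simp: unit_forms_def)

lemma open_mass_le_norm: "open_mass F U \<le> ennreal (norm F)"
  unfolding open_mass_def
proof (rule SUP_least, rule ennreal_leI)
  fix w assume "w \<in> unit_forms U"
  then have "norm (F w) \<le> norm F * 1"
    by (intro order_trans[OF norm_blinfun mult_left_mono]) (auto simp: unit_forms_def)
  then show "F w \<le> norm F" by simp
qed

lemma open_mass_empty: "open_mass F {} = 0"
proof -
  have "w = 0" if w: "w \<in> unit_forms {}" for w
  proof -
    obtain k where "cb_supp k \<subseteq> {}" "smult k w = w" using w unfolding unit_forms_def by blast
    moreover from this have "k = 0" by (intro bcontfun_eqI) (use cb_suppI in force)
    ultimately show ?thesis by simp
  qed
  then have "unit_forms {} = {0}" using zero_unit_forms by blast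
  then show ?thesis by (simp add: open_mass_def)
qed

lemma outer_mass_open: "open U \<Longrightarrow> outer_mass F U = open_mass F U"
  unfolding outer_mass_def by (intro antisym INF_lower INF_greatest) (auto intro: open_mass_mono)

lemma outer_mass_mono: "A \<subseteq> B \<Longrightarrow> outer_mass F A \<le> outer_mass F B"
  unfolding outer_mass_def by (rule INF_superset_mono) auto

lemma outer_mass_le: "open U \<Longrightarrow> E \<subseteq> U \<Longrightarrow> outer_mass F E \<le> open_mass F U"
  unfolding outer_mass_def by (rule INF_lower) simp

text \<open>If \<open>w\<close> is supported in \<open>C = supp k \<subseteq> W \<inter> U\<close>, then \<open>W - C\<close> is open and contains \<open>W - U\<close>.\<close>

lemma outer_mass_split:
  assumes W: "open W" and U: "open U"
  shows "outer_mass F (U \<inter> W) + outer_mass F (W - U) \<le> open_mass F W"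
proof -
  have *: "ennreal (F w) + outer_mass F (W - U) \<le> open_mass F W" if w: "w \<in> unit_forms (U \<inter> W)" for w
  proof -
    obtain k where k: "cb_supp k \<subseteq> U \<inter> W" "\<And>x. 0 \<le> k x" "\<And>x. k x \<le> 1" "smult k w = w" and wn: "norm w \<le> 1"
      using w by (auto simp: unit_forms_def)
    let ?V = "W - cb_supp k"
    have V: "open ?V" using W by (intro open_Diff) (auto simp: cb_supp_def)
    have "ennreal (F w) + open_mass F ?V \<le> open_mass F W"
    proof -
      have "ennreal (F w) + ennreal (F u) \<le> open_mass F W" if u: "u \<in> unit_forms ?V" for u
      proof -
        obtain l where l: "cb_supp l \<subseteq> ?V" "\<And>x. 0 \<le> l x" "\<And>x. l x \<le> 1" "smult l u = u" and un: "norm u \<le> 1"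
          using u by (auto simp: unit_forms_def)
        have disj: "cb_supp k \<inter> cb_supp l = {}" using l(1) by blast
        then have kl: "k x = 0 \<or> l x = 0" for x using cb_suppI by fast
        have "k \<odot> l = 0" "l \<odot> k = 0" by (rule bcontfun_eqI; use kl in auto)+
        then have "smult k u = 0" "smult l w = 0"
          using smult_smult[of k l u] smult_smult[of l k w] k l by simp_all
        then have "smult (k + l) (w + u) = w + u"
          by (simp add: smult_add_left smult_add_right k l)
        moreover have "cb_supp (k + l) \<subseteq> cb_supp k \<union> cb_supp l"
        proof (rule cb_supp_subsetI)
          show "closed (cb_supp k \<union> cb_supp l)" by (simp add: cb_supp_def closed_Un)
          fix x assume "(k + l) x \<noteq> 0"
          then have "k x \<noteq> 0 \<or> l x \<noteq> 0" by auto
          then show "x \<in> cb_supp k \<union> cb_supp l" using cb_suppI by blast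
        qed
        \<comment> \<open>Since w = k w and u = l u with disjoint supports, the sum is still in the
          unit ball.\<close>
        moreover have "norm (w + u) \<le> 1"
          using norm_smult_disjoint_le[OF disj norm_01 norm_01 wn un] k l by simp
        moreover have "0 \<le> (k + l) x \<and> (k + l) x \<le> 1" for x using kl[of x] k l by auto
        ultimately have wu: "w + u \<in> unit_forms W"
          using k(1) l(1) by (intro unit_formsI[where k = "k + l"]) (blast+)
        show ?thesis
        \<comment> \<open>If one value is negative it becomes 0 in \<open>ennreal\<close>, and the
          other form alone gives the bound.\<close>
        proof (cases "0 \<le> F w \<and> 0 \<le> F u")
          case True
          then show ?thesis using open_mass_upper[OF wu, of F]
            by (simp add: blinfun.add_right flip: ennreal_plus)
        next
          case False
          have "w \<in> unit_forms W" "u \<in> unit_forms W"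
            using w u unfolding unit_forms_def by blast+
          with False show ?thesis using open_mass_upper[of w W F] open_mass_upper[of u W F]
            by (auto simp: ennreal_neg not_le)
        qed
      qed
      then show ?thesis
        unfolding open_mass_def[of F ?V]
        using zero_unit_forms[of ?V] by (subst ennreal_SUP_add_right) (auto intro!: SUP_least)
    qed
    moreover have "outer_mass F (W - U) \<le> open_mass F ?V" using k(1) V by (intro outer_mass_le) auto
    ultimately show ?thesis using add_left_mono order_trans by blast
  qed
  have "outer_mass F (U \<inter> W) = (SUP w\<in>unit_forms (U \<inter> W). ennreal (F w))"
    using U W by (simp add: outer_mass_open open_Int open_mass_def)
  also have "\<dots> + outer_mass F (W - U) = (SUP w\<in>unit_forms (U \<inter> W). ennreal (F w) + outer_mass F (W - U))"
    using zero_unit_forms[of "U \<inter> W"] by (subst ennreal_SUP_add_left) auto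
  also have "\<dots> \<le> open_mass F W" using * by (rule SUP_least)
  finally show ?thesis .
qed

text \<open>With \<open>w\<^sub>0 = w\<close> and \<open>w\<^sub>i\<^sub>+\<^sub>1 = (1 - c\<^sub>i) w\<^sub>i\<close> the vector \<open>w\<close> is the sum of the \<open>c\<^sub>i w\<^sub>i\<close> and a remainder.\<close>

lemma complement_product:
  fixes c :: "nat \<Rightarrow> 'a \<Rightarrow>\<^sub>C real"
  assumes c: "\<And>i x. 0 \<le> c i x" "\<And>i x. c i x \<le> 1"
  obtains p :: "'a \<Rightarrow>\<^sub>C real" and q :: "nat \<Rightarrow> 'a \<Rightarrow>\<^sub>C real"
  where "\<And>x. p x = (\<Prod>i<n. 1 - c i x)" "\<And>i x. 0 \<le> q i x" "\<And>i x. q i x \<le> 1"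
    "\<And>w. w = (\<Sum>i<n. smult (c i \<odot> q i) w) + smult p w"
proof -
  define q where "q i = Bcontfun (\<lambda>x. \<Prod>j<i. 1 - c j x)" for i
  have q: "q i x = (\<Prod>j<i. 1 - c j x)" for i x
    unfolding q_def using c
    by (subst apply_Bcontfun_bounded[where B = 1])
      (auto intro!: continuous_intros prod_le_1 simp: abs_prod)
  have "w = (\<Sum>i<n. smult (c i \<odot> q i) w) + smult (q n) w" for w
  proof (induction n)
    case 0
    have "q 0 = const_bcontfun 1" by (rule bcontfun_eqI) (simp add: q)
    then show ?case by (simp add: smult_one)
  next
    case (Suc n)
    have "q n = c n \<odot> q n + q (Suc n)" by (rule bcontfun_eqI) (simp add: q algebra_simps)
    then have "smult (q n) w = smult (c n \<odot> q n) w + smult (q (Suc n)) w"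
      by (metis smult_add_left)
    with Suc show ?case by (simp add: add.assoc)
  qed
  then show ?thesis
    using that[of "q n" q] c by (auto simp: q prod_nonneg prod_le_1)
qed

text \<open>A unit form on the union is decomposed along cutoffs of the first n sets. The remainder
  carries the factor \<open>p n\<close>, which decreases to 0 on the union; multiplied by
  \<open>k\<close> it decreases to 0 everywhere, and tightness makes its contribution
  vanish.\<close>

lemma open_mass_subadditive:
  assumes F: "tight F" and U: "\<And>i. open (U i)"
  shows "open_mass F (\<Union>i::nat. U i) \<le> (\<Sum>i. open_mass F (U i))"
  unfolding open_mass_def[of F "\<Union>i. U i"]
proof (rule SUP_least)
  fix w assume "w \<in> unit_forms (\<Union>i. U i)"
  then obtain k where k: "cb_supp k \<subseteq> (\<Union>i. U i)" "\<And>x. 0 \<le> k x" "\<And>x. k x \<le> 1" "smult k w = w" and wn: "norm w \<le> 1"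
    by (rule unit_formsE) blast
  define Q where "Q n p q \<longleftrightarrow> (\<forall>x. apply_bcontfun p x = (\<Prod>i<n. 1 - cutoff (U i) n x)) \<and>
      (\<forall>i x. 0 \<le> apply_bcontfun (q i) x \<and> apply_bcontfun (q i) x \<le> 1) \<and>
      w = (\<Sum>i<n. smult (cutoff (U i) n \<odot> q i) w) + smult p w" for n p q
  have "\<exists>p q. Q n p q" for n
  proof -
    obtain p q where "\<And>x. apply_bcontfun p x = (\<Prod>i<n. 1 - cutoff (U i) n x)"
      "\<And>i x. 0 \<le> apply_bcontfun (q i) x" "\<And>i x. apply_bcontfun (q i) x \<le> 1"
      "\<And>w. w = (\<Sum>i<n. smult (cutoff (U i) n \<odot> q i) w) + smult p w"
      by (rule complement_product[of "\<lambda>i. cutoff (U i) n" n, OF cutoff_bounds]) blast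
    then show ?thesis unfolding Q_def by blast
  qed
  then obtain p q where Q: "\<And>n. Q n (p n) (q n)" by metis
  have p: "p n x = (\<Prod>i<n. 1 - cutoff (U i) n x)" for n x using Q[of n] unfolding Q_def by blast
  have q: "0 \<le> q n i x" "q n i x \<le> 1" for n i x using Q[of n] unfolding Q_def by blast+
  have w: "w = (\<Sum>i<n. smult (cutoff (U i) n \<odot> q n i) w) + smult (p n) w" for n
    using Q[of n] unfolding Q_def by blast
  have p01: "0 \<le> p n x" "p n x \<le> 1" for n x
    unfolding p by (auto intro!: prod_nonneg prod_le_1 simp: cutoff_bounds)
  \<comment> \<open>Passing to n+1 adds a factor at most 1 and decreases each of the old
    ones.\<close>
  have dec: "p (Suc n) x \<le> p n x" for n x
  proof -
    have "(\<Prod>i<Suc n. 1 - cutoff (U i) (Suc n) x) \<le> (\<Prod>i<n. 1 - cutoff (U i) (Suc n) x) * 1"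
      unfolding prod.lessThan_Suc by (intro mult_left_mono prod_nonneg) (auto simp: cutoff_bounds)
    also have "\<dots> \<le> (\<Prod>i<n. 1 - cutoff (U i) n x)"
      by (simp, intro prod_mono) (auto simp: cutoff_bounds intro!: cutoff_mono)
    finally show ?thesis by (simp add: p)
  qed
  have lim: "(\<lambda>n. (p n \<odot> k) x) \<longlonglongrightarrow> 0" for x
  proof (cases "x \<in> (\<Union>i. U i)")
    case True
    then obtain i where i: "x \<in> U i" by blast
    have le: "p n x \<le> 1 - cutoff (U i) n x" if "n > i" for n
    proof -
      have "p n x = (1 - cutoff (U i) n x) * (\<Prod>j\<in>{..<n} - {i}. 1 - cutoff (U j) n x)"
        unfolding p using that by (intro prod.remove) auto
      also have "\<dots> \<le> (1 - cutoff (U i) n x) * 1"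
        by (intro mult_left_mono prod_le_1) (auto simp: cutoff_bounds)
      finally show ?thesis by simp
    qed
    have "(\<lambda>n. cutoff (U i) n x) \<longlonglongrightarrow> 1"
      using cutoff_tendsto[OF U, of i x] i by simp
    then have l0: "(\<lambda>n. 1 - cutoff (U i) n x) \<longlonglongrightarrow> 0"
      using tendsto_diff[OF tendsto_const, of "\<lambda>n. cutoff (U i) n x" 1 sequentially 1] by simp
    have "(\<lambda>n. p n x) \<longlonglongrightarrow> 0"
    proof (rule tendsto_sandwich[OF _ _ tendsto_const l0])
      show "\<forall>\<^sub>F n in sequentially. 0 \<le> p n x" by (simp add: p01)
      show "\<forall>\<^sub>F n in sequentially. p n x \<le> 1 - cutoff (U i) n x"
        using eventually_gt_at_top[of i] by eventually_elim (rule le)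
    qed
    then show ?thesis by (simp add: tendsto_mult_left_zero)
  next
    case False
    then have "k x = 0" using k(1) cb_suppI by blast
    then show ?thesis by simp
  qed
  have "decseq (\<lambda>n. (p n \<odot> k) x)" for x
    by (rule decseq_SucI) (simp add: dec k mult_right_mono)
  then have "(\<lambda>n. F (smult (p n \<odot> k) w)) \<longlonglongrightarrow> 0" by (intro tightD[OF F, of "\<lambda>n. p n \<odot> k"] lim)
  then have rem: "(\<lambda>n. F (smult (p n) w)) \<longlonglongrightarrow> 0" by (simp add: k flip: smult_smult)
  have bound: "ennreal (F w) \<le> (\<Sum>i. open_mass F (U i)) + ennreal (F (smult (p n) w))" for n
  proof -
    \<comment> \<open>The cutoff at the doubled level reproduces the piece, by
      \<open>cutoff_absorb\<close>.\<close>
    have piece: "smult (cutoff (U i) n \<odot> q n i) w \<in> unit_forms (U i)" for i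
    proof (rule unit_formsI[where k = "cutoff (U i) (2 * n)"])
      have "norm (cutoff (U i) n \<odot> q n i) \<le> 1"
        by (rule norm_01) (auto simp: cutoff_bounds q mult_le_one)
      then show "norm (smult (cutoff (U i) n \<odot> q n i) w) \<le> 1"
        using norm_smult_le_norm wn order_trans by blast
      show "smult (cutoff (U i) (2 * n)) (smult (cutoff (U i) n \<odot> q n i) w) = smult (cutoff (U i) n \<odot> q n i) w"
        by (simp add: cutoff_absorb smult_smult[of _ "cutoff (U i) n"] flip: smult_smult)
    qed (use U in \<open>auto simp: cutoff_bounds cutoff_supp\<close>)
    have "F w = (\<Sum>i<n. F (smult (cutoff (U i) n \<odot> q n i) w)) + F (smult (p n) w)"
      by (subst w[of n]) (simp add: blinfun.add_right blinfun.sum_right)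
    \<comment> \<open>Negative terms are dropped so that the sum can be taken in
      \<open>ennreal\<close>.\<close>
    then have "F w \<le> (\<Sum>i<n. max 0 (F (smult (cutoff (U i) n \<odot> q n i) w))) + max 0 (F (smult (p n) w))"
      by (auto intro!: add_mono sum_mono)
    then have "ennreal (F w) \<le> ennreal ((\<Sum>i<n. max 0 (F (smult (cutoff (U i) n \<odot> q n i) w))) + max 0 (F (smult (p n) w)))"
      by (rule ennreal_leI)
    also have "\<dots> = (\<Sum>i<n. ennreal (max 0 (F (smult (cutoff (U i) n \<odot> q n i) w)))) + ennreal (max 0 (F (smult (p n) w)))"
      by (subst ennreal_plus) (auto simp: sum_nonneg sum_ennreal)
    also have "\<dots> \<le> (\<Sum>i<n. open_mass F (U i)) + ennreal (F (smult (p n) w))"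
      using open_mass_upper[OF piece, of F] by (intro add_mono sum_mono) (auto simp: max_def ennreal_neg)
    also have "\<dots> \<le> (\<Sum>i. open_mass F (U i)) + ennreal (F (smult (p n) w))"
      by (intro add_mono sum_le_suminf) auto
    finally show ?thesis .
  qed
  have "(\<lambda>n. (\<Sum>i. open_mass F (U i)) + ennreal (F (smult (p n) w))) \<longlonglongrightarrow> (\<Sum>i. open_mass F (U i)) + ennreal 0"
    by (intro tendsto_add tendsto_const tendsto_ennrealI rem)
  then have "ennreal (F w) \<le> (\<Sum>i. open_mass F (U i)) + ennreal 0"
    by (rule LIMSEQ_le_const) (use bound in auto)
  then show "ennreal (F w) \<le> (\<Sum>i. open_mass F (U i))" by simp
qed

text \<open>Open sets covering \<open>A n\<close> with excess e/2^(n+1) reduce the claim to open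
  sets.\<close>

lemma outer_mass_subadditive:
  assumes F: "tight F"
  shows "outer_mass F (\<Union>i::nat. A i) \<le> (\<Sum>i. outer_mass F (A i))"
proof (rule ennreal_le_epsilon)
  fix e :: real assume "0 < e" "(\<Sum>n. outer_mass F (A n)) < top"
  then have *: "outer_mass F (A n) < outer_mass F (A n) + e * (1/2)^Suc n" for n
    by (auto simp add: less_top dest!: ennreal_suminf_lessD)
  have "\<exists>U. open U \<and> A n \<subseteq> U \<and> open_mass F U < outer_mass F (A n) + e * (1/2)^Suc n" for n
    using *[of n, unfolded outer_mass_def[of F "A n"] INF_less_iff] unfolding outer_mass_def by blast
  then obtain U where U: "\<And>n. open (U n)" "\<And>n. A n \<subseteq> U n"
    "\<And>n. open_mass F (U n) < outer_mass F (A n) + e * (1/2)^Suc n"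
    by metis
  have "outer_mass F (\<Union>i. A i) \<le> open_mass F (\<Union>i. U i)"
    using U(1,2) by (intro outer_mass_le) auto
  also have "\<dots> \<le> (\<Sum>i. open_mass F (U i))" by (rule open_mass_subadditive[OF F U(1)])
  also have "\<dots> \<le> (\<Sum>n. outer_mass F (A n) + e * (1/2) ^ Suc n)"
    using U(3) by (intro suminf_le) (auto intro: less_imp_le)
  also have "... = (\<Sum>n. outer_mass F (A n)) + (\<Sum>n. ennreal e * ennreal ((1/2) ^ Suc n))"
    using \<open>0 < e\<close> by (subst suminf_add[symmetric])
       (auto simp del: ennreal_suminf_cmult simp add: ennreal_mult[symmetric])
  also have "\<dots> = (\<Sum>n. outer_mass F (A n)) + e"
    unfolding ennreal_suminf_cmult
    by (subst suminf_ennreal_eq[OF zero_le_power power_half_series]) auto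
  finally show "outer_mass F (\<Union>i. A i) \<le> (\<Sum>n. outer_mass F (A n)) + e" .
qed

definition dual_measure :: "('v \<Rightarrow>\<^sub>L real) \<Rightarrow> 'a measure" where
  "dual_measure F = measure_of UNIV (sets borel) (outer_mass F)"

lemma sets_dual_measure: "sets (dual_measure F) = sets borel"
  unfolding dual_measure_def by (metis sets.sets_measure_of_eq space_borel)

text \<open>Caratheodory's theorem: the measurable sets form a sigma-algebra, which contains the
  open sets by \<open>outer_mass_split\<close> and therefore all Borel sets.\<close>

lemma emeasure_dual_measure:
  assumes F: "tight F" and A: "A \<in> sets borel"
  shows "emeasure (dual_measure F) A = outer_mass F A"
proof -
  have pos: "outer_mass F {} = 0" by (simp add: outer_mass_open open_mass_empty)
  have oms: "outer_measure_space (Pow UNIV) (outer_mass F)"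
    unfolding outer_measure_space_def
    by (auto simp: positive_def pos increasing_def outer_mass_mono countably_subadditive_def outer_mass_subadditive[OF F])
  define L where "L = lambda_system UNIV (Pow UNIV) (outer_mass F)"
  have ms: "measure_space UNIV L (outer_mass F)"
    unfolding L_def by (rule sigma_algebra.caratheodory_lemma[OF sigma_algebra_Pow oms])
  have "U \<in> L" if U: "open U" for U
    unfolding L_def lambda_system_def
  proof (clarsimp, rule antisym)
    fix E :: "'a set"
    \<comment> \<open>By outer regularity it suffices to bound the left side by the mass of each
      open W containing E.\<close>
    show "outer_mass F (U \<inter> E) + outer_mass F ((UNIV - U) \<inter> E) \<le> outer_mass F E"
      unfolding outer_mass_def[of F E]
    proof (rule INF_greatest, clarify)
      fix W assume W: "open W" "E \<subseteq> W"
      have "outer_mass F (U \<inter> E) + outer_mass F ((UNIV - U) \<inter> E) \<le> outer_mass F (U \<inter> W) + outer_mass F (W - U)"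
        using W(2) by (intro add_mono outer_mass_mono) auto
      also have "\<dots> \<le> open_mass F W" by (rule outer_mass_split[OF W(1) U])
      finally show "outer_mass F (U \<inter> E) + outer_mass F ((UNIV - U) \<inter> E) \<le> open_mass F W" .
    qed
    \<comment> \<open>Padding with empty sets turns countable subadditivity into the case of two
      sets.\<close>
    let ?A = "\<lambda>i::nat. if i = 0 then U \<inter> E else if i = 1 then (UNIV - U) \<inter> E else {}"
    have "outer_mass F (\<Union>i. ?A i) \<le> (\<Sum>i. outer_mass F (?A i))" by (rule outer_mass_subadditive[OF F])
    also have "(\<Union>i. ?A i) = E" by (auto split: if_splits)
    also have "(\<Sum>i. outer_mass F (?A i)) = (\<Sum>i<2. outer_mass F (?A i))"
      by (rule suminf_finite) (auto simp: pos)
    also have "\<dots> = outer_mass F (U \<inter> E) + outer_mass F ((UNIV - U) \<inter> E)"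
      by (simp add: numeral_2_eq_2)
    finally show "outer_mass F E \<le> outer_mass F (U \<inter> E) + outer_mass F ((UNIV - U) \<inter> E)" .
  qed
  then have "sigma_sets UNIV {S. open S} \<subseteq> L"
    using ms by (intro sigma_algebra.sigma_sets_subset) (auto simp: measure_space_def)
  then have "sets borel \<subseteq> L" unfolding borel_def by (simp add: sets_measure_of)
  then have "measure_space UNIV (sets borel) (outer_mass F)"
    by (rule measure_down[OF ms, rotated]) (metis sets.sigma_algebra_axioms space_borel)
  then show ?thesis
    unfolding dual_measure_def using A
    by (intro emeasure_measure_of_sigma) (auto simp: measure_space_def)
qed

lemma emeasure_dual_measure_open:
  "tight F \<Longrightarrow> open U \<Longrightarrow> emeasure (dual_measure F) U = open_mass F U"
  by (simp add: emeasure_dual_measure outer_mass_open)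

lemma finite_dual_measure: "tight F \<Longrightarrow> finite_measure (dual_measure F)"
proof (rule finite_measureI)
  assume "tight F"
  then have "emeasure (dual_measure F) UNIV \<le> ennreal (norm F)"
    by (simp add: emeasure_dual_measure_open open_mass_le_norm)
  then show "emeasure (dual_measure F) (space (dual_measure F)) \<noteq> \<infinity>"
    by (auto simp: space_borel_sets[OF sets_dual_measure] top_unique)
qed

section \<open>The functional is dominated by its measure\<close>

lemma unit_form_le_measure:
  assumes F: "tight F" and U: "open U" and w: "w \<in> unit_forms U"
  shows "F w \<le> measure (dual_measure F) U"
proof -
  have "ennreal (F w) \<le> ennreal (measure (dual_measure F) U)"
    using open_mass_upper[OF w, of F] emeasure_dual_measure_open[OF F U]
    by (simp add: finite_measure.emeasure_eq_measure[OF finite_dual_measure[OF F]])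
  then show ?thesis by simp
qed

text \<open>Layer cake: \<open>f\<close> is sliced into layers of height \<open>e\<close>. Each
  layer divided by \<open>e\<close>, times \<open>v\<close>, is a unit form on a superlevel set and
  so contributes at most \<open>e\<close> times the measure of that set.\<close>

lemma dual_measure_bound_layers:
  fixes f :: "'a \<Rightarrow>\<^sub>C real"
  assumes F: "tight F" and f: "\<And>x. 0 \<le> f x" and v: "norm v \<le> 1" and e: "0 < e"
  shows "F (smult f v) \<le> (\<integral>x. f x \<partial>dual_measure F) + 2 * e * measure (dual_measure F) UNIV"
proof -
  let ?M = "dual_measure F"
  interpret finite_measure ?M by (rule finite_dual_measure[OF F])
  note sM = sets_dual_measure[of F]
  have cf: "continuous_on UNIV (apply_bcontfun f)" by simp
  \<comment> \<open>N layers of height e exhaust f.\<close>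
  obtain N :: nat where N: "norm f / e \<le> real N" using real_arch_simple by blast
  define g where "g i x = max 0 (min e (f x - real i * e))" for i x
  define G where "G i = Bcontfun (g i)" for i
  have G: "apply_bcontfun (G i) = g i" for i
    unfolding G_def g_def by (rule apply_Bcontfun_bounded[where B = e]) (use e in \<open>auto intro!: continuous_intros\<close>)
  \<comment> \<open>The threshold is one layer below the foot of layer i, which leaves room for a
    reproducing function supported in \<open>U i\<close>. For i = 0 the set is the whole space,
    since f is nonnegative.\<close>
  define U where "U i = {x. f x > (real i - 1) * e}" for i :: nat
  have Uo: "open (U i)" for i unfolding U_def by (intro open_Collect_less continuous_intros cf)
  have UM [measurable]: "U i \<in> sets ?M" for i using Uo by (simp add: sM)
  have layer: "F (smult (G i) v) \<le> e * measure ?M (U i)" for i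
  proof -
    \<comment> \<open>As a function of the value of f, this is 0 up to (i-1/2)e and 1 from ie on,
      where layer i begins.\<close>
    define k where "k = Bcontfun (\<lambda>x. max 0 (min 1 (2 * (f x - (real i - 1) * e) / e - 1)))"
    have k: "k x = max 0 (min 1 (2 * (f x - (real i - 1) * e) / e - 1))" for x
      unfolding k_def by (subst apply_Bcontfun_bounded[where B = 1]) (use e in \<open>auto intro!: continuous_intros\<close>)
    have "(1 / e) *\<^sub>R smult (G i) v \<in> unit_forms (U i)"
    proof (rule unit_formsI[where k = k])
      have "norm ((1/e) *\<^sub>R G i) \<le> 1"
        by (rule norm_01) (use e in \<open>auto simp: G g_def divide_le_eq\<close>)
      then show "norm ((1 / e) *\<^sub>R smult (G i) v) \<le> 1"
        using norm_smult_le_norm[of "(1/e) *\<^sub>R G i" v] v unfolding smult_scale_left by linarith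
      have "cb_supp k \<subseteq> {x. (real i - 1) * e + e / 2 \<le> f x}"
      proof (rule cb_supp_subsetI)
        show "closed {x. (real i - 1) * e + e / 2 \<le> f x}"
          by (intro closed_Collect_le continuous_intros cf)
        fix x assume "k x \<noteq> 0"
        then have "0 < 2 * (f x - (real i - 1) * e) / e - 1" unfolding k by (auto simp: max_def split: if_splits)
        then have "e < 2 * (f x - (real i - 1) * e)" using e by (simp add: less_divide_eq)
        then show "x \<in> {x. (real i - 1) * e + e / 2 \<le> f x}" by simp
      qed
      also have "\<dots> \<subseteq> U i" unfolding U_def using e by auto
      finally show "cb_supp k \<subseteq> U i" .
      show "0 \<le> k x" "k x \<le> 1" for x by (auto simp: k)
      have "k \<odot> G i = G i"
      proof (rule bcontfun_eqI)
        fix x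
        show "(k \<odot> G i) x = G i x"
        proof (cases "G i x = 0")
          case False
          then have "real i * e \<le> f x" unfolding G g_def by (auto simp: max_def min_def split: if_splits)
          then have "2 * e \<le> 2 * (f x - (real i - 1) * e)" by (simp add: algebra_simps)
          then have "2 \<le> 2 * (f x - (real i - 1) * e) / e" using e by (simp add: le_divide_eq)
          then show ?thesis by (simp add: k)
        qed simp
      qed
      then show "smult k ((1 / e) *\<^sub>R smult (G i) v) = (1 / e) *\<^sub>R smult (G i) v"
        by (simp add: smult_scale_right smult_smult)
    qed
    from unit_form_le_measure[OF F Uo this] show ?thesis
      using e by (simp add: blinfun.scaleR_right divide_le_eq mult.commute)
  qed
  have layer_sum: "(\<Sum>i<n. g i x) = min (f x) (real n * e)" for n x
  proof (induction n)
    case (Suc n)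
    have "real (Suc n) * e = real n * e + e" by (simp add: algebra_simps)
    with Suc show ?case using e f[of x] by (simp add: g_def del: of_nat_Suc)
  qed (use f in simp)
  have split: "smult f v = (\<Sum>i<N. smult (G i) v)"
  proof -
    define H where "H n = (\<Sum>i<n. G i)" for n
    have "smult (H n) v = (\<Sum>i<n. smult (G i) v)" for n
      by (induction n) (simp_all add: H_def smult_add_left)
    moreover have "H n x = (\<Sum>i<n. g i x)" for n x
      by (induction n) (simp_all add: H_def G)
    moreover have "min (f x) (real N * e) = f x" for x
      using N e abs_bcontfun_le[of f x] by (simp add: divide_le_eq)
    ultimately have "H N = f" by (intro bcontfun_eqI) (simp add: layer_sum)
    with \<open>\<And>n. smult (H n) v = (\<Sum>i<n. smult (G i) v)\<close> show ?thesis by metis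
  qed
  \<comment> \<open>Carrying both bounds in the minimum closes the induction: if x is in
    \<open>U n\<close>, then n e < f x + e, and the old sum is at most n e.\<close>
  have count: "(\<Sum>i<n. e * indicator (U i) x) \<le> min (real n * e) (f x + 2 * e)" for n x
  proof (induction n)
    case 0
    then show ?case using f[of x] e by simp
  next
    case (Suc n)
    have eq: "(\<Sum>i<Suc n. e * indicator (U i) x) = (\<Sum>i<n. e * indicator (U i) x) + e * indicator (U n) x"
      by (rule sum.lessThan_Suc)
    have eq': "real (Suc n) * e = real n * e + e" by (simp add: algebra_simps)
    show ?case
    proof (cases "x \<in> U n")
      case True
      then have "real n * e < f x + e" "e * indicator (U n) x = e" by (auto simp: U_def algebra_simps)
      then show ?thesis using Suc.IH unfolding eq eq' by linarith
    next
      case False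
      then have "e * indicator (U n) x = 0" by simp
      then show ?thesis using Suc.IH e unfolding eq eq' by linarith
    qed
  qed
  have "F (smult f v) = (\<Sum>i<N. F (smult (G i) v))" by (simp add: split blinfun.sum_right)
  also have "\<dots> \<le> (\<Sum>i<N. e * measure ?M (U i))" by (rule sum_mono) (rule layer)
  also have "\<dots> = (\<integral>x. (\<Sum>i<N. e * indicator (U i) x) \<partial>?M)"
    by (subst Bochner_Integration.integral_sum) (auto simp: emeasure_eq_measure)
  also have "\<dots> \<le> (\<integral>x. f x + 2 * e \<partial>?M)"
  proof (rule integral_mono)
    show "integrable ?M (\<lambda>x. \<Sum>i<N. e * indicator (U i) x)"
      by (intro Bochner_Integration.integrable_sum integrable_mult_right) (auto simp: emeasure_eq_measure)
    show "integrable ?M (\<lambda>x. f x + 2 * e)"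
      by (intro Bochner_Integration.integrable_add cb_integrable sM finite_measure_axioms integrable_const)
    show "(\<Sum>i<N. e * indicator (U i) x) \<le> f x + 2 * e" for x using count[where n = N and x = x] by simp
  qed
  also have "\<dots> = (\<integral>x. f x \<partial>?M) + 2 * e * measure ?M UNIV"
    by (subst Bochner_Integration.integral_add)
      (auto intro!: cb_integrable finite_measure_axioms simp: sM space_borel_sets[OF sM])
  finally show ?thesis .
qed

text \<open>Let the layer height tend to 0, normalize v, and apply the one-sided bound to the unit
  vector and to its negative.\<close>

lemma dual_measure_bound_nonneg:
  fixes f :: "'a \<Rightarrow>\<^sub>C real"
  assumes F: "tight F" and f: "\<And>x. 0 \<le> f x"
  shows "\<bar>F (smult f v)\<bar> \<le> norm v * (\<integral>x. f x \<partial>dual_measure F)"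
proof -
  let ?M = "dual_measure F"
  have unit: "F (smult f v) \<le> (\<integral>x. f x \<partial>?M)" if v: "norm v \<le> 1" for v
  proof (rule field_le_epsilon)
    fix r :: real assume r: "0 < r"
    \<comment> \<open>The added 1 keeps the denominator positive when the measure is zero.\<close>
    define e where "e = r / (2 * measure ?M UNIV + 1)"
    have m: "0 < 2 * measure ?M UNIV + 1" using measure_nonneg[of ?M UNIV] by linarith
    then have e: "0 < e" using r by (simp add: e_def)
    have "2 * e * measure ?M UNIV \<le> e * (2 * measure ?M UNIV + 1)" using e by (simp add: algebra_simps)
    also have "\<dots> = r" using m by (simp add: e_def)
    finally show "F (smult f v) \<le> (\<integral>x. f x \<partial>?M) + r"
      using dual_measure_bound_layers[OF F f v e] by linarith
  qed
  show ?thesis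
  proof (cases "v = 0")
    case False
    define u where "u = (1 / norm v) *\<^sub>R v"
    have u: "v = norm v *\<^sub>R u" "norm u \<le> 1" using False by (auto simp: u_def)
    have "F (smult f u) \<le> (\<integral>x. f x \<partial>?M)" "- F (smult f u) \<le> (\<integral>x. f x \<partial>?M)"
      using unit[of u] unit[of "(-1) *\<^sub>R u"] u(2)
      by (simp_all only: smult_scale_right blinfun.scaleR_right norm_scaleR) simp_all
    then have "norm v * \<bar>F (smult f u)\<bar> \<le> norm v * (\<integral>x. f x \<partial>?M)"
      by (intro mult_left_mono) auto
    moreover have "F (smult f v) = norm v * F (smult f u)"
      by (subst u(1)) (simp add: smult_scale_right blinfun.scaleR_right)
    ultimately show ?thesis by (simp add: abs_mult)
  qed (simp add: blinfun.zero_right)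
qed

text \<open>Splitting \<open>f\<close> into positive and negative parts loses nothing, as their
  integrals add up to that of its absolute value.\<close>

lemma dual_measure_bound:
  assumes F: "tight F"
  shows "\<bar>F (smult f v)\<bar> \<le> norm v * (\<integral>x. \<bar>f x\<bar> \<partial>dual_measure F)"
proof -
  let ?M = "dual_measure F"
  define p where "p = Bcontfun (\<lambda>x. max 0 (f x))"
  define q where "q = Bcontfun (\<lambda>x. max 0 (- f x))"
  have b: "\<bar>max 0 (f x)\<bar> \<le> norm f" "\<bar>max 0 (- f x)\<bar> \<le> norm f" for x
    using abs_bcontfun_le[of f x] by auto
  have p: "p x = max 0 (f x)" and q: "q x = max 0 (- f x)" for x
    unfolding p_def q_def using b
    by (subst apply_Bcontfun_bounded[where B = "norm f"]; auto intro!: continuous_intros)+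
  have "f = p - q" by (rule bcontfun_eqI) (simp add: p q)
  then have "F (smult f v) = F (smult p v) - F (smult q v)"
    by (simp add: smult_diff_left blinfun.diff_right)
  moreover have "\<bar>F (smult p v)\<bar> \<le> norm v * (\<integral>x. p x \<partial>?M)" "\<bar>F (smult q v)\<bar> \<le> norm v * (\<integral>x. q x \<partial>?M)"
    by (rule dual_measure_bound_nonneg[OF F]; simp add: p q)+
  moreover have "(\<integral>x. p x \<partial>?M) + (\<integral>x. q x \<partial>?M) = (\<integral>x. \<bar>f x\<bar> \<partial>?M)"
  proof -
    have "(\<integral>x. p x \<partial>?M) + (\<integral>x. q x \<partial>?M) = (\<integral>x. p x + q x \<partial>?M)"
      by (rule Bochner_Integration.integral_add[symmetric])
        (intro cb_integrable finite_dual_measure[OF F] sets_dual_measure)+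
    also have "\<dots> = (\<integral>x. \<bar>f x\<bar> \<partial>?M)" by (rule Bochner_Integration.integral_cong) (auto simp: p q)
    finally show ?thesis .
  qed
  then have "norm v * (\<integral>x. \<bar>f x\<bar> \<partial>?M) = norm v * (\<integral>x. p x \<partial>?M) + norm v * (\<integral>x. q x \<partial>?M)"
    by (simp add: distrib_left[symmetric])
  ultimately show ?thesis by linarith
qed

section \<open>Local vector measures\<close>

context
  fixes N assumes N: "local_vector_measure N"
begin

lemma lvm_sums:
  "range A \<subseteq> sets borel \<Longrightarrow> disjoint_family A \<Longrightarrow> (\<lambda>i::nat. N (A i)) sums N (\<Union>i. A i)"
  using N unfolding local_vector_measure_def by blast

lemma lvm_null_open: "open A \<Longrightarrow> local_norm A v = 0 \<Longrightarrow> N A v = 0"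
  using N unfolding local_vector_measure_def by blast

text \<open>The constant sequence of empty sets is disjoint, and the terms of a convergent series
  tend to 0.\<close>

lemma lvm_empty: "N {} = 0"
proof -
  have "(\<lambda>i::nat. N {}) sums N {}" using lvm_sums[of "\<lambda>_. {}"] by (simp add: disjoint_family_on_def)
  then have "(\<lambda>i::nat. N {}) \<longlonglongrightarrow> 0" by (intro summable_LIMSEQ_zero) (rule sums_summable)
  then show ?thesis by (simp add: LIMSEQ_const_iff)
qed

lemma lvm_Un:
  assumes "A \<in> sets borel" "B \<in> sets borel" "A \<inter> B = {}"
  shows "N (A \<union> B) = N A + N B"
proof -
  let ?A = "\<lambda>i::nat. if i = 0 then A else if i = 1 then B else {}"
  have "(\<lambda>i. N (?A i)) sums N (\<Union>i. ?A i)"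
    using assms by (intro lvm_sums) (auto simp: disjoint_family_on_def)
  moreover have "(\<lambda>i. N (?A i)) sums (\<Sum>i<2. N (?A i))"
    by (rule sums_finite) (auto simp: lvm_empty)
  moreover have "(\<Union>i. ?A i) = A \<union> B" by (auto split: if_splits)
  ultimately show ?thesis using sums_unique2 by (fastforce simp: numeral_2_eq_2)
qed

lemma lvm_split: "A \<in> sets borel \<Longrightarrow> B \<in> sets borel \<Longrightarrow> N A = N (A \<inter> B) + N (A - B)"
  using lvm_Un[of "A \<inter> B" "A - B"] by (simp add: Int_Diff_Un Int_Diff_disjoint)

lemma lvm_Compl: "A \<in> sets borel \<Longrightarrow> N (- A) = N UNIV - N A"
  using lvm_split[of UNIV A] by (simp add: Compl_eq_Diff_UNIV)

text \<open>The successive differences partition \<open>A 0\<close>, and their series telescopes;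
  the convergence is in the dual norm.\<close>

lemma lvm_decseq:
  assumes A: "\<And>n. A n \<in> sets borel" "decseq A" "(\<Inter>n. A n) = {}"
  shows "(\<lambda>n. N (A n)) \<longlonglongrightarrow> 0"
proof -
  have sub: "A m \<subseteq> A n" if "n \<le> m" for n m using A(2) that by (rule decseqD)
  let ?D = "\<lambda>i. A i - A (Suc i)"
  have disj: "disjoint_family ?D"
    unfolding disjoint_family_on_def
  proof (intro ballI impI)
    fix m n :: nat assume "m \<noteq> n"
    then consider "Suc m \<le> n" | "Suc n \<le> m" by linarith
    then show "?D m \<inter> ?D n = {}" by cases (use sub in blast)+
  qed
  have U: "(\<Union>i. ?D i) = A 0"
  proof
    show "(\<Union>i. ?D i) \<subseteq> A 0" using sub[of 0] by auto
    show "A 0 \<subseteq> (\<Union>i. ?D i)"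
    proof
      fix x assume x: "x \<in> A 0"
      show "x \<in> (\<Union>i. ?D i)"
      proof (rule ccontr)
        assume *: "x \<notin> (\<Union>i. ?D i)"
        have "x \<in> A n" for n by (induction n) (use x * in auto)
        then show False using A(3) by auto
      qed
    qed
  qed
  have "(\<lambda>i. N (?D i)) sums N (A 0)"
    using lvm_sums[OF _ disj] A(1) U by auto
  then have l: "(\<lambda>n. \<Sum>i<n. N (?D i)) \<longlonglongrightarrow> N (A 0)" by (simp add: sums_def)
  have tel: "(\<Sum>i<n. N (?D i)) = N (A 0) - N (A n)" for n
  proof (induction n)
    case (Suc n)
    have "N (A n) = N (A (Suc n)) + N (?D n)"
      using lvm_split[OF A(1)[of n] A(1)[of "Suc n"]] sub[of n "Suc n"] by (simp add: Int_absorb1)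
    with Suc show ?case by simp
  qed simp
  show ?thesis using tendsto_diff[OF tendsto_const l, of "N (A 0)"] unfolding tel by simp
qed

text \<open>The locality axiom concerns open sets only; Dynkin induction extends it to all Borel
  subsets of an open set on which v has local norm zero.\<close>

lemma lvm_null:
  assumes B: "open B" "local_norm B v = 0" and E: "E \<in> sets borel"
  shows "N (E \<inter> B) v = 0"
  using E
proof (induction E rule: borel_induct_disjoint)
  case (basic U)
  then show ?case using B by (intro lvm_null_open open_Int local_norm_zero_mono[OF B(2)]) auto
next
  case (compl A)
  have "N B = N (B \<inter> A) + N (B - A)" using compl B by (intro lvm_split) auto
  moreover have "N B v = 0" by (rule lvm_null_open[OF B])
  ultimately have "N (B - A) v = 0" using compl by (simp add: Int_commute blinfun.add_left)
  moreover have "- A \<inter> B = B - A" by blast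
  ultimately show ?case by simp
next
  case (union A)
  have "(\<lambda>i. N (A i \<inter> B)) sums N (\<Union>i. A i \<inter> B)"
    using union B by (intro lvm_sums) (auto simp: disjoint_family_on_def)
  then have "(\<lambda>i. N (A i \<inter> B) v) sums N (\<Union>i. A i \<inter> B) v"
    by (rule bounded_linear.sums[OF blinfun.bounded_linear_left])
  then have "(\<lambda>i. 0) sums N ((\<Union>i. A i) \<inter> B) v" using union by simp
  then show ?case using sums_unique2[OF _ sums_zero] by blast
qed

text \<open>The complement of A is contained in the open set -C, where v has local norm
  zero.\<close>

lemma lvm_supp_in: "A \<in> sets borel \<Longrightarrow> supp_in v A \<Longrightarrow> N A v = N UNIV v"
proof -
  assume A: "A \<in> sets borel" and "supp_in v A"
  then obtain C where C: "C \<subseteq> A" "closed C" "local_norm (- C) v = 0" by (auto simp: supp_in_def)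
  have "N (- A \<inter> - C) v = 0" using A C by (intro lvm_null) auto
  moreover have "- A \<inter> - C = - A" using C(1) by blast
  ultimately have "N (- A) v = 0" by simp
  then show ?thesis using lvm_Compl[OF A] by (simp add: blinfun.diff_left)
qed

text \<open>Split at \<open>{\<phi> n \<ge> e}\<close>: these sets decrease to the empty set, and on the complement \<open>\<phi> n = min (\<phi> n) e\<close>.\<close>

lemma lvm_tendsto_0:
  fixes \<phi> :: "nat \<Rightarrow> 'a \<Rightarrow>\<^sub>C real"
  assumes E: "E \<in> sets borel" and pos: "\<And>n x. 0 \<le> \<phi> n x" and dec: "\<And>x. decseq (\<lambda>n. \<phi> n x)"
    and lim: "\<And>x. x \<in> E \<Longrightarrow> (\<lambda>n. \<phi> n x) \<longlonglongrightarrow> 0"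
  shows "(\<lambda>n. N E (smult (\<phi> n) v)) \<longlonglongrightarrow> 0"
proof (rule LIMSEQ_I)
  fix r :: real assume r: "0 < r"
  \<comment> \<open>Chosen so that the part where \<open>\<phi> n\<close> is below e costs at most
    r/2, up to a term governed by \<open>N (A n)\<close>, which tends to 0.\<close>
  define e where "e = r / (2 * (norm (N E) * norm v + 1))"
  have d: "0 < norm (N E) * norm v + 1" by (simp add: add_nonneg_pos)
  then have e: "0 < e" using r by (simp add: e_def)
  have NEe: "norm (N E) * (e * norm v) \<le> r / 2"
  proof -
    have "norm (N E) * (e * norm v) \<le> e * (norm (N E) * norm v + 1)" using e by (simp add: algebra_simps)
    also have "\<dots> = r / 2" using d by (simp add: e_def field_simps)
    finally show ?thesis .
  qed
  define A where "A n = E \<inter> {x. e \<le> \<phi> n x}" for n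
  have Ab: "A n \<in> sets borel" for n
    unfolding A_def by (intro sets.Int E borel_closed closed_Collect_le continuous_intros) auto
  have "(\<lambda>n. N (A n)) \<longlonglongrightarrow> 0"
  proof (rule lvm_decseq[OF Ab])
    show "decseq A"
      unfolding A_def using dec by (auto simp: decseq_def intro: order_trans)
    show "(\<Inter>n. A n) = {}"
    proof (rule ccontr)
      assume "(\<Inter>n. A n) \<noteq> {}"
      then obtain x where x: "\<And>n. x \<in> A n" by blast
      then have "e \<le> 0" using lim[of x] by (intro LIMSEQ_le_const[of "\<lambda>n. \<phi> n x"]) (auto simp: A_def)
      then show False using e by simp
    qed
  qed
  then have "(\<lambda>n. norm (N (A n)) * (norm (\<phi> 0) * norm v + e * norm v)) \<longlonglongrightarrow> 0 * (norm (\<phi> 0) * norm v + e * norm v)"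
    by (intro tendsto_mult tendsto_const tendsto_norm_zero)
  then have "\<forall>\<^sub>F n in sequentially. norm (N (A n)) * (norm (\<phi> 0) * norm v + e * norm v) < r / 2"
    using r by (intro order_tendstoD(2)) auto
  then obtain n0 where n0: "\<And>n. n \<ge> n0 \<Longrightarrow> norm (N (A n)) * (norm (\<phi> 0) * norm v + e * norm v) < r / 2"
    by (auto simp: eventually_sequentially)
  have "norm (N E (smult (\<phi> n) v) - 0) < r" if n: "n \<ge> n0" for n
  proof -
    let ?B = "{x. \<phi> n x < e}"
    have Bo: "open ?B" by (intro open_Collect_less continuous_intros) auto
    have EB: "E - A n = E \<inter> ?B" by (auto simp: A_def)
    have "E \<inter> A n = A n" by (auto simp: A_def)
    then have split: "N E = N (A n) + N (E \<inter> ?B)"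
      using lvm_split[OF E Ab[of n]] EB by simp
    have min_e: "\<bar>min (\<phi> n x) e\<bar> \<le> e" for x using pos[of n x] e by linarith
    \<comment> \<open>Since \<psi> equals \<open>\<phi> n\<close> on the open set \<open>?B\<close>,
      \<open>lvm_null\<close> allows the replacement, and the norm of \<psi> is at most e on all of
      X.\<close>
    define \<psi> where "\<psi> = Bcontfun (\<lambda>x. min (\<phi> n x) e)"
    have \<psi>: "\<psi> x = min (\<phi> n x) e" for x
      unfolding \<psi>_def using min_e
      by (subst apply_Bcontfun_bounded[where B = e]) (auto intro!: continuous_intros)
    have "N (E \<inter> ?B) (smult (\<phi> n) v - smult \<psi> v) = 0"
      by (intro lvm_null Bo E local_norm_diff_zeroI) (simp add: \<psi>)
    then have "N (E \<inter> ?B) (smult (\<phi> n) v) = N (E \<inter> ?B) (smult \<psi> v)"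
      by (simp add: blinfun.diff_right)
    also have "\<bar>\<dots>\<bar> \<le> norm (N (E \<inter> ?B)) * (e * norm v)"
    proof -
      have "norm \<psi> \<le> e" by (rule norm_bcontfun_le) (simp add: \<psi> min_e)
      then have "norm (smult \<psi> v) \<le> e * norm v"
        using norm_smult_le[of \<psi> v] mult_right_mono[of "norm \<psi>" e "norm v"] by simp
      then show ?thesis by (rule abs_blinfun_le)
    qed
    also have "\<dots> \<le> (norm (N E) + norm (N (A n))) * (e * norm v)"
    proof -
      have "N (E \<inter> ?B) = N E - N (A n)" using split by simp
      then have "norm (N (E \<inter> ?B)) \<le> norm (N E) + norm (N (A n))" by (simp add: norm_triangle_ineq4)
      then show ?thesis using e by (intro mult_right_mono) auto
    qed
    finally have 2: "\<bar>N (E \<inter> ?B) (smult (\<phi> n) v)\<bar> \<le> (norm (N E) + norm (N (A n))) * (e * norm v)" .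
    have "norm (\<phi> n) \<le> norm (\<phi> 0)"
    proof (rule norm_bcontfun_le)
      fix x
      have "\<phi> n x \<le> \<phi> 0 x" using dec[of x] by (simp add: decseq_def)
      then show "\<bar>\<phi> n x\<bar> \<le> norm (\<phi> 0)" using pos[of n x] abs_bcontfun_le[of "\<phi> 0" x] by simp
    qed
    then have "norm (smult (\<phi> n) v) \<le> norm (\<phi> 0) * norm v"
      using norm_smult_le[of "\<phi> n" v] mult_right_mono[of "norm (\<phi> n)" "norm (\<phi> 0)" "norm v"] by simp
    then have 1: "\<bar>N (A n) (smult (\<phi> n) v)\<bar> \<le> norm (N (A n)) * (norm (\<phi> 0) * norm v)"
      by (rule abs_blinfun_le)
    have "N E (smult (\<phi> n) v) = N (A n) (smult (\<phi> n) v) + N (E \<inter> ?B) (smult (\<phi> n) v)"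
      by (simp add: split blinfun.add_left)
    then show ?thesis using 1 2 n0[OF n] NEe by (simp add: algebra_simps)
  qed
  then show "\<exists>no. \<forall>n\<ge>no. norm (N E (smult (\<phi> n) v) - 0) < r" by blast
qed

section \<open>Tightness and uniqueness of local vector measures\<close>

lemma lvm_tight: "tight (N UNIV)"
  unfolding tight_def
proof (intro allI impI)
  fix v and \<phi> :: "nat \<Rightarrow> 'a \<Rightarrow>\<^sub>C real"
  assume *: "\<forall>x. decseq (\<lambda>n. apply_bcontfun (\<phi> n) x) \<and> (\<lambda>n. apply_bcontfun (\<phi> n) x) \<longlonglongrightarrow> 0"
  then have "0 \<le> \<phi> n x" for n x using decseq_ge[of "\<lambda>n. \<phi> n x" 0 n] by blast
  then show "(\<lambda>n. N UNIV (smult (\<phi> n) v)) \<longlonglongrightarrow> 0" using * by (intro lvm_tendsto_0) auto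
qed

text \<open>The functions 1 - \<open>cutoff A k\<close> decrease everywhere but tend to 0 only on A;
  hence the form of \<open>lvm_tendsto_0\<close>, with convergence asked on E alone.\<close>

lemma lvm_cutoff:
  assumes A: "open A"
  shows "(\<lambda>k. N A (smult (cutoff A k) v)) \<longlonglongrightarrow> N A v"
proof -
  have "(\<lambda>k. N A (smult (const_bcontfun 1 - cutoff A k) v)) \<longlonglongrightarrow> 0"
  proof (rule lvm_tendsto_0)
    show "decseq (\<lambda>k. (const_bcontfun 1 - cutoff A k) x)" for x
      by (auto simp: decseq_def cutoff_mono)
    show "(\<lambda>k. (const_bcontfun 1 - cutoff A k) x) \<longlonglongrightarrow> 0" if "x \<in> A" for x
      using tendsto_diff[OF tendsto_const cutoff_tendsto[OF A], of 1 x] that by simp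
  qed (use A in \<open>auto simp: cutoff_bounds\<close>)
  then have "(\<lambda>k. N A v - N A (smult (cutoff A k) v)) \<longlonglongrightarrow> 0"
    by (simp add: smult_diff_left smult_one blinfun.diff_right)
  from tendsto_diff[OF tendsto_const this, of "N A v"] show ?thesis by simp
qed

end

text \<open>The vectors \<open>smult (cutoff A k) v\<close> are supported in A, so both measures
  agree on them and, in the limit, on every v. Dynkin induction passes from open to Borel
  sets.\<close>

lemma lvm_unique:
  assumes N: "local_vector_measure N" and N': "local_vector_measure N'"
    and eq: "\<And>A v. open A \<Longrightarrow> supp_in v A \<Longrightarrow> N' A v = N A v"
    and B: "B \<in> sets borel"
  shows "N' B = N B"
proof -
  have op: "N' A = N A" if A: "open A" for A
  proof (rule blinfun_eqI)
    fix v
    have "N' A (smult (cutoff A k) v) = N A (smult (cutoff A k) v)" for k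
      by (intro eq A supp_in_smult cutoff_supp)
    then show "N' A v = N A v"
      using lvm_cutoff[OF N A, of v] lvm_cutoff[OF N' A, of v] LIMSEQ_unique by simp
  qed
  show ?thesis using B
  proof (induction B rule: borel_induct_disjoint)
    case (compl A)
    then show ?case using op[of UNIV] by (simp add: lvm_Compl[OF N] lvm_Compl[OF N'])
  next
    case (union A)
    then show ?case using lvm_sums[OF N, of A] lvm_sums[OF N', of A] by (simp add: sums_unique2)
  qed (rule op)
qed

end

section \<open>Density of the bounded continuous functions\<close>

lemma integrable_indicator_finite:
  assumes "finite_measure \<mu>" "A \<in> sets \<mu>"
  shows "integrable \<mu> (indicator A :: _ \<Rightarrow> real)"
  using assms finite_measure.emeasure_finite[OF assms(1), of A] by (simp add: top.not_eq_extremum)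

lemma disjoint_indicator_sums_L1:
  fixes A :: "nat \<Rightarrow> 'a::metric_space set"
  assumes fin: "finite_measure \<mu>" and s: "sets \<mu> = sets borel"
    and A: "range A \<subseteq> sets borel" "disjoint_family A"
  shows "(\<lambda>n. \<integral>x. \<bar>indicator (\<Union>i. A i) x - (\<Sum>i<n. indicator (A i) x)\<bar> \<partial>\<mu>) \<longlonglongrightarrow> (0::real)"
proof -
  have sum: "(\<Sum>i<n. indicator (A i) x) = (indicator (\<Union>i<n. A i) x :: real)" for n x
    using A(2) by (intro indicator_UN_disjoint[symmetric]) (auto simp: disjoint_family_on_def)
  have [measurable]: "A i \<in> sets \<mu>" for i using A(1) by (auto simp: s)
  have "(\<lambda>n. \<integral>x. \<bar>indicator (\<Union>i. A i) x - indicator (\<Union>i<n. A i) x\<bar> \<partial>\<mu>) \<longlonglongrightarrow> (\<integral>x. (0::real) \<partial>\<mu>)"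
  proof (rule integral_dominated_convergence[where w = "\<lambda>_. 1"])
    show "integrable \<mu> (\<lambda>_. 1 :: real)" by (rule finite_measure.integrable_const[OF fin])
    have "(\<lambda>n. \<bar>indicator (\<Union>i. A i) x - indicator (\<Union>i<n. A i) x\<bar>) \<longlonglongrightarrow> \<bar>indicator (\<Union>i. A i) x - indicator (\<Union>i. A i) x :: real\<bar>" for x
      by (intro tendsto_rabs tendsto_diff tendsto_const LIMSEQ_indicator_UN)
    then show "AE x in \<mu>. (\<lambda>n. \<bar>indicator (\<Union>i. A i) x - indicator (\<Union>i<n. A i) x\<bar>) \<longlonglongrightarrow> (0::real)" by simp
    show "AE x in \<mu>. norm \<bar>indicator (\<Union>i. A i) x - indicator (\<Union>i<n. A i) x :: real\<bar> \<le> 1" for n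
      by (rule AE_I2) (auto simp: indicator_def)
  qed auto
  then show ?thesis by (simp add: sum)
qed

lemma cutoff_tendsto_L1:
  assumes fin: "finite_measure \<mu>" and s: "sets \<mu> = sets borel" and A: "open A"
  shows "(\<lambda>k. \<integral>x. \<bar>indicator A x - cutoff A k x\<bar> \<partial>\<mu>) \<longlonglongrightarrow> 0"
proof -
  have [measurable]: "A \<in> sets \<mu>" using A by (simp add: s)
  note [measurable] = cb_measurable[OF s]
  have "(\<lambda>k. \<integral>x. \<bar>indicator A x - cutoff A k x\<bar> \<partial>\<mu>) \<longlonglongrightarrow> (\<integral>x. (0::real) \<partial>\<mu>)"
  proof (rule integral_dominated_convergence[where w = "\<lambda>_. 1"])
    show "integrable \<mu> (\<lambda>_. 1 :: real)" by (rule finite_measure.integrable_const[OF fin])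
    have "(\<lambda>k. \<bar>indicator A x - cutoff A k x\<bar>) \<longlonglongrightarrow> \<bar>indicator A x - indicator A x\<bar>" for x
      by (intro tendsto_rabs tendsto_diff tendsto_const cutoff_tendsto A)
    then show "AE x in \<mu>. (\<lambda>k. \<bar>indicator A x - cutoff A k x\<bar>) \<longlonglongrightarrow> 0" by simp
    have "\<bar>indicator A x - cutoff A k x\<bar> \<le> 1" for k x
      using cutoff_bounds[of A k x] by (auto simp: indicator_def)
    then show "AE x in \<mu>. norm \<bar>indicator A x - cutoff A k x\<bar> \<le> 1" for k by simp
  qed auto
  then show ?thesis by simp
qed

text \<open>Each term gets the tolerance e/(n+1), which also covers n = 0.\<close>

lemma choose_small_sum:
  fixes \<phi> :: "nat \<Rightarrow> 'b \<Rightarrow> real"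
  assumes small: "\<And>i d. 0 < d \<Longrightarrow> \<exists>y. \<phi> i y < d" and e: "0 < e"
  shows "\<exists>g. (\<Sum>i<n. \<phi> i (g i)) < e"
proof -
  define d where "d = e / real (Suc n)"
  have d: "0 < d" using e by (simp add: d_def)
  then obtain g where g: "\<And>i. \<phi> i (g i) < d" using small by metis
  have "(\<Sum>i<n. \<phi> i (g i)) \<le> (\<Sum>i<n. d)" using g by (intro sum_mono) (auto intro: less_imp_le)
  also have "\<dots> < real (Suc n) * d" using d by (simp add: distrib_right)
  also have "\<dots> = e" by (simp add: d_def del: of_nat_Suc)
  finally show ?thesis by blast
qed

lemma indicator_sum_L1_le:
  fixes g :: "nat \<Rightarrow> 'a::metric_space \<Rightarrow>\<^sub>C real"
  assumes fin: "finite_measure \<mu>" and s: "sets \<mu> = sets borel"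
    and C: "C \<in> sets borel" and A: "range A \<subseteq> sets borel"
  shows "(\<integral>x. \<bar>indicator C x - (\<Sum>i<n. g i) x\<bar> \<partial>\<mu>) \<le>
    (\<integral>x. \<bar>indicator C x - (\<Sum>i<n. indicator (A i) x)\<bar> \<partial>\<mu>) + (\<Sum>i<n. \<integral>x. \<bar>indicator (A i) x - g i x\<bar> \<partial>\<mu>)"
proof -
  have Ab: "A i \<in> sets borel" for i using A by auto
  have ind: "integrable \<mu> (indicator B :: 'a \<Rightarrow> real)" if "B \<in> sets borel" for B
    using that by (intro integrable_indicator_finite[OF fin]) (simp add: s)
  have G: "(\<Sum>i<n. g i) x = (\<Sum>i<n. g i x)" for x by (induction n) simp_all
  have "(\<integral>x. \<bar>indicator C x - (\<Sum>i<n. g i) x\<bar> \<partial>\<mu>)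
      \<le> (\<integral>x. \<bar>indicator C x - (\<Sum>i<n. indicator (A i) x)\<bar> + (\<Sum>i<n. \<bar>indicator (A i) x - g i x\<bar>) \<partial>\<mu>)"
  proof (rule integral_mono)
    fix x
    have "\<bar>(\<Sum>i<n. indicator (A i) x) - (\<Sum>i<n. g i) x\<bar> \<le> (\<Sum>i<n. \<bar>indicator (A i) x - g i x\<bar>)"
      unfolding G sum_subtractf[symmetric] by (rule sum_abs)
    then show "\<bar>indicator C x - (\<Sum>i<n. g i) x\<bar>
        \<le> \<bar>indicator C x - (\<Sum>i<n. indicator (A i) x)\<bar> + (\<Sum>i<n. \<bar>indicator (A i) x - g i x\<bar>)"
      by linarith
  qed (intro Bochner_Integration.integrable_add Bochner_Integration.integrable_diff integrable_abs
      Bochner_Integration.integrable_sum ind C Ab cb_integrable[OF fin s])+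
  also have "\<dots> = (\<integral>x. \<bar>indicator C x - (\<Sum>i<n. indicator (A i) x)\<bar> \<partial>\<mu>)
      + (\<Sum>i<n. \<integral>x. \<bar>indicator (A i) x - g i x\<bar> \<partial>\<mu>)"
    by (subst Bochner_Integration.integral_add)
      (auto intro!: Bochner_Integration.integrable_diff integrable_abs Bochner_Integration.integrable_sum
        Bochner_Integration.integral_sum ind C Ab cb_integrable[OF fin s])
  finally show ?thesis .
qed

text \<open>Indicators that are L1-limits of bounded continuous functions include those of open
  sets, by cutoffs, and are stable under complements and countable disjoint unions.\<close>

lemma bcontfun_dense_L1:
  fixes \<mu> :: "'a::metric_space measure"
  assumes fin: "finite_measure \<mu>" and s: "sets \<mu> = sets borel" and A: "A \<in> sets borel" and e: "0 < e"
  shows "\<exists>g :: 'a \<Rightarrow>\<^sub>C real. (\<integral>x. \<bar>indicator A x - g x\<bar> \<partial>\<mu>) < e"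
  using A e
proof (induction A arbitrary: e rule: borel_induct_disjoint)
  case (basic U)
  have "\<forall>\<^sub>F k in sequentially. (\<integral>x. \<bar>indicator U x - cutoff U k x\<bar> \<partial>\<mu>) < e"
    by (rule order_tendstoD(2)[OF cutoff_tendsto_L1[OF fin s basic(1)] basic(2)])
  then show ?case by (auto simp: eventually_sequentially)
next
  case (compl A)
  then obtain g :: "'a \<Rightarrow>\<^sub>C real" where "(\<integral>x. \<bar>indicator A x - g x\<bar> \<partial>\<mu>) < e" by blast
  moreover have "\<bar>indicator (- A) x - (const_bcontfun 1 - g) x\<bar> = \<bar>indicator A x - g x\<bar>" for x
    by (auto simp: indicator_def)
  ultimately show ?case by (intro exI[of _ "const_bcontfun 1 - g"]) (simp only:)
next
  case (union A)
  have "\<forall>\<^sub>F n in sequentially. (\<integral>x. \<bar>indicator (\<Union>i. A i) x - (\<Sum>i<n. indicator (A i) x)\<bar> \<partial>\<mu>) < e / 2"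
    using union by (intro order_tendstoD(2)[OF disjoint_indicator_sums_L1[OF fin s]]) auto
  then obtain n where n: "(\<integral>x. \<bar>indicator (\<Union>i. A i) x - (\<Sum>i<n. indicator (A i) x)\<bar> \<partial>\<mu>) < e / 2"
    by (auto simp: eventually_sequentially)
  have "\<exists>g :: nat \<Rightarrow> 'a \<Rightarrow>\<^sub>C real. (\<Sum>i<n. \<integral>x. \<bar>indicator (A i) x - g i x\<bar> \<partial>\<mu>) < e / 2"
    by (rule choose_small_sum[OF union(3)]) (use union(4) in simp_all)
  then obtain g :: "nat \<Rightarrow> 'a \<Rightarrow>\<^sub>C real"
    where "(\<Sum>i<n. \<integral>x. \<bar>indicator (A i) x - g i x\<bar> \<partial>\<mu>) < e / 2" by blast
  moreover have "(\<Union>i. A i) \<in> sets borel" using union(2) by auto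
  ultimately have "(\<integral>x. \<bar>indicator (\<Union>i. A i) x - (\<Sum>i<n. g i) x\<bar> \<partial>\<mu>) < e"
    using indicator_sum_L1_le[OF fin s _ union(2), where C = "\<Union>i. A i" and n = n and g = g] n by linarith
  then show ?case by blast
qed

section \<open>Local vector measures from functionals of finite mass\<close>

context metric_cb_module
begin

context
  fixes F :: "'v \<Rightarrow>\<^sub>L real" and \<mu> :: "'a measure"
  assumes fin: "finite_measure \<mu>" and s: "sets \<mu> = sets borel"
    and bound: "\<And>g v. \<bar>F (smult g v)\<bar> \<le> norm v * (\<integral>x. \<bar>g x\<bar> \<partial>\<mu>)"
begin

text \<open>Dominated convergence, with the constant \<open>norm (\<phi> 0)\<close> as
  majorant.\<close>

lemma mass_bounded_tight: "tight F"
  unfolding tight_def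
proof (intro allI impI)
  fix v :: 'v and \<phi> :: "nat \<Rightarrow> 'a \<Rightarrow>\<^sub>C real"
  assume *: "\<forall>x. decseq (\<lambda>n. apply_bcontfun (\<phi> n) x) \<and> (\<lambda>n. apply_bcontfun (\<phi> n) x) \<longlonglongrightarrow> 0"
  have "\<bar>\<phi> n x\<bar> \<le> norm (\<phi> 0)" for n x
  proof -
    have "0 \<le> \<phi> n x" using * decseq_ge[of "\<lambda>n. \<phi> n x" 0 n] by blast
    moreover have "\<phi> n x \<le> \<phi> 0 x" using * by (simp add: decseq_def)
    ultimately show ?thesis using abs_bcontfun_le[of "\<phi> 0" x] by simp
  qed
  then have "(\<lambda>n. norm v * (\<integral>x. \<bar>\<phi> n x\<bar> \<partial>\<mu>)) \<longlonglongrightarrow> 0"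
    using * by (intro tendsto_mult_right_zero cb_integral_tendsto_0[OF fin s]) auto
  then show "(\<lambda>n. F (smult (\<phi> n) v)) \<longlonglongrightarrow> 0"
    by (rule Lim_null_comparison[rotated]) (simp add: bound)
qed

text \<open>The assignment from \<open>g\<close> to this functional is linear and 1-Lipschitz for
  the L1 norm of \<mu>; it is to be extended to indicators.\<close>

definition cb_restrict :: "('a \<Rightarrow>\<^sub>C real) \<Rightarrow> 'v \<Rightarrow>\<^sub>L real" where
  "cb_restrict g = Blinfun (\<lambda>v. F (smult g v))"

lemma cb_restrict_apply: "cb_restrict g v = F (smult g v)"
  unfolding cb_restrict_def
proof (subst bounded_linear_Blinfun_apply)
  show "bounded_linear (\<lambda>v. F (smult g v))"
    by (rule bounded_linear_intro[where K = "\<integral>x. \<bar>g x\<bar> \<partial>\<mu>"])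
      (simp_all add: smult_add_right smult_scale_right blinfun.add_right blinfun.scaleR_right bound)
qed simp

lemma norm_cb_restrict_diff: "norm (cb_restrict g - cb_restrict h) \<le> (\<integral>x. \<bar>g x - h x\<bar> \<partial>\<mu>)"
proof (rule norm_blinfun_bound)
  fix v
  show "norm ((cb_restrict g - cb_restrict h) v) \<le> (\<integral>x. \<bar>g x - h x\<bar> \<partial>\<mu>) * norm v"
    using bound[of "g - h" v]
    by (simp add: blinfun.diff_left cb_restrict_apply smult_diff_left blinfun.diff_right mult.commute)
qed simp

lemma cb_restrict_sum: "cb_restrict (\<Sum>i<n. g i) = (\<Sum>i<n::nat. cb_restrict (g i))"
  by (rule blinfun_eqI, induction n)
    (simp_all add: cb_restrict_apply blinfun.sum_left blinfun.add_left smult_add_left blinfun.add_right blinfun.zero_right)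

lemma integrable_indicator_diff_cb:
  fixes g :: "'a \<Rightarrow>\<^sub>C real"
  shows "A \<in> sets borel \<Longrightarrow> integrable \<mu> (\<lambda>x. \<bar>indicator A x - apply_bcontfun g x\<bar>)"
  by (intro integrable_abs Bochner_Integration.integrable_diff cb_integrable[OF fin s]
    integrable_indicator_finite[OF fin]) (simp add: s)

text \<open>Approximants of the indicator in L1 have restrictions that are Cauchy in the complete
  dual. By density, the inequality for all h determines the limit.\<close>

lemma cb_restrict_extension:
  assumes A: "A \<in> sets borel"
  shows "\<exists>X. \<forall>h. norm (X - cb_restrict h) \<le> (\<integral>x. \<bar>indicator A x - apply_bcontfun h x\<bar> \<partial>\<mu>)"
proof -
  have "\<exists>g :: 'a \<Rightarrow>\<^sub>C real. (\<integral>x. \<bar>indicator A x - g x\<bar> \<partial>\<mu>) < 1 / real (Suc k)" for k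
    by (rule bcontfun_dense_L1[OF fin s A]) simp
  then obtain G :: "nat \<Rightarrow> 'a \<Rightarrow>\<^sub>C real" where G: "\<And>k. (\<integral>x. \<bar>indicator A x - G k x\<bar> \<partial>\<mu>) < 1 / real (Suc k)"
    by metis
  have near: "norm (cb_restrict (G k) - cb_restrict h) \<le> 1 / real (Suc k) + (\<integral>x. \<bar>indicator A x - apply_bcontfun h x\<bar> \<partial>\<mu>)" for k h
  proof -
    have "norm (cb_restrict (G k) - cb_restrict h) \<le> (\<integral>x. \<bar>G k x - h x\<bar> \<partial>\<mu>)" by (rule norm_cb_restrict_diff)
    also have "\<dots> \<le> (\<integral>x. \<bar>indicator A x - G k x\<bar> + \<bar>indicator A x - h x\<bar> \<partial>\<mu>)"
      by (intro integral_mono Bochner_Integration.integrable_add integrable_indicator_diff_cb A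
        integrable_abs Bochner_Integration.integrable_diff cb_integrable[OF fin s]) linarith
    also have "\<dots> = (\<integral>x. \<bar>indicator A x - G k x\<bar> \<partial>\<mu>) + (\<integral>x. \<bar>indicator A x - h x\<bar> \<partial>\<mu>)"
      by (intro Bochner_Integration.integral_add integrable_indicator_diff_cb A)
    finally show ?thesis using G[of k] by linarith
  qed
  have "Cauchy (\<lambda>k. cb_restrict (G k))"
  proof (rule metric_CauchyI)
    fix e :: real assume e: "0 < e"
    obtain M where M: "inverse (real (Suc M)) < e / 2" using reals_Archimedean e by (metis half_gt_zero)
    have "dist (cb_restrict (G m)) (cb_restrict (G n)) < e" if "M \<le> m" "M \<le> n" for m n
    proof -
      have "1 / real (Suc m) \<le> 1 / real (Suc M)" "1 / real (Suc n) \<le> 1 / real (Suc M)"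
        using that by (auto intro!: divide_left_mono)
      then show ?thesis using near[of m "G n"] G[of n] M unfolding dist_norm inverse_eq_divide by linarith
    qed
    then show "\<exists>M. \<forall>m\<ge>M. \<forall>n\<ge>M. dist (cb_restrict (G m)) (cb_restrict (G n)) < e" by blast
  qed
  then obtain X where X: "(\<lambda>k. cb_restrict (G k)) \<longlonglongrightarrow> X"
    using Cauchy_convergent_iff convergent_def by blast
  have "norm (X - cb_restrict h) \<le> (\<integral>x. \<bar>indicator A x - apply_bcontfun h x\<bar> \<partial>\<mu>)" for h
  proof -
    have "(\<lambda>k. norm (cb_restrict (G k) - cb_restrict h)) \<longlonglongrightarrow> norm (X - cb_restrict h)"
      by (intro tendsto_norm tendsto_diff X tendsto_const)
    moreover have "(\<lambda>k. 1 / real (Suc k) + (\<integral>x. \<bar>indicator A x - apply_bcontfun h x\<bar> \<partial>\<mu>))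
        \<longlonglongrightarrow> 0 + (\<integral>x. \<bar>indicator A x - apply_bcontfun h x\<bar> \<partial>\<mu>)"
      by (intro tendsto_add lim_1_over_n[THEN LIMSEQ_Suc] tendsto_const)
    ultimately show ?thesis using near[of _ h] by (intro LIMSEQ_le) auto
  qed
  then show ?thesis by blast
qed

text \<open>\<open>N A\<close> is the extended restriction at the indicator of A. The inequality
  \<open>comb\<close> combines linearity and the L1 bound.\<close>

lemma lvm_exists:
  obtains N where "local_vector_measure N" "N UNIV = F"
    "\<And>A. A \<in> sets borel \<Longrightarrow> norm (N A) \<le> measure \<mu> A"
proof -
  define N where "N A = (SOME X. \<forall>h. norm (X - cb_restrict h) \<le> (\<integral>x. \<bar>indicator A x - apply_bcontfun h x\<bar> \<partial>\<mu>))" for A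
  have N: "norm (N A - cb_restrict h) \<le> (\<integral>x. \<bar>indicator A x - apply_bcontfun h x\<bar> \<partial>\<mu>)" if "A \<in> sets borel" for A h
    using someI_ex[OF cb_restrict_extension[OF that]] unfolding N_def by blast
  have comb: "norm (N C - (\<Sum>i<n. N (A i))) \<le> (\<integral>x. \<bar>indicator C x - (\<Sum>i<n. indicator (A i) x)\<bar> \<partial>\<mu>)"
    if C: "C \<in> sets borel" and A: "range A \<subseteq> sets borel" for C and A :: "nat \<Rightarrow> 'a set" and n
  proof (rule field_le_epsilon)
    let ?I = "\<integral>x. \<bar>indicator C x - (\<Sum>i<n. indicator (A i) x)\<bar> \<partial>\<mu>"
    fix e :: real assume e: "0 < e"
    have Ab: "A i \<in> sets borel" for i using A by auto
    have "\<exists>g :: nat \<Rightarrow> 'a \<Rightarrow>\<^sub>C real. (\<Sum>i<n. \<integral>x. \<bar>indicator (A i) x - g i x\<bar> \<partial>\<mu>) < e / 2"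
      by (rule choose_small_sum[OF bcontfun_dense_L1[OF fin s Ab]]) (use e in simp_all)
    then obtain g :: "nat \<Rightarrow> 'a \<Rightarrow>\<^sub>C real"
      where g: "(\<Sum>i<n. \<integral>x. \<bar>indicator (A i) x - g i x\<bar> \<partial>\<mu>) < e / 2" by blast
    define G where "G = (\<Sum>i<n. g i)"
    have 1: "norm (N C - cb_restrict G) \<le> ?I + e / 2"
      using N[OF C, of G] indicator_sum_L1_le[OF fin s C A, where n = n and g = g] g unfolding G_def by linarith
    have "norm ((\<Sum>i<n. N (A i)) - cb_restrict G) \<le> (\<Sum>i<n. norm (N (A i) - cb_restrict (g i)))"
      unfolding G_def cb_restrict_sum sum_subtractf[symmetric] by (rule norm_sum)
    also have "\<dots> \<le> (\<Sum>i<n. \<integral>x. \<bar>indicator (A i) x - g i x\<bar> \<partial>\<mu>)" by (intro sum_mono N Ab)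
    finally have "norm ((\<Sum>i<n. N (A i)) - cb_restrict G) \<le> e / 2" using g by linarith
    then show "norm (N C - (\<Sum>i<n. N (A i))) \<le> ?I + e"
      using 1 norm_triangle_ineq4[of "N C - cb_restrict G" "(\<Sum>i<n. N (A i)) - cb_restrict G"] by simp
  qed
  show ?thesis
  proof (rule that[of N])
    show "local_vector_measure N"
      unfolding local_vector_measure_def
    proof (intro conjI allI impI)
      fix A :: "nat \<Rightarrow> 'a set" assume "range A \<subseteq> sets borel \<and> disjoint_family A"
      then have A: "range A \<subseteq> sets borel" "disjoint_family A" by auto
      have U: "(\<Union>i. A i) \<in> sets borel" using A(1) by auto
      \<comment> \<open>Partial sums of indicators converge in L1, and \<open>comb\<close> turns
        this into norm convergence in the dual.\<close>
      have "(\<lambda>n. N (\<Union>i. A i) - (\<Sum>i<n. N (A i))) \<longlonglongrightarrow> 0"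
        by (rule Lim_null_comparison[OF _ disjoint_indicator_sums_L1[OF fin s A]])
          (intro always_eventually allI comb[OF U A(1)])
      then show "(\<lambda>i. N (A i)) sums N (\<Union>i. A i)"
        unfolding sums_def using tendsto_diff[OF tendsto_const, of "\<lambda>n. N (\<Union>i. A i) - (\<Sum>i<n. N (A i))" 0 sequentially "N (\<Union>i. A i)"]
        by simp
    next
      fix A v assume "open A \<and> local_norm A v = 0"
      then have A: "open A" "local_norm A v = 0" by auto
      have "norm (N A v) \<le> (\<integral>x. \<bar>indicator A x - cutoff A k x\<bar> \<partial>\<mu>) * norm v" for k
      proof -
        \<comment> \<open>A cutoff of A annihilates v, and the cutoffs tend to the indicator of A in
          L1.\<close>
        have "smult (cutoff A k) v = 0" using A cutoff_supp[OF A(1)] by (simp add: local_norm_zero_iff)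
        then have "N A v = (N A - cb_restrict (cutoff A k)) v"
          by (simp add: blinfun.diff_left cb_restrict_apply blinfun.zero_right)
        also have "norm \<dots> \<le> norm (N A - cb_restrict (cutoff A k)) * norm v" by (rule norm_blinfun)
        also have "\<dots> \<le> (\<integral>x. \<bar>indicator A x - cutoff A k x\<bar> \<partial>\<mu>) * norm v"
          using A by (intro mult_right_mono N) auto
        finally show ?thesis .
      qed
      moreover have "(\<lambda>k. (\<integral>x. \<bar>indicator A x - cutoff A k x\<bar> \<partial>\<mu>) * norm v) \<longlonglongrightarrow> 0 * norm v"
        by (intro tendsto_mult tendsto_const cutoff_tendsto_L1[OF fin s A(1)])
      ultimately have "norm (N A v) \<le> 0 * norm v" by (intro LIMSEQ_le_const) auto
      then show "N A v = 0" by simp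
    qed
    have "cb_restrict (const_bcontfun 1) = F"
      by (rule blinfun_eqI) (simp add: cb_restrict_apply smult_one)
    then show "N UNIV = F" using N[of UNIV "const_bcontfun 1"] by simp
    have "cb_restrict 0 = 0" by (rule blinfun_eqI) (simp add: cb_restrict_apply blinfun.zero_right)
    then show "norm (N A) \<le> measure \<mu> A" if "A \<in> sets borel" for A
      using N[OF that, of 0] that by (simp add: s space_borel_sets[OF s])
  qed
qed

end

end

section \<open>Extension of currents to the space of forms\<close>

text \<open>Bounded pointwise convergence implies L1 convergence for every finite Borel measure, so
  the notion does not depend on a current.\<close>

definition approximates :: "(nat \<Rightarrow> 'a::metric_space \<Rightarrow>\<^sub>C real) \<Rightarrow> ('a \<Rightarrow>\<^sub>C real) \<Rightarrow> bool" where
  "approximates G f \<longleftrightarrow> (\<forall>k. G k \<in> LIPb) \<and> (\<exists>B. \<forall>k x. \<bar>G k x\<bar> \<le> B) \<and> (\<forall>x. (\<lambda>k. G k x) \<longlonglongrightarrow> f x)"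

lemma approximates_exists: "\<exists>G. approximates G f"
proof -
  obtain F where "\<And>k. F k \<in> LIPb" "\<And>k x. \<bar>F k x\<bar> \<le> norm f" "\<And>x. (\<lambda>k. F k x) \<longlonglongrightarrow> f x"
    using Lip_approx[of f] by blast
  then show ?thesis unfolding approximates_def by blast
qed

lemma approximates_const: "f \<in> LIPb \<Longrightarrow> approximates (\<lambda>_. f) f"
  unfolding approximates_def using abs_bcontfun_le[of f] by auto

lemma approximates_linear:
  assumes "approximates G f" "approximates H g"
  shows "approximates (\<lambda>k. a *\<^sub>R G k + b *\<^sub>R H k) (a *\<^sub>R f + b *\<^sub>R g)"
proof -
  obtain B C where B: "\<And>k x. \<bar>G k x\<bar> \<le> B" "\<And>k x. \<bar>H k x\<bar> \<le> C"
    using assms unfolding approximates_def by blast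
  have "\<bar>(a *\<^sub>R G k + b *\<^sub>R H k) x\<bar> \<le> \<bar>a\<bar> * B + \<bar>b\<bar> * C" for k x
  proof -
    have "\<bar>a * G k x + b * H k x\<bar> \<le> \<bar>a\<bar> * \<bar>G k x\<bar> + \<bar>b\<bar> * \<bar>H k x\<bar>"
      by (metis abs_mult abs_triangle_ineq)
    also have "\<dots> \<le> \<bar>a\<bar> * B + \<bar>b\<bar> * C" by (intro add_mono mult_left_mono B) auto
    finally show ?thesis by simp
  qed
  then show ?thesis
    using assms unfolding approximates_def
    by (auto intro!: LIPb_add LIPb_scaleR tendsto_intros)
qed

lemma approximates_L1:
  assumes "approximates G f" "finite_measure \<mu>" "sets \<mu> = sets borel"
  shows "(\<lambda>k. \<integral>x. \<bar>(G k - f) x\<bar> \<partial>\<mu>) \<longlonglongrightarrow> 0"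
proof -
  obtain B where B: "\<And>k x. \<bar>G k x\<bar> \<le> B" using assms(1) unfolding approximates_def by blast
  show ?thesis
  proof (rule cb_integral_tendsto_0[OF assms(2,3), of _ "B + norm f"])
    show "\<bar>(G k - f) x\<bar> \<le> B + norm f" for k x
      using B[of k x] abs_bcontfun_le[of f x] by simp
    have "(\<lambda>k. G k x) \<longlonglongrightarrow> f x" for x using assms(1) unfolding approximates_def by blast
    then show "(\<lambda>k. (G k - f) x) \<longlonglongrightarrow> 0" for x by (simp add: LIM_zero)
  qed
qed

definition cb_extension :: "('a::metric_space, 'n) precurrent \<Rightarrow> ('a, 'n) precurrent" where
  "cb_extension T f \<pi> = lim (\<lambda>k. T ((SOME G. approximates G f) k) \<pi>)"

lemma cb_integral_triangle:
  fixes f g h :: "'a::metric_space \<Rightarrow>\<^sub>C real"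
  assumes "finite_measure \<mu>" "sets \<mu> = sets borel"
  shows "(\<integral>x. \<bar>(f - g) x\<bar> \<partial>\<mu>) \<le> (\<integral>x. \<bar>(f - h) x\<bar> \<partial>\<mu>) + (\<integral>x. \<bar>(g - h) x\<bar> \<partial>\<mu>)"
proof -
  note int = integrable_abs[OF cb_integrable[OF assms]]
  have "\<bar>(f - g) x\<bar> \<le> \<bar>(f - h) x\<bar> + \<bar>(g - h) x\<bar>" for x
    using abs_triangle_ineq4[of "(f - h) x" "(g - h) x"] by simp
  then have "(\<integral>x. \<bar>(f - g) x\<bar> \<partial>\<mu>) \<le> (\<integral>x. \<bar>(f - h) x\<bar> + \<bar>(g - h) x\<bar> \<partial>\<mu>)"
    by (intro integral_mono Bochner_Integration.integrable_add int)
  then show ?thesis by (simp only: Bochner_Integration.integral_add[OF int int])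
qed

context
  fixes T :: "('a::polish_space, 'n::finite) precurrent"
  assumes T: "current T"
begin

lemma current_linear1:
  "f \<in> LIPb \<Longrightarrow> g \<in> LIPb \<Longrightarrow> T (a *\<^sub>R f + b *\<^sub>R g) \<pi> = a * T f \<pi> + b * T g \<pi>"
  using T unfolding current_def multilinear_def by blast

lemma current_mass_le: "f \<in> LIPb \<Longrightarrow> \<bar>T f \<pi>\<bar> \<le> (\<Prod>j\<in>UNIV. Lip (\<pi> j)) * (\<integral>x. \<bar>f x\<bar> \<partial>mass T)"
  using current_mass_bound[OF T] unfolding mass_bound_def by blast

text \<open>The limit exists and is the same for all approximating sequences, so the choice made in
  \<open>cb_extension\<close> is immaterial.\<close>

lemma cb_extension_lim:
  assumes G: "approximates G f"
  shows "(\<lambda>k. T (G k) \<pi>) \<longlonglongrightarrow> cb_extension T f \<pi>"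
proof -
  note fin = finite_mass[OF T] and s = sets_mass[OF T]
  let ?L = "\<Prod>j\<in>UNIV. Lip (\<pi> j)"
  have L0: "0 \<le> ?L" by (intro prod_nonneg) auto
  define S where "S = (SOME G. approximates G f)"
  have S: "approximates S f" unfolding S_def using approximates_exists by (rule someI_ex)
  define d where "d H k = ?L * (\<integral>x. \<bar>(H k - f) x\<bar> \<partial>mass T)" for H :: "nat \<Rightarrow> 'a \<Rightarrow>\<^sub>C real" and k
  have d: "d H \<longlonglongrightarrow> 0" if "approximates H f" for H
    unfolding d_def by (intro tendsto_mult_right_zero approximates_L1[OF that fin s])
  \<comment> \<open>With H = K this gives the Cauchy property, with different sequences the
    independence of the choice.\<close>
  have close: "\<bar>T (H k) \<pi> - T (K l) \<pi>\<bar> \<le> d H k + d K l" if "approximates H f" "approximates K f" for H K k l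
  proof -
    have m: "H k \<in> LIPb" "K l \<in> LIPb" using that unfolding approximates_def by auto
    have "\<bar>T (H k) \<pi> - T (K l) \<pi>\<bar> = \<bar>T (H k - K l) \<pi>\<bar>"
      using T m by (simp add: multilinear_diff1 current_def)
    also have "\<dots> \<le> ?L * (\<integral>x. \<bar>(H k - K l) x\<bar> \<partial>mass T)" by (intro current_mass_le LIPb_diff m)
    also have "\<dots> \<le> ?L * ((\<integral>x. \<bar>(H k - f) x\<bar> \<partial>mass T) + (\<integral>x. \<bar>(K l - f) x\<bar> \<partial>mass T))"
      by (intro mult_left_mono cb_integral_triangle fin s L0)
    finally show ?thesis by (simp add: d_def distrib_left)
  qed
  have "Cauchy (\<lambda>k. T (S k) \<pi>)"
  proof (rule metric_CauchyI)
    fix e :: real assume "0 < e"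
    then have "\<forall>\<^sub>F k in sequentially. d S k < e / 2" by (intro order_tendstoD(2)[OF d[OF S]]) simp
    then obtain M where M: "\<And>k. M \<le> k \<Longrightarrow> d S k < e / 2" by (auto simp: eventually_sequentially)
    have "dist (T (S m) \<pi>) (T (S n) \<pi>) < e" if "M \<le> m" "M \<le> n" for m n
      using close[OF S S, of m n] M[OF that(1)] M[OF that(2)] unfolding dist_real_def by linarith
    then show "\<exists>M. \<forall>m\<ge>M. \<forall>n\<ge>M. dist (T (S m) \<pi>) (T (S n) \<pi>) < e" by blast
  qed
  then have l: "(\<lambda>k. T (S k) \<pi>) \<longlonglongrightarrow> cb_extension T f \<pi>"
    unfolding cb_extension_def S_def[symmetric] by (simp add: Cauchy_convergent_iff convergent_LIMSEQ_iff)
  have "(\<lambda>k. d G k + d S k) \<longlonglongrightarrow> 0 + 0" by (intro tendsto_add d G S)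
  then have "(\<lambda>k. d G k + d S k) \<longlonglongrightarrow> 0" by simp
  then have "(\<lambda>k. T (G k) \<pi> - T (S k) \<pi>) \<longlonglongrightarrow> 0"
    by (rule Lim_null_comparison[rotated]) (simp add: close[OF G S])
  from tendsto_add[OF this l] show ?thesis by simp
qed

lemma cb_extension_LIPb: "f \<in> LIPb \<Longrightarrow> cb_extension T f \<pi> = T f \<pi>"
  using cb_extension_lim[OF approximates_const, of f \<pi>] by (simp add: LIMSEQ_const_iff)

lemma cb_extension_linear1:
  "cb_extension T (a *\<^sub>R f + b *\<^sub>R g) \<pi> = a * cb_extension T f \<pi> + b * cb_extension T g \<pi>"
proof -
  obtain G H where G: "approximates G f" and H: "approximates H g" using approximates_exists by metis
  have "T (a *\<^sub>R G k + b *\<^sub>R H k) \<pi> = a * T (G k) \<pi> + b * T (H k) \<pi>" for k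
    using G H by (intro current_linear1) (auto simp: approximates_def)
  moreover have "(\<lambda>k. a * T (G k) \<pi> + b * T (H k) \<pi>) \<longlonglongrightarrow> a * cb_extension T f \<pi> + b * cb_extension T g \<pi>"
    by (intro tendsto_intros cb_extension_lim G H)
  ultimately show ?thesis
    using cb_extension_lim[OF approximates_linear[OF G H], of a b \<pi>] LIMSEQ_unique by simp
qed

lemma cb_extension_linear2:
  "cb_extension T f (\<pi>(j := a *\<^sub>R \<alpha> + b *\<^sub>R \<beta>)) =
     a * cb_extension T f (\<pi>(j := \<alpha>)) + b * cb_extension T f (\<pi>(j := \<beta>))"
proof -
  obtain G where G: "approximates G f" using approximates_exists by metis
  have "T (G k) (\<pi>(j := a *\<^sub>R \<alpha> + b *\<^sub>R \<beta>)) = a * T (G k) (\<pi>(j := \<alpha>)) + b * T (G k) (\<pi>(j := \<beta>))" for k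
    using T G unfolding current_def multilinear_def approximates_def by blast
  moreover have "(\<lambda>k. a * T (G k) (\<pi>(j := \<alpha>)) + b * T (G k) (\<pi>(j := \<beta>))) \<longlonglongrightarrow>
      a * cb_extension T f (\<pi>(j := \<alpha>)) + b * cb_extension T f (\<pi>(j := \<beta>))"
    by (intro tendsto_intros cb_extension_lim G)
  ultimately show ?thesis
    using cb_extension_lim[OF G, of "\<pi>(j := a *\<^sub>R \<alpha> + b *\<^sub>R \<beta>)"] LIMSEQ_unique by simp
qed

lemma cb_extension_alternating: "i \<noteq> j \<Longrightarrow> \<pi> i = \<pi> j \<Longrightarrow> cb_extension T f \<pi> = 0"
proof -
  assume ij: "i \<noteq> j" "\<pi> i = \<pi> j"
  obtain G where G: "approximates G f" using approximates_exists by metis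
  have "T (G k) \<pi> = 0" for k
    using G by (intro current_alternating[OF T _ ij]) (auto simp: approximates_def)
  then show ?thesis using cb_extension_lim[OF G, of \<pi>] by (simp add: LIMSEQ_const_iff)
qed

lemma cb_extension_bound:
  "\<bar>cb_extension T f \<pi>\<bar> \<le> (\<Prod>j\<in>UNIV. Lip (\<pi> j)) * (\<integral>x. \<bar>f x\<bar> \<partial>mass T)"
proof -
  note fin = finite_mass[OF T] and s = sets_mass[OF T]
  let ?L = "\<Prod>j\<in>UNIV. Lip (\<pi> j)"
  have L0: "0 \<le> ?L" by (intro prod_nonneg) auto
  obtain G where G: "approximates G f" using approximates_exists by metis
  have "\<bar>T (G k) \<pi>\<bar> \<le> ?L * ((\<integral>x. \<bar>(G k - f) x\<bar> \<partial>mass T) + (\<integral>x. \<bar>f x\<bar> \<partial>mass T))" for k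
  proof -
    have "(\<integral>x. \<bar>G k x\<bar> \<partial>mass T) \<le> (\<integral>x. \<bar>(G k - f) x\<bar> \<partial>mass T) + (\<integral>x. \<bar>f x\<bar> \<partial>mass T)"
      using cb_integral_triangle[OF fin s, of "G k" 0 f] by simp
    moreover have "\<bar>T (G k) \<pi>\<bar> \<le> ?L * (\<integral>x. \<bar>G k x\<bar> \<partial>mass T)"
      using G by (intro current_mass_le) (simp add: approximates_def)
    ultimately show ?thesis using L0 by (meson mult_left_mono order_trans)
  qed
  moreover have "(\<lambda>k. ?L * ((\<integral>x. \<bar>(G k - f) x\<bar> \<partial>mass T) + (\<integral>x. \<bar>f x\<bar> \<partial>mass T))) \<longlonglongrightarrow>
      ?L * (0 + (\<integral>x. \<bar>f x\<bar> \<partial>mass T))"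
    by (intro tendsto_intros approximates_L1[OF G fin s])
  ultimately have "\<bar>cb_extension T f \<pi>\<bar> \<le> ?L * (0 + (\<integral>x. \<bar>f x\<bar> \<partial>mass T))"
    using cb_extension_lim[OF G, of \<pi>] by (intro LIMSEQ_le[OF tendsto_rabs]) auto
  then show ?thesis by simp
qed

text \<open>The lift to the free space annihilates the relations, the alternating ones thanks to
  \<open>current_alternating\<close>, and so passes to the quotient.\<close>

lemma extends_exists: "\<exists>L. extends T L"
proof -
  define h where "h = free_lift (\<lambda>(f, \<pi>). cb_extension T f \<pi>)"
  have lin: "linear h" unfolding h_def by (rule linear_free_lift)
  have hg: "h (gen (f, \<pi>)) = cb_extension T f \<pi>" for f \<pi> by (simp add: h_def)
  have "h r = 0" if "r \<in> form_relations" for r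
    using that
  proof cases
    case (linear1 a f b g \<pi>)
    then show ?thesis by (simp add: linear_diff[OF lin] linear_scale[OF lin] hg cb_extension_linear1)
  next
    case (linear2 f \<pi> j a \<alpha> b \<beta>)
    then show ?thesis by (simp add: linear_diff[OF lin] linear_scale[OF lin] hg cb_extension_linear2)
  next
    case (alternating i j \<pi> f)
    then show ?thesis by (simp add: hg cb_extension_alternating)
  qed
  then have span: "h r = 0" if "r \<in> span form_relations" for r
    using linear_eq_0_on_span[OF lin _ that] by blast
  define L where "L v = h (rep_cform v)" for v
  have L: "L (abs_cform p) = h p" for p
  proof -
    have "form_rel (rep_cform (abs_cform p)) p"
      by (metis Quotient_cform Quotient_rel_abs2 Quotient_rep_reflp Quotient_abs_rep cform.abs_eq_iff)
    then have "h (rep_cform (abs_cform p) - p) = 0" by (intro span) (simp add: form_rel_def)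
    then show ?thesis by (simp add: L_def linear_diff[OF lin])
  qed
  have "linear L"
  proof (rule linearI)
    fix v w :: "('a, 'n) cform" and c :: real
    obtain p q where "v = abs_cform p" "w = abs_cform q" by (metis Quotient_cform Quotient_abs_rep)
    then show "L (v + w) = L v + L w" "L (c *\<^sub>R v) = c *\<^sub>R L v"
      by (simp_all add: plus_cform.abs_eq scaleR_cform.abs_eq L linear_add[OF lin] linear_scale[OF lin])
  qed
  moreover have "L (form f \<pi>) = cb_extension T f \<pi>" for f \<pi>
    by (simp add: form.abs_eq L hg)
  ultimately have "extends T L"
    unfolding extends_def by (simp add: cb_extension_LIPb cb_extension_bound)
  then show ?thesis by blast
qed

text \<open>The seminorm controls the functional by \<open>extends_le_mass\<close>, so it descends
  to the normed quotient. Applying the same estimate to the current restricted by \<open>g\<close>,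
  whose mass is at most the integral of its absolute value, gives the inequality.\<close>

lemma induces_exists:
  obtains F where "induces T F" "\<And>g v. \<bar>F (dform_mult g v)\<bar> \<le> norm v * (\<integral>x. \<bar>g x\<bar> \<partial>mass T)"
proof -
  obtain L where L: "extends T L" using extends_exists by blast
  have lin: "linear L" using L by (simp add: extends_def)
  have dex: "\<exists>w. v = abs_dform w" for v :: "('a, 'n) dform" by (metis Quotient_dform Quotient_abs_rep)
  define h where "h v = L (rep_dform v)" for v
  have h: "h (abs_dform w) = L w" for w
  proof -
    have "seminorm_rel (rep_dform (abs_dform w)) w"
      by (metis Quotient_dform Quotient_abs_rep dform.abs_eq_iff)
    then have "current_seminorm (rep_dform (abs_dform w) - w) = 0" by (simp add: seminorm_rel_def)
    then have "L (rep_dform (abs_dform w) - w) = 0"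
      using extends_le_mass[OF T L, of "rep_dform (abs_dform w) - w"] by simp
    then show ?thesis by (simp add: h_def linear_diff[OF lin])
  qed
  have "bounded_linear h"
  proof (rule bounded_linear_intro[where K = "measure (mass T) UNIV"])
    fix v w :: "('a, 'n) dform" and c :: real
    obtain p q where pq: "v = abs_dform p" "w = abs_dform q" using dex by metis
    then show "h (v + w) = h v + h w" "h (c *\<^sub>R v) = c *\<^sub>R h v"
      by (simp_all add: h linear_add[OF lin] linear_scale[OF lin]
        flip: linear_add[OF linear_abs_dform] linear_scale[OF linear_abs_dform])
    show "norm (h v) \<le> norm v * measure (mass T) UNIV"
      using extends_le_mass[OF T L, of p] by (simp add: pq h norm_dform.abs_eq mult.commute)
  qed
  then have F: "blinfun_apply (Blinfun h) = h" by (rule bounded_linear_Blinfun_apply)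
  have "induces T (Blinfun h)" unfolding induces_def using L by (simp add: F h)
  moreover have "\<bar>Blinfun h (dform_mult g v)\<bar> \<le> norm v * (\<integral>x. \<bar>g x\<bar> \<partial>mass T)" for g v
  proof -
    obtain w where w: "v = abs_dform w" using dex by blast
    note * = current_restrict[OF T L, of g]
    have "\<bar>L (cform_mult g w)\<bar> \<le> measure (mass (\<lambda>f \<pi>. L (form (g \<odot> f) \<pi>))) UNIV * current_seminorm w"
      by (rule extends_le_mass[OF *(1,2)])
    also have "\<dots> \<le> (\<integral>x. \<bar>g x\<bar> \<partial>mass T) * current_seminorm w"
      by (intro mult_right_mono *(3) current_seminorm_nonneg)
    finally show ?thesis
      by (simp add: F w dform_mult.abs_eq h norm_dform.abs_eq mult.commute)
  qed
  ultimately show ?thesis by (rule that)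
qed

end

section \<open>Tight functionals on the space of forms\<close>

interpretation D: metric_cb_module "dform_mult :: ('a::polish_space \<Rightarrow>\<^sub>C real) \<Rightarrow> ('a, 'n::finite) dform \<Rightarrow> _"
  by unfold_locales

section \<open>From tight functionals to currents\<close>

lemma elementary_form_mult: "elementary_form f \<pi> = dform_mult f (elementary_form (const_bcontfun 1) \<pi>)"
proof -
  have "f \<odot> const_bcontfun 1 = f" by (rule bcontfun_eqI) simp
  then show ?thesis by (simp add: elementary_form_def dform_mult.abs_eq)
qed

lemma norm_elementary_form_1:
  fixes \<pi> :: "'n::finite \<Rightarrow> 'a::polish_space lip"
  shows "norm (elementary_form (const_bcontfun 1) \<pi>) \<le> (\<Prod>j\<in>UNIV. Lip (\<pi> j))"
proof -
  have "current_seminorm (form (const_bcontfun 1) \<pi>) \<le> (\<Prod>j\<in>UNIV. Lip (\<pi> j)) * norm (const_bcontfun 1 :: 'a \<Rightarrow>\<^sub>C real)"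
    by (rule current_seminorm_least) (rule order_trans[OF abs_ge_self unit_functional_form])
  also have "\<dots> \<le> (\<Prod>j\<in>UNIV. Lip (\<pi> j)) * 1"
    by (intro mult_left_mono prod_nonneg norm_bcontfun_le) auto
  finally show ?thesis by (simp add: elementary_form_def norm_dform.abs_eq)
qed

lemma tight_elementary_form_bound:
  assumes "D.tight F"
  shows "\<bar>F (elementary_form f \<pi>)\<bar> \<le> (\<Prod>j\<in>UNIV. Lip (\<pi> j)) * (\<integral>x. \<bar>f x\<bar> \<partial>D.dual_measure F)"
proof -
  have "\<bar>F (elementary_form f \<pi>)\<bar> \<le> norm (elementary_form (const_bcontfun 1) \<pi>) * (\<integral>x. \<bar>f x\<bar> \<partial>D.dual_measure F)"
    by (subst elementary_form_mult) (rule D.dual_measure_bound[OF assms])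
  also have "\<dots> \<le> (\<Prod>j\<in>UNIV. Lip (\<pi> j)) * (\<integral>x. \<bar>f x\<bar> \<partial>D.dual_measure F)"
    by (intro mult_right_mono norm_elementary_form_1) simp
  finally show ?thesis .
qed

text \<open>All currents vanish on such a form, hence so does its norm. Axiom (iii) is thus built
  into the space of forms.\<close>

lemma elementary_form_local:
  assumes "f \<in> LIPb" "open U" "{x. apply_bcontfun f x \<noteq> 0} \<subseteq> U" "\<forall>x\<in>U. apply_lip (\<pi> j) x = c"
  shows "elementary_form f \<pi> = 0"
proof -
  have "L (form f \<pi>) = 0" if L: "L \<in> unit_functionals" for L
  proof -
    obtain T where T: "current T" "extends T L" using L by blast
    then have "T f \<pi> = 0" using assms unfolding current_def is_local_def by blast
    then show ?thesis using T(2) assms(1) by (simp add: extends_def)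
  qed
  then have "current_seminorm (form f \<pi>) \<le> 0" by (rule current_seminorm_least[OF eq_refl])
  then have "norm (elementary_form f \<pi>) = 0"
    using current_seminorm_nonneg[of "form f \<pi>"] by (simp add: elementary_form_def norm_dform.abs_eq)
  then show ?thesis by (simp only: norm_eq_zero)
qed

text \<open>Multilinearity and locality come from the space of forms and finite mass from
  \<open>dual_measure\<close>, so (ii) is the only axiom assumed.\<close>

lemma current_map_current:
  fixes F :: "('a::polish_space, 'n::finite) dform \<Rightarrow>\<^sub>L real"
  assumes tight: "D.tight F" and sc: "seq_continuous (current_map F)"
  shows "current (current_map F)"
  unfolding current_def
proof (intro conjI sc)
  show "multilinear (current_map F)"
    unfolding multilinear_def current_map_def elementary_form_def form_linear1 form_linear2
    by (simp add: linear_add[OF linear_abs_dform] linear_scale[OF linear_abs_dform]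
      blinfun.add_right blinfun.scaleR_right)
  show "\<exists>\<mu>. mass_bound (current_map F) \<mu>"
    unfolding mass_bound_def current_map_def
    using tight_elementary_form_bound[OF tight] D.finite_dual_measure[OF tight] D.sets_dual_measure[of F] by blast
  show "is_local (current_map F)"
    unfolding is_local_def current_map_def using elementary_form_local by (metis blinfun.zero_right)
qed

text \<open>\<open>extends\<close> asks for the bound by the least mass on all bounded continuous
  functions; it passes from Lipschitz ones to the limit because the dual measure already bounds the
  functional.\<close>

lemma current_map_induces:
  fixes F :: "('a::polish_space, 'n::finite) dform \<Rightarrow>\<^sub>L real"
  assumes tight: "D.tight F" and cur: "current (current_map F)"
  shows "induces (current_map F) F"
proof -
  let ?L = "\<lambda>v. F (abs_dform v)"
  have lin: "linear ?L"
    using linear_compose[OF linear_abs_dform, of F] by (simp add: o_def bounded_linear.linear[OF blinfun.bounded_linear_right])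
  have eq: "?L (form f \<pi>) = current_map F f \<pi>" for f \<pi> by (simp add: current_map_def elementary_form_def)
  have "\<bar>?L (form f \<pi>)\<bar> \<le> (\<Prod>j\<in>UNIV. Lip (\<pi> j)) * (\<integral>x. \<bar>f x\<bar> \<partial>mass (current_map F))" for f \<pi>
  proof (rule extends_bound_limit[OF lin D.finite_dual_measure[OF tight] D.sets_dual_measure _
      finite_mass[OF cur] sets_mass[OF cur]])
    show "\<bar>?L (form f \<pi>)\<bar> \<le> (\<Prod>j\<in>UNIV. Lip (\<pi> j)) * (\<integral>x. \<bar>f x\<bar> \<partial>D.dual_measure F)" for f \<pi>
      using tight_elementary_form_bound[OF tight, of f \<pi>] by (simp add: elementary_form_def)
    show "\<bar>?L (form f \<pi>)\<bar> \<le> (\<Prod>j\<in>UNIV. Lip (\<pi> j)) * (\<integral>x. \<bar>f x\<bar> \<partial>mass (current_map F))"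
      if "f \<in> LIPb" for f \<pi>
      unfolding eq by (rule current_mass_le[OF cur that])
  qed
  then show ?thesis unfolding induces_def extends_def using lin eq by blast
qed

text \<open>The dual measure is a mass bound of total mass at most \<open>norm F\<close>, and the
  mass is the least one.\<close>

lemma mass_le_dual_norm:
  assumes T: "current T" and F: "induces T F" and tight: "D.tight F"
  shows "measure (mass T) UNIV \<le> norm F"
proof -
  have "T f \<pi> = F (elementary_form f \<pi>)" if "f \<in> LIPb" for f \<pi>
    using F that by (simp add: induces_def extends_def elementary_form_def)
  then have "mass_bound T (D.dual_measure F)"
    unfolding mass_bound_def
    using tight_elementary_form_bound[OF tight] D.finite_dual_measure[OF tight] D.sets_dual_measure[of F] by auto
  then have "emeasure (mass T) UNIV \<le> emeasure (D.dual_measure F) UNIV"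
    by (intro mass_le[OF T]) auto
  also have "\<dots> \<le> ennreal (norm F)"
    by (simp add: D.emeasure_dual_measure_open[OF tight] D.open_mass_le_norm)
  finally show ?thesis by (simp add: finite_measure.emeasure_eq_measure[OF finite_mass[OF T]])
qed

section \<open>From currents to local vector measures\<close>

text \<open>When the norms themselves are additive, all partitions give the same sum.\<close>

lemma total_variation_eq:
  fixes N :: "'a::topological_space set \<Rightarrow> 'v::real_normed_vector \<Rightarrow>\<^sub>L real"
  assumes \<mu>: "sets \<mu> = sets borel" and N: "\<And>A. A \<in> sets borel \<Longrightarrow> ennreal (norm (N A)) = emeasure \<mu> A"
    and B: "B \<in> sets borel"
  shows "total_variation N B = emeasure \<mu> B"
proof -
  let ?P = "{P. finite P \<and> P \<subseteq> sets borel \<and> partition_on B P}"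
  have "(\<Sum>A\<in>P. ennreal (norm (N A))) = emeasure \<mu> B" if P: "P \<in> ?P" for P
  proof -
    have "(\<Sum>A\<in>P. ennreal (norm (N A))) = (\<Sum>A\<in>P. emeasure \<mu> A)"
      using P by (intro sum.cong N) auto
    also have "\<dots> = emeasure \<mu> (\<Union>A\<in>P. A)"
      using P by (intro sum_emeasure)
        (auto simp: \<mu> partition_on_def disjoint_family_on_def disjoint_def)
    also have "(\<Union>A\<in>P. A) = B" using P by (auto simp: partition_on_def)
    finally show ?thesis .
  qed
  \<comment> \<open>A partition has no empty member, so the empty set is partitioned by the empty
    family.\<close>
  moreover have "(if B = {} then {} else {B}) \<in> ?P"
    using B by (auto simp: partition_on_def)
  ultimately show ?thesis
    unfolding total_variation_def by (intro antisym SUP_least) (auto intro: SUP_upper2)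
qed

lemma current_lvm:
  fixes T :: "('a::polish_space, 'n::finite) precurrent"
  assumes T: "current T"
  obtains F N where "induces T F" "D.tight F" "D.local_vector_measure N" "N UNIV = F"
    "\<And>A. A \<in> sets borel \<Longrightarrow> ennreal (norm (N A)) = emeasure (mass T) A"
proof -
  note fin = finite_mass[OF T] and s = sets_mass[OF T]
  interpret finite_measure "mass T" by (rule fin)
  obtain F where F: "induces T F"
    and bound: "\<And>g v. \<bar>F (dform_mult g v)\<bar> \<le> norm v * (\<integral>x. \<bar>g x\<bar> \<partial>mass T)"
    using induces_exists[OF T] by blast
  have tight: "D.tight F" by (rule D.mass_bounded_tight[OF fin s bound])
  obtain N where N: "D.local_vector_measure N" "N UNIV = F"
    and le: "\<And>A. A \<in> sets borel \<Longrightarrow> norm (N A) \<le> measure (mass T) A"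
    using D.lvm_exists[OF fin s bound] by blast
  have "norm (N A) = measure (mass T) A" if A: "A \<in> sets borel" for A
  proof (rule antisym[OF le[OF A]])
    \<comment> \<open>Equality of the totals, together with the upper bound on A and on its
      complement, forces equality on each.\<close>
    have "measure (mass T) UNIV \<le> norm (N A + N (- A))"
      using mass_le_dual_norm[OF T F tight] D.lvm_Compl[OF N(1) A] by (simp add: N(2))
    also have "\<dots> \<le> norm (N A) + measure (mass T) (- A)"
      using le[of "- A"] A norm_triangle_ineq[of "N A" "N (- A)"] by simp
    finally show "measure (mass T) A \<le> norm (N A)"
      using finite_measure_compl[of A] A by (simp add: s space_mass[OF T] Compl_eq_Diff_UNIV)
  qed
  then have "ennreal (norm (N A)) = emeasure (mass T) A" if "A \<in> sets borel" for A
    using that by (simp add: emeasure_eq_measure)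
  with F tight N show ?thesis by (rule that)
qed

theorem proposition1p36:
  shows "(\<forall>T :: ('a::polish_space, 'n::finite) precurrent. current T \<longrightarrow>
      (\<exists>F. induces T F \<and> D.tight F \<and>
        (\<exists>N. D.local_vector_measure N \<and>
          (\<forall>A v. open A \<and> D.supp_in v A \<longrightarrow> N A v = F v) \<and>
          (\<forall>N'. D.local_vector_measure N' \<and> (\<forall>A v. open A \<and> D.supp_in v A \<longrightarrow> N' A v = F v)
             \<longrightarrow> (\<forall>B\<in>sets borel. N' B = N B)) \<and>
          (\<forall>B\<in>sets borel. emeasure (mass T) B = total_variation N B)))) \<and>
    (\<forall>F :: ('a, 'n) dform \<Rightarrow>\<^sub>L real.
      D.tight F \<and> seq_continuous (current_map F) \<longrightarrow> current (current_map F)) \<and>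
    (\<forall>N :: 'a set \<Rightarrow> ('a, 'n) dform \<Rightarrow>\<^sub>L real.
      D.local_vector_measure N \<and> seq_continuous (current_map (N UNIV)) \<longrightarrow>
      (\<exists>T F. current T \<and> induces T F \<and> (\<forall>A v. open A \<and> D.supp_in v A \<longrightarrow> N A v = F v)))"
proof (intro conjI allI impI)
  fix T :: "('a, 'n) precurrent" assume T: "current T"
  obtain F N where F: "induces T F" "D.tight F" and N: "D.local_vector_measure N" "N UNIV = F"
    and norm: "\<And>A. A \<in> sets borel \<Longrightarrow> ennreal (norm (N A)) = emeasure (mass T) A"
    using current_lvm[OF T] by blast
  \<comment> \<open>Borel measurability of open sets suffices for \<open>lvm_supp_in\<close>, which
    identifies \<open>N A v\<close> with the value of F = \<open>N UNIV\<close>.\<close>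
  have supp: "\<forall>A v. open A \<and> D.supp_in v A \<longrightarrow> N A v = F v"
    using D.lvm_supp_in[OF N(1)] N(2) by (metis borel_open)
  have "\<forall>B\<in>sets borel. N' B = N B"
    if N': "D.local_vector_measure N'" "\<forall>A v. open A \<and> D.supp_in v A \<longrightarrow> N' A v = F v" for N'
    using D.lvm_unique[OF N(1) N'(1)] N'(2) supp by metis
  moreover have "\<forall>B\<in>sets borel. emeasure (mass T) B = total_variation N B"
    using total_variation_eq[OF sets_mass[OF T], of N] norm by metis
  ultimately show "\<exists>F. induces T F \<and> D.tight F \<and>
        (\<exists>N. D.local_vector_measure N \<and>
          (\<forall>A v. open A \<and> D.supp_in v A \<longrightarrow> N A v = F v) \<and>
          (\<forall>N'. D.local_vector_measure N' \<and> (\<forall>A v. open A \<and> D.supp_in v A \<longrightarrow> N' A v = F v)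
             \<longrightarrow> (\<forall>B\<in>sets borel. N' B = N B)) \<and>
          (\<forall>B\<in>sets borel. emeasure (mass T) B = total_variation N B))"
    using F N(1) supp by blast
next
  fix F :: "('a, 'n) dform \<Rightarrow>\<^sub>L real" assume "D.tight F \<and> seq_continuous (current_map F)"
  then show "current (current_map F)" using current_map_current by blast
next
  fix N :: "'a set \<Rightarrow> ('a, 'n) dform \<Rightarrow>\<^sub>L real"
  assume *: "D.local_vector_measure N \<and> seq_continuous (current_map (N UNIV))"
  \<comment> \<open>The required current is the map of \<open>N UNIV\<close>, which is tight because
    N is a local vector measure.\<close>
  then have tight: "D.tight (N UNIV)" by (intro D.lvm_tight) simp
  with * have cur: "current (current_map (N UNIV))" by (intro current_map_current) auto
  moreover have "induces (current_map (N UNIV)) (N UNIV)" by (rule current_map_induces[OF tight cur])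
  moreover have "\<forall>A v. open A \<and> D.supp_in v A \<longrightarrow> N A v = N UNIV v"
    using D.lvm_supp_in[of N] * by (metis borel_open)
  ultimately show "\<exists>T F. current T \<and> induces T F \<and> (\<forall>A v. open A \<and> D.supp_in v A \<longrightarrow> N A v = F v)"
    by blast
qed

end
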